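(* Let $X$ be a super-Brownian motion on $\mathbb{R}^d$ ($d\ge1$) with branching mechanism $\Psi$. Suppose there is a spatially constant (sub)critical branching mechanism $\Phi$ satisfying the Keller–Osserman condition such that $$\Phi(u)\le\Psi(x,u),\qquad x\in\mathbb{R}^d,\ u\ge0 .$$ Then for every $\mu\in M_c$ and $t>0$, $$\mathbb{P}_\mu\left\{\overline{\bigcup_{s\le t}S(X_s)}\text{ is compact}\right\}=1 .$$ Moreover, $\mathbb{P}_\mu\{\mathscr{R}(X)\text{ is compact}\}=1$ for every $\mu\in M_c$.
   Context: $P_x$ denotes the law of, and expectation for, a standard $d$-dimensional Brownian motion $W$ started at $x$. Branching mechanisms. A (general) branching mechanism is a function $\Psi:\mathbb{R}^d\times[0,\infty)\to\mathbb{R}$, $$\Psi(x,u)=\alpha(x)u+\beta(x)u^2+\int_0^\infty(e^{-\lambda u}-1+\lambda u)\,\pi(x,\mathrm{d}\lambda),$$ with $\alpha,\beta$ bounded continuous on $\mathbb{R}^d$, $\beta\ge 0$, and $(\lambda\wedge\lambda^2)\pi(x,\mathrm{d}\lambda)$ a bounded kernel from $\mathbb{R}^d$ to $(0,\infty)$. It is spatially constant, written $\Phi(u)$, if $\alpha,\beta,\pi$ do not depend on $x$. It is subcritical if $\alpha(x)>0$ for all $x$, critical if $\alpha\equiv0$; (sub)critical means critical or subcritical. Standing assumptions: every branching mechanism is (sub)critical and non-degenerate, i.e. $\alpha(x)+\beta(x)+\pi(x,(0,\infty))>0$ for all $x$ (for spatially constant ones, $\alpha+\beta+\pi((0,\infty))>0$).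 Keller–Osserman condition for a spatially constant (sub)critical $\Phi$: $\int_\theta^\infty\big(\int_0^\lambda\Phi(u)\,\mathrm{d}u\big)^{-1/2}\mathrm{d}\lambda<\infty$ for some $\theta>0$. Measures. $M_F$ is the space of finite measures on $\mathbb{R}^d$ with the weak topology; $S(\mu)$ is the topological support of $\mu$; $M_c\subset M_F$ is the set of measures with compact support; $\langle f,\mu\rangle=\int f\,\mathrm{d}\mu$. $\overline{A}$ denotes the closure of a set $A$. Super-Brownian motion with branching mechanism $\Psi$: the càdlàg $M_F$-valued Markov process $X=(X_t)_{t\ge0}$ (canonical Borel right realization on Skorokhod space), with law $\mathbb{P}_\mu$ when $X_0=\mu$, such that for bounded measurable $f\ge0$, $\mathbb{P}_\mu[\exp(-\langle f,X_t\rangle)]=\exp(-\langle v(\cdot,t),\mu\rangle)$, where $v$ is the unique non-negative solution of $v(x,t)=P_x[f(W_t)]-P_x\big[\int_0^t\Psi(W_s,v(W_s,t-s))\,\mathrm{d}s\big]$. The range of $X$ is $\mathscr{R}(X):=\overline{\bigcup_{t\ge0}S(X_t)}$. *)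

theory Defs
  imports "HOL-Probability.Probability"
begin

section \<open>Branching mechanisms\<close>

text \<open>A function \<open>\<Psi>(x, u)\<close> is only meaningful for \<open>u \<ge> 0\<close>; its values at negative \<open>u\<close> are
  unconstrained. The possibly infinite measures \<open>\<pi> x\<close> live on the space \<open>{0<..}\<close>, and the
  boundedness of the kernel makes the integrand defining \<open>\<Psi>\<close> Bochner integrable.\<close>

definition bounded_jump_kernel :: "('a::euclidean_space \<Rightarrow> real measure) \<Rightarrow> bool" where
  "bounded_jump_kernel \<pi> \<longleftrightarrow>
     (\<forall>x. sets (\<pi> x) = sets (restrict_space borel {0<..})) \<and>
     (\<forall>A\<in>sets (restrict_space borel {0<..}).
        (\<lambda>x. emeasure (density (\<pi> x) (\<lambda>l. ennreal (min l (l\<^sup>2)))) A) \<in> borel_measurable borel) \<and>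
     (\<exists>C::real. \<forall>x. emeasure (density (\<pi> x) (\<lambda>l. ennreal (min l (l\<^sup>2)))) {0<..} \<le> ennreal C)"

definition has_branching_triple ::
    "('a::euclidean_space \<Rightarrow> real \<Rightarrow> real) \<Rightarrow> ('a \<Rightarrow> real) \<Rightarrow> ('a \<Rightarrow> real) \<Rightarrow> ('a \<Rightarrow> real measure) \<Rightarrow> bool"
  where
  "has_branching_triple \<Psi> \<alpha> \<beta> \<pi> \<longleftrightarrow>
     continuous_on UNIV \<alpha> \<and> bounded (range \<alpha>) \<and>
     continuous_on UNIV \<beta> \<and> bounded (range \<beta>) \<and> (\<forall>x. 0 \<le> \<beta> x) \<and>
     bounded_jump_kernel \<pi> \<and>
     (\<forall>x. \<forall>u\<ge>0. \<Psi> x u = \<alpha> x * u + \<beta> x * u\<^sup>2 + (\<integral>l. (exp (- l * u) - 1 + l * u) \<partial>\<pi> x))"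

definition subcritical :: "('a \<Rightarrow> real) \<Rightarrow> bool" where
  "subcritical \<alpha> \<longleftrightarrow> (\<forall>x. 0 < \<alpha> x)"

definition critical :: "('a \<Rightarrow> real) \<Rightarrow> bool" where
  "critical \<alpha> \<longleftrightarrow> (\<forall>x. \<alpha> x = 0)"

text \<open>The sum is taken in \<open>ereal\<close> because \<open>\<pi> x\<close> may have infinite total mass.\<close>

definition nondegenerate ::
    "('a \<Rightarrow> real) \<Rightarrow> ('a \<Rightarrow> real) \<Rightarrow> ('a \<Rightarrow> real measure) \<Rightarrow> bool" where
  "nondegenerate \<alpha> \<beta> \<pi> \<longleftrightarrow>
     (\<forall>x. 0 < ereal (\<alpha> x + \<beta> x) + enn2ereal (emeasure (\<pi> x) {0<..}))"

text \<open>The standing assumptions ((sub)criticality and non-degeneracy) are part of the following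
  two notions.\<close>

definition branching_mechanism :: "('a::euclidean_space \<Rightarrow> real \<Rightarrow> real) \<Rightarrow> bool" where
  "branching_mechanism \<Psi> \<longleftrightarrow>
     (\<exists>\<alpha> \<beta> \<pi>. has_branching_triple \<Psi> \<alpha> \<beta> \<pi> \<and>
       (subcritical \<alpha> \<or> critical \<alpha>) \<and> nondegenerate \<alpha> \<beta> \<pi>)"

definition spatially_constant_branching_mechanism ::
    "('a::euclidean_space \<Rightarrow> real \<Rightarrow> real) \<Rightarrow> bool" where
  "spatially_constant_branching_mechanism \<Psi> \<longleftrightarrow>
     (\<exists>a b p. has_branching_triple \<Psi> (\<lambda>_. a) (\<lambda>_. b) (\<lambda>_. p) \<and>
       (subcritical (\<lambda>_::'a. a) \<or> critical (\<lambda>_::'a. a)) \<and>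
       nondegenerate (\<lambda>_::'a. a) (\<lambda>_. b) (\<lambda>_. p))"

text \<open>The outer integral is taken in \<open>[0, \<infinity>]\<close>, where \<open>1 / 0 = \<infinity>\<close>.\<close>

definition keller_osserman :: "(real \<Rightarrow> real) \<Rightarrow> bool" where
  "keller_osserman \<Phi> \<longleftrightarrow>
     (\<exists>\<theta>>0. (\<integral>\<^sup>+ l\<in>{\<theta>..}. (1 / ennreal (sqrt (LBINT u:{0..l}. \<Phi> u))) \<partial>lborel) < \<infinity>)"

section \<open>Brownian motion\<close>

definition standard_brownian_motion ::
    "'w measure \<Rightarrow> 'a::euclidean_space \<Rightarrow> (real \<Rightarrow> 'w \<Rightarrow> 'a) \<Rightarrow> bool" where
  "standard_brownian_motion M x W \<longleftrightarrow>
     prob_space M \<and>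
     (\<forall>t\<ge>0. W t \<in> borel_measurable M) \<and>
     (AE \<omega> in M. W 0 \<omega> = x) \<and>
     (\<forall>\<omega>\<in>space M. continuous_on {0..} (\<lambda>t. W t \<omega>)) \<and>
     (\<forall>s t. 0 \<le> s \<and> s < t \<longrightarrow>
        distributed M lborel (\<lambda>\<omega>. W t \<omega> - W s \<omega>)
          (\<lambda>y. ennreal (\<Prod>b\<in>Basis. normal_density 0 (sqrt (t - s)) (y \<bullet> b)))) \<and>
     (\<forall>(\<tau>::nat \<Rightarrow> real) n. mono \<tau> \<and> 0 \<le> \<tau> 0 \<longrightarrow>
        prob_space.indep_vars M (\<lambda>_. borel) (\<lambda>i \<omega>. W (\<tau> (Suc i)) \<omega> - W (\<tau> i) \<omega>) {..<n})"

section \<open>Finite measures and the weak topology\<close>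

definition finite_measures :: "'a::euclidean_space measure set" where
  "finite_measures = {\<mu>. sets \<mu> = sets borel \<and> finite_measure \<mu>}"

text \<open>The coarsest topology on \<open>finite_measures\<close> that makes every map \<open>\<mu> \<mapsto> \<langle>f, \<mu>\<rangle>\<close> with
  \<open>f\<close> bounded and continuous, continuous.\<close>

definition weak_topology :: "'a::euclidean_space measure topology" where
  "weak_topology = topology_generated_by
     {{\<mu> \<in> finite_measures. (\<integral>x. f x \<partial>\<mu>) \<in> U} | (f :: 'a \<Rightarrow> real) U.
        continuous_on UNIV f \<and> bounded (range f) \<and> open U}"

lemma topspace_weak_topology: "topspace weak_topology = finite_measures"
proof -
  have "finite_measures \<in> {{\<mu> \<in> finite_measures. (\<integral>x. f x \<partial>\<mu>) \<in> U} | (f :: 'a \<Rightarrow> real) U.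
        continuous_on UNIV f \<and> bounded (range f) \<and> open U}"
    by (rule CollectI, rule exI[of _ "\<lambda>_. 0"], rule exI[of _ UNIV]) auto
  then show ?thesis
    unfolding weak_topology_def topology_generated_by_topspace by blast
qed

definition finite_measure_borel :: "'a::euclidean_space measure measure" where
  "finite_measure_borel = sigma finite_measures {U. openin weak_topology U}"

definition measure_support :: "'a::euclidean_space measure \<Rightarrow> 'a set" where
  "measure_support \<mu> = {x. \<forall>U. open U \<and> x \<in> U \<longrightarrow> 0 < emeasure \<mu> U}"

definition compactly_supported_measures :: "'a::euclidean_space measure set" where
  "compactly_supported_measures = {\<mu> \<in> finite_measures. compact (measure_support \<mu>)}"

section \<open>Super-Brownian motion\<close>

definition cadlag_paths :: "(real \<Rightarrow> 'a::euclidean_space measure) set" where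
  "cadlag_paths = {\<omega> \<in> {0..} \<rightarrow>\<^sub>E finite_measures.
     (\<forall>t\<ge>0. limitin weak_topology \<omega> (\<omega> t) (at_right t)) \<and>
     (\<forall>t>0. \<exists>\<nu>. limitin weak_topology \<omega> \<nu> (at_left t))}"

text \<open>Skorokhod space carries the \<open>\<sigma>\<close>-algebra generated by the coordinate maps, which is also the
  Borel \<open>\<sigma>\<close>-algebra of the Skorokhod topology. The canonical process is \<open>X\<^sub>t(\<omega>) = \<omega>(t)\<close>; only the
  measurable structure of this space is used.\<close>

definition skorokhod_space :: "(real \<Rightarrow> 'a::euclidean_space measure) measure" where
  "skorokhod_space = restrict_space (PiM {0..} (\<lambda>_. finite_measure_borel)) cadlag_paths"

definition canonical_filtration :: "real \<Rightarrow> (real \<Rightarrow> 'a::euclidean_space measure) measure" where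
  "canonical_filtration s =
     sigma cadlag_paths
       {{\<omega> \<in> cadlag_paths. \<omega> r \<in> B} | r B. 0 \<le> r \<and> r \<le> s \<and> B \<in> sets finite_measure_borel}"

text \<open>A time-homogeneous Markov family of laws on Skorokhod space, indexed by the initial state.\<close>

definition cadlag_markov_family ::
    "('a::euclidean_space measure \<Rightarrow> (real \<Rightarrow> 'a measure) measure) \<Rightarrow> bool" where
  "cadlag_markov_family \<P> \<longleftrightarrow>
     (\<forall>\<mu>\<in>finite_measures.
        prob_space (\<P> \<mu>) \<and> sets (\<P> \<mu>) = sets skorokhod_space \<and> (AE \<omega> in \<P> \<mu>. \<omega> 0 = \<mu>)) \<and>
     (\<forall>A\<in>sets skorokhod_space. (\<lambda>\<mu>. measure (\<P> \<mu>) A) \<in> borel_measurable finite_measure_borel) \<and>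
     (\<forall>\<mu>\<in>finite_measures. \<forall>s\<ge>0. \<forall>t\<ge>0. \<forall>B\<in>sets finite_measure_borel.
        AE \<omega> in \<P> \<mu>.
          real_cond_exp (\<P> \<mu>) (canonical_filtration s) (\<lambda>\<eta>. indicator B (\<eta> (s + t))) \<omega> =
          measure (\<P> (\<omega> s)) {\<eta> \<in> space (\<P> (\<omega> s)). \<eta> t \<in> B})"

text \<open>\<open>v\<close> is a non-negative solution of the integral equation with initial value \<open>f\<close>, where
  \<open>P x\<close> is the law of the Brownian motion \<open>W\<close> started at \<open>x\<close>. Measurability and local boundedness
  are what gives the right-hand side its meaning. Since \<open>\<Psi> \<ge> 0\<close>, the equation itself forces
  \<open>0 \<le> v \<le> sup f\<close>, and as \<open>\<Psi> x\<close> is Lipschitz on bounded intervals uniformly in \<open>x\<close>, there is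
  at most one solution by Gronwall's inequality.\<close>

definition cumulant_solution ::
    "('a::euclidean_space \<Rightarrow> 'w measure) \<Rightarrow> (real \<Rightarrow> 'w \<Rightarrow> 'a) \<Rightarrow> ('a \<Rightarrow> real \<Rightarrow> real) \<Rightarrow>
     ('a \<Rightarrow> real) \<Rightarrow> ('a \<Rightarrow> real \<Rightarrow> real) \<Rightarrow> bool" where
  "cumulant_solution P W \<Psi> f v \<longleftrightarrow>
     (\<lambda>(x, t). v x t) \<in> borel_measurable (restrict_space borel (UNIV \<times> {0..})) \<and>
     (\<forall>x. \<forall>t\<ge>0. 0 \<le> v x t) \<and>
     (\<forall>T. bounded ((\<lambda>(x, t). v x t) ` (UNIV \<times> {0..T}))) \<and>
     (\<forall>x. \<forall>t\<ge>0. v x t =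
        (\<integral>\<omega>. f (W t \<omega>) \<partial>P x) - (\<integral>\<omega>. (LBINT s:{0..t}. \<Psi> (W s \<omega>) (v (W s \<omega>) (t - s))) \<partial>P x))"

definition super_brownian_motion ::
    "('a::euclidean_space \<Rightarrow> 'w measure) \<Rightarrow> (real \<Rightarrow> 'w \<Rightarrow> 'a) \<Rightarrow> ('a \<Rightarrow> real \<Rightarrow> real) \<Rightarrow>
     ('a measure \<Rightarrow> (real \<Rightarrow> 'a measure) measure) \<Rightarrow> bool" where
  "super_brownian_motion P W \<Psi> \<P> \<longleftrightarrow>
     cadlag_markov_family \<P> \<and>
     (\<forall>f :: 'a \<Rightarrow> real. f \<in> borel_measurable borel \<and> bounded (range f) \<and> (\<forall>x. 0 \<le> f x) \<longrightarrow>
        (\<exists>v. cumulant_solution P W \<Psi> f v \<and>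
          (\<forall>\<mu>\<in>finite_measures. \<forall>t\<ge>0.
             (\<integral>\<omega>. exp (- (\<integral>x. f x \<partial>\<omega> t)) \<partial>\<P> \<mu>) = exp (- (\<integral>x. v x t \<partial>\<mu>)))))"

definition range_up_to :: "real \<Rightarrow> (real \<Rightarrow> 'a::euclidean_space measure) \<Rightarrow> 'a set" where
  "range_up_to t \<omega> = closure (\<Union>s\<in>{0..t}. measure_support (\<omega> s))"

definition total_range :: "(real \<Rightarrow> 'a::euclidean_space measure) \<Rightarrow> 'a set" where
  "total_range \<omega> = closure (\<Union>s\<in>{0..}. measure_support (\<omega> s))"

end

theory Submission
  imports Defs
begin

text \<open>
  It suffices to confine the supports to each of the half-spaces \<open>{x. c * (x \<bullet> b) \<le> R}\<close> with
  \<open>b \<in> Basis\<close> and \<open>c = \<plusminus>1\<close>, which is a one-dimensional problem in \<open>y = c * (x \<bullet> b)\<close>.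
  The Keller-Osserman condition says that the steps \<open>(A\<^sub>n / \<Phi>(A\<^sub>n))\<^sup>1\<^sup>/\<^sup>2\<close> with
  \<open>A\<^sub>n = 2\<^sup>n \<delta>\<close> are summable, and hence there are bounded barriers \<open>w\<close>, built from arcs of
  parabolas with concave kinks, such that \<open>w = \<delta>\<close> near the support of \<open>\<mu>\<close>,
  \<open>w'' \<le> \<Phi>(w)\<close> in a generalized sense, and \<open>w\<close> is an arbitrarily large constant beyond a
  threshold \<open>R\<close> that does not depend on that constant.

  Let \<open>f\<close> be a bounded function of \<open>y\<close> that is positive exactly for \<open>y > R\<close>. If
  \<open>\<theta> f < \<Phi>(w) / 2\<close>, then the integral equation shows \<open>V\<^sub>h (w + h \<theta> f) \<le> w\<close> for the cumulant
  semigroup \<open>V\<close> and small \<open>h\<close>. By the Markov property, the Laplace functional of the Riemann sum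
  \<open>h \<Sum>\<^sub>i \<langle>f, X\<^sub>i\<^sub>h\<rangle>\<close> at \<open>\<theta>\<close> is at least \<open>exp (- \<langle>w, \<mu>\<rangle>) = exp (- \<delta> \<mu>(\<real>\<^sup>d))\<close>.
  Letting \<open>h \<rightarrow> 0\<close> and then \<open>\<theta> \<rightarrow> \<infinity>\<close>, right-continuity of the paths yields
  \<open>\<langle>f, X\<^sub>t\<rangle> = 0\<close> for all \<open>t\<close> with at least that probability, which tends to \<open>1\<close> as \<open>\<delta> \<rightarrow> 0\<close>.
\<close>

section \<open>Branching mechanisms\<close>

text \<open>The process is accessible only through its one-time Laplace functional and the Markov
  property, so the analysis takes place in a single short step of length \<open>h\<close>. Over such
  a step a super-solution should satisfy \<open>w'' / 2 \<le> \<Phi>(w) - \<theta> f\<close>, as the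
  generator of Brownian motion is half the Laplacian. The barriers are built for
  \<open>w'' \<le> \<Phi>(w)\<close>, which leaves half of \<open>\<Phi>(w)\<close> unspent: it pays
  for \<open>\<theta> f\<close> and for errors of order \<open>h\<^sup>3\<^sup>/\<^sup>2\<close>.
  Kinks are handled by asking only for a Taylor bound from above at each point, with some slope and
  a quartic remainder: Brownian increments are centred, have variance \<open>h\<close> and fourth
  moment \<open>3 * h\<^sup>2\<close>. The barriers are kept bounded, in place of the classical
  solutions that blow up at a finite distance, because the cumulant equation takes bounded initial
  data and \<open>\<Phi>\<close> has Lipschitz constants on bounded intervals. Arbitrary heights
  take over the role of the blow-up, and the bound on the sum of the step lengths puts them all
  beyond one common threshold.\<close>

definition jump :: "real \<Rightarrow> real" where
  "jump x = exp (- x) - 1 + x"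

lemma jump_0 [simp]: "jump 0 = 0"
  by (simp add: jump_def)

lemma jump_nonneg: "0 \<le> jump x"
  using exp_ge_add_one_self[of "-x"] by (simp add: jump_def)

lemma jump_measurable [measurable]: "jump \<in> borel_measurable borel"
  unfolding jump_def by measurable

lemma jump_mono:
  assumes "0 \<le> x" "x \<le> y" shows "jump x \<le> jump y"
proof (rule DERIV_nonneg_imp_nondecreasing[OF assms(2)])
  fix t assume "x \<le> t" "t \<le> y"
  then show "\<exists>D. (jump has_real_derivative D) (at t) \<and> 0 \<le> D"
    using assms unfolding jump_def
    by (intro exI[of _ "1 - exp (- t)"]) (auto intro!: derivative_eq_intros)
qed

text \<open>The derivative \<open>1 - exp (- t)\<close> is at most 1 and at most \<open>t\<close>.
  The first bound suits large jumps and the second small ones, matching the weight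
  \<open>min l (l\<^sup>2)\<close> of the kernel.\<close>

lemma jump_diff_le:
  assumes "0 \<le> x" "x \<le> y"
  shows "jump y - jump x \<le> min 1 y * (y - x)"
proof (cases "x = y")
  case False
  then have "x < y" using assms by simp
  then obtain t where t: "x < t" "t < y" "jump y - jump x = (y - x) * (1 - exp (- t))"
    using MVT2[of x y jump "\<lambda>t. 1 - exp (- t)"]
    unfolding jump_def by (force intro!: derivative_eq_intros)
  have "1 - exp (- t) \<le> min 1 y"
    using t exp_ge_add_one_self[of "-t"] by auto
  then show ?thesis
    using t(3) \<open>x < y\<close> by (simp add: mult.commute)
qed auto

text \<open>The difference of the two sides is a perfect square. Through \<open>double_ge\<close>
  this makes \<open>\<Phi> (2 ^ n * \<delta>)\<close> grow without bound, so that it can outweigh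
  any source \<open>\<theta> f\<close>.\<close>

lemma jump_double_ge: "2 * jump x \<le> jump (2 * x)"
proof -
  have "jump (2 * x) - 2 * jump x = (1 - exp (- x))\<^sup>2"
    by (simp add: jump_def power2_eq_square algebra_simps flip: exp_add)
  then show ?thesis
    by (metis diff_ge_0_iff_ge zero_le_power2)
qed

text \<open>The difference vanishes at 0 and has the derivative
  \<open>2 * (1 - exp (- t))\<^sup>2\<close>. The factor 4 allows \<open>\<Phi>\<close> on a dyadic
  block to be compared with its value at the left end.\<close>

lemma jump_double_le:
  assumes "0 \<le> x" shows "jump (2 * x) \<le> 4 * jump x"
proof -
  have "(\<lambda>t. 4 * jump t - jump (2 * t)) 0 \<le> (\<lambda>t. 4 * jump t - jump (2 * t)) x"
  proof (rule DERIV_nonneg_imp_nondecreasing[OF assms])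
    fix t
    have "((\<lambda>t. 4 * jump t - jump (2 * t)) has_real_derivative 2 * (1 - exp (- t))\<^sup>2) (at t)"
      unfolding jump_def
      by (auto intro!: derivative_eq_intros simp: power2_eq_square algebra_simps simp flip: exp_add)
    then show "\<exists>D. ((\<lambda>t. 4 * jump t - jump (2 * t)) has_real_derivative D) (at t) \<and> 0 \<le> D"
      by (intro exI[of _ "2 * (1 - exp (- t))\<^sup>2"]) simp
  qed
  then show ?thesis by simp
qed

text \<open>For \<open>l \<le> 1\<close> the bound \<open>min 1 (l * v) \<le> l * v\<close> produces
  \<open>l\<^sup>2\<close>, and for \<open>l > 1\<close> the bound by 1 produces \<open>l\<close>;
  the factor \<open>1 + v\<close> covers both cases.\<close>

lemma jump_scaled_diff_le:
  assumes "0 < l" "0 \<le> u" "u \<le> v"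
  shows "jump (l * v) - jump (l * u) \<le> (1 + v) * (v - u) * min l (l\<^sup>2)"
proof -
  have "jump (l * v) - jump (l * u) \<le> min 1 (l * v) * (l * v - l * u)"
    using assms by (intro jump_diff_le) (auto intro: mult_left_mono)
  also have "\<dots> = (min 1 (l * v) * l) * (v - u)" by (simp add: algebra_simps)
  also have "\<dots> \<le> ((1 + v) * min l (l\<^sup>2)) * (v - u)"
  proof (rule mult_right_mono)
    show "min 1 (l * v) * l \<le> (1 + v) * min l (l\<^sup>2)"
    proof (cases "l \<le> 1")
      case True
      then have "min l (l\<^sup>2) = l\<^sup>2"
        using assms by (simp add: power2_eq_square mult_left_le)
      moreover have "min 1 (l * v) * l \<le> (l * v) * l" using assms by (intro mult_right_mono) auto
      ultimately show ?thesis by (simp add: power2_eq_square algebra_simps add_increasing)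
    next
      case False
      then have "min l (l\<^sup>2) = l"
        by (simp add: power2_eq_square)
      moreover have "min 1 (l * v) * l \<le> 1 * l" using assms by (intro mult_right_mono) auto
      moreover have "1 * l \<le> (1 + v) * l" using assms by (intro mult_right_mono) auto
      ultimately show ?thesis by simp
    qed
  qed (use assms in auto)
  finally show ?thesis by (simp add: mult_ac)
qed

section \<open>Integrability with respect to the jump kernel\<close>

lemma jump_kernel_measurable:
  fixes f :: "real \<Rightarrow> 'b::topological_space"
  assumes "bounded_jump_kernel \<pi>" "f \<in> borel_measurable borel"
  shows "f \<in> borel_measurable (\<pi> x)"
proof -
  have "sets (\<pi> x) = sets (restrict_space borel {0<..})"
    using assms(1) by (auto simp: bounded_jump_kernel_def)
  then have "measurable (\<pi> x) (borel :: 'b measure) = borel_measurable (restrict_space borel {0<..})"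
    by (intro measurable_cong_sets) auto
  then show ?thesis
    using measurable_restrict_space1[OF assms(2), of "{0<..}"] by simp
qed

lemma jump_kernel_space:
  assumes "bounded_jump_kernel \<pi>"
  shows "space (\<pi> x) = {0<..}"
proof -
  have "sets (\<pi> x) = sets (restrict_space borel {0<..})"
    using assms(1) by (auto simp: bounded_jump_kernel_def)
  then show ?thesis
    by (simp add: sets_eq_imp_space_eq[of "\<pi> x"] space_restrict_space)
qed

lemma jump_kernel_bound:
  fixes \<pi> :: "'a::euclidean_space \<Rightarrow> real measure"
  assumes "bounded_jump_kernel \<pi>"
  obtains C where "0 \<le> C" "\<And>x. integrable (\<pi> x) (\<lambda>l. min l (l\<^sup>2))"
    "\<And>x. (\<integral>l. min l (l\<^sup>2) \<partial>\<pi> x) \<le> C"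
    "\<And>x. emeasure (density (\<pi> x) (\<lambda>l. ennreal (min l (l\<^sup>2)))) {0<..} \<le> ennreal C"
proof -
  obtain C where C: "emeasure (density (\<pi> x) (\<lambda>l. ennreal (min l (l\<^sup>2)))) {0<..} \<le> ennreal C" for x
    using assms by (auto simp: bounded_jump_kernel_def)
  have meas: "(\<lambda>l. min l (l\<^sup>2)) \<in> borel_measurable (\<pi> x)" for x
    by (rule jump_kernel_measurable[OF assms]) simp
  have "(\<integral>\<^sup>+l. ennreal (min l (l\<^sup>2)) \<partial>\<pi> x) = emeasure (density (\<pi> x) (\<lambda>l. ennreal (min l (l\<^sup>2)))) {0<..}" for x
  proof -
    have "{0<..} \<in> sets (\<pi> x)"
      using sets.top[of "\<pi> x"] by (simp add: jump_kernel_space[OF assms])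
    then show ?thesis
      using meas[of x] by (subst emeasure_density) 
        (auto simp: jump_kernel_space[OF assms] intro!: nn_integral_cong)
  qed
  with C have nn: "(\<integral>\<^sup>+l. ennreal (min l (l\<^sup>2)) \<partial>\<pi> x) \<le> ennreal (max 0 C)" for x
    by (smt (verit) ennreal_leI order_trans)
  have pos: "AE l in \<pi> x. 0 \<le> min l (l\<^sup>2)" for x
    by (rule AE_I2) (simp add: jump_kernel_space[OF assms])
  have int: "integrable (\<pi> x) (\<lambda>l. min l (l\<^sup>2))" for x
    using nn[of x] by (intro integrableI_nonneg meas pos) (auto simp: less_top[symmetric] top_unique)
  show ?thesis
  \<comment> \<open>The constant supplied by the definition may be negative, in which case
    \<open>ennreal C\<close> is 0.\<close>
  proof (rule that[of "max 0 C"])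
    show "(\<integral>l. min l (l\<^sup>2) \<partial>\<pi> x) \<le> max 0 C" for x
      using nn[of x] nn_integral_eq_integral[OF int pos, of x] by (simp add: max_def split: if_splits)
    show "emeasure (density (\<pi> x) (\<lambda>l. ennreal (min l (l\<^sup>2)))) {0<..} \<le> ennreal (max 0 C)" for x
      using C[of x] by (smt (verit) ennreal_leI order_trans)
  qed (use int in auto)
qed

lemma jump_kernel_integrable:
  assumes "bounded_jump_kernel \<pi>" "0 \<le> u"
  shows "integrable (\<pi> x) (\<lambda>l. jump (l * u))"
proof -
  obtain C where "integrable (\<pi> x) (\<lambda>l. min l (l\<^sup>2))"
    using jump_kernel_bound[OF assms(1)] by metis
  then have "integrable (\<pi> x) (\<lambda>l. (1 + u) * u * min l (l\<^sup>2))" by simp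
  then show ?thesis
  proof (rule Bochner_Integration.integrable_bound)
    show "(\<lambda>l. jump (l * u)) \<in> borel_measurable (\<pi> x)"
      by (rule jump_kernel_measurable[OF assms(1)]) simp
    show "AE l in \<pi> x. norm (jump (l * u)) \<le> norm ((1 + u) * u * min l (l\<^sup>2))"
    proof (rule AE_I2)
      fix l assume "l \<in> space (\<pi> x)"
      then have "0 < l" by (simp add: jump_kernel_space[OF assms(1)])
      then show "norm (jump (l * u)) \<le> norm ((1 + u) * u * min l (l\<^sup>2))"
        using jump_scaled_diff_le[of l 0 u] jump_nonneg[of "l * u"] assms(2) by (simp add: abs_mult)
    qed
  qed
qed

section \<open>Monotonicity, growth and regularity of a branching mechanism\<close>

locale branching_triple =
  fixes \<Psi> :: "'a::euclidean_space \<Rightarrow> real \<Rightarrow> real" and \<alpha> \<beta> \<pi>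
  assumes triple: "has_branching_triple \<Psi> \<alpha> \<beta> \<pi>" and \<alpha>_nonneg: "\<And>x. 0 \<le> \<alpha> x"
begin

lemma kernel: "bounded_jump_kernel \<pi>"
  and \<beta>_nonneg: "0 \<le> \<beta> x"
  and bounded_coeffs: "bounded (range \<alpha>)" "bounded (range \<beta>)"
  and continuous_coeffs: "continuous_on UNIV \<alpha>" "continuous_on UNIV \<beta>"
  using triple by (auto simp: has_branching_triple_def)

lemma eq: "0 \<le> u \<Longrightarrow> \<Psi> x u = \<alpha> x * u + \<beta> x * u\<^sup>2 + (\<integral>l. jump (l * u) \<partial>\<pi> x)"
  using triple by (simp add: has_branching_triple_def jump_def)

lemmas jump_integrable = jump_kernel_integrable[OF kernel]

lemma integral_jump_mono:
  fixes f g :: "real \<Rightarrow> real"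
  assumes "integrable (\<pi> x) f" "integrable (\<pi> x) g" "\<And>l. 0 < l \<Longrightarrow> f l \<le> g l"
  shows "(\<integral>l. f l \<partial>\<pi> x) \<le> (\<integral>l. g l \<partial>\<pi> x)"
  using assms by (intro integral_mono) (auto simp: jump_kernel_space[OF kernel])

lemma zero [simp]: "\<Psi> x 0 = 0"
  by (simp add: eq)

lemma mono: "0 \<le> u \<Longrightarrow> u \<le> v \<Longrightarrow> \<Psi> x u \<le> \<Psi> x v"
  using \<alpha>_nonneg[of x] \<beta>_nonneg[of x]
  by (simp add: eq) (intro add_mono mult_left_mono power_mono integral_jump_mono jump_integrable jump_mono; simp)

lemma nonneg: "0 \<le> u \<Longrightarrow> 0 \<le> \<Psi> x u"
  using mono[of 0 u x] by simp

lemma double_ge: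
  assumes "0 \<le> u" shows "2 * \<Psi> x u \<le> \<Psi> x (2 * u)"
proof -
  have "(\<integral>l. 2 * jump (l * u) \<partial>\<pi> x) \<le> (\<integral>l. jump (l * (2 * u)) \<partial>\<pi> x)"
    using assms jump_double_ge[of "_ * u"] by (intro integral_jump_mono integrable_mult_right jump_integrable) (auto simp: mult_ac)
  moreover have "2 * (\<beta> x * u\<^sup>2) \<le> \<beta> x * (2 * u)\<^sup>2"
    using \<beta>_nonneg[of x] by (simp add: power_mult_distrib)
  ultimately show ?thesis using assms by (simp add: eq)
qed

text \<open>Doubling \<open>u\<close> multiplies the linear part by 2, the quadratic part by 4 and
  the jump part by at most 4; the slack in the linear part is \<open>2 * \<alpha> x * u\<close>,
  which is non-negative.\<close>

lemma double_le:
  assumes "0 \<le> u" shows "\<Psi> x (2 * u) \<le> 4 * \<Psi> x u"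
proof -
  have "(\<integral>l. jump (l * (2 * u)) \<partial>\<pi> x) \<le> (\<integral>l. 4 * jump (l * u) \<partial>\<pi> x)"
  proof (intro integral_jump_mono integrable_mult_right jump_integrable)
    fix l :: real assume "0 < l"
    then show "jump (l * (2 * u)) \<le> 4 * jump (l * u)"
      using jump_double_le[of "l * u"] assms by (simp add: mult_ac)
  qed (use assms in auto)
  moreover have "0 \<le> u * \<alpha> x" using assms \<alpha>_nonneg[of x] by simp
  moreover have "(\<integral>l. 4 * jump (l * u) \<partial>\<pi> x) = 4 * (\<integral>l. jump (l * u) \<partial>\<pi> x)" by simp
  ultimately show ?thesis using assms by (simp only: eq power_mult_distrib) (simp add: eq power_mult_distrib)
qed

lemma lipschitz:
  obtains K where "0 \<le> K"
    "\<And>x u v. 0 \<le> u \<Longrightarrow> u \<le> v \<Longrightarrow> v \<le> m \<Longrightarrow> \<Psi> x v - \<Psi> x u \<le> K * (v - u)"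
proof -
  obtain C where C: "0 \<le> C" "\<And>x. integrable (\<pi> x) (\<lambda>l. min l (l\<^sup>2))"
    "\<And>x. (\<integral>l. min l (l\<^sup>2) \<partial>\<pi> x) \<le> C"
    using jump_kernel_bound[OF kernel] by metis
  obtain A where A: "0 \<le> A" "\<And>x. \<alpha> x \<le> A"
    using bounded_coeffs(1) by (auto simp: bounded_pos) (meson abs_le_D1 less_imp_le)
  obtain B where B: "0 \<le> B" "\<And>x. \<beta> x \<le> B"
    using bounded_coeffs(2) by (auto simp: bounded_pos) (meson abs_le_D1 less_imp_le)
  \<comment> \<open>The summands are Lipschitz constants of the linear, quadratic and jump parts on
    \<open>[0, m]\<close>, each uniform in \<open>x\<close>.\<close>
  define K where "K = A + B * (2 * \<bar>m\<bar>) + (1 + \<bar>m\<bar>) * C"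
  show ?thesis
  proof (rule that[of K])
    show "0 \<le> K" using A B C by (simp add: K_def)
    fix x u v assume uv: "0 \<le> u" "u \<le> v" "v \<le> m"
    have 1: "\<alpha> x * v - \<alpha> x * u \<le> A * (v - u)"
      using A(2)[of x] uv by (simp add: right_diff_distrib[symmetric] mult_right_mono)
    have "\<beta> x * v\<^sup>2 - \<beta> x * u\<^sup>2 = (\<beta> x * (v + u)) * (v - u)"
      by (simp add: power2_eq_square algebra_simps)
    also have "\<dots> \<le> (B * (2 * \<bar>m\<bar>)) * (v - u)"
      using B uv \<beta>_nonneg[of x] by (intro mult_right_mono mult_mono) auto
    finally have 2: "\<beta> x * v\<^sup>2 - \<beta> x * u\<^sup>2 \<le> (B * (2 * \<bar>m\<bar>)) * (v - u)" .
    have "(\<integral>l. jump (l * v) \<partial>\<pi> x) - (\<integral>l. jump (l * u) \<partial>\<pi> x) = (\<integral>l. jump (l * v) - jump (l * u) \<partial>\<pi> x)"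
      using uv jump_integrable[of v x] jump_integrable[of u x] by simp
    also have "\<dots> \<le> (\<integral>l. (1 + v) * (v - u) * min l (l\<^sup>2) \<partial>\<pi> x)"
      using uv C(2)[of x] jump_integrable[of v x] jump_integrable[of u x]
      by (intro integral_jump_mono jump_scaled_diff_le) auto
    also have "\<dots> = (1 + v) * (v - u) * (\<integral>l. min l (l\<^sup>2) \<partial>\<pi> x)" by simp
    also have "\<dots> \<le> (1 + \<bar>m\<bar>) * (v - u) * C"
      using uv C(1) C(3)[of x] by (intro mult_mono) (auto intro!: integral_nonneg_AE simp: jump_kernel_space[OF kernel])
    finally have "(\<integral>l. jump (l * v) \<partial>\<pi> x) - (\<integral>l. jump (l * u) \<partial>\<pi> x) \<le> ((1 + \<bar>m\<bar>) * C) * (v - u)"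
      by (simp add: mult_ac)
    with 1 2 show "\<Psi> x v - \<Psi> x u \<le> K * (v - u)"
      using uv by (simp add: eq K_def distrib_right)
  qed
qed

text \<open>The measures \<open>\<pi> x\<close> may be infinite, so they do not form a
  sub-probability kernel. The weight \<open>min l (l\<^sup>2)\<close> is therefore moved from the
  integrand into the measure: \<open>\<kappa> x\<close> has uniformly bounded mass, and a rescaling
  gives a kernel to which the measurability theorem for parametrized integrals applies. The
  \<open>max 0 u\<close> is there because \<open>\<Psi>\<close> is unconstrained at negative
  arguments. The result feeds the use of Fubini below.\<close>

lemma jointly_measurable:
  "(\<lambda>(x, u). \<Psi> x (max 0 u)) \<in> borel_measurable (borel \<Otimes>\<^sub>M borel)"
proof -
  let ?S = "restrict_space borel {0<..} :: real measure"
  define \<kappa> where "\<kappa> x = density (\<pi> x) (\<lambda>l. ennreal (min l (l\<^sup>2)))" for x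
  obtain C where C: "0 \<le> C" "\<And>x. emeasure (\<kappa> x) {0<..} \<le> ennreal C"
    unfolding \<kappa>_def using jump_kernel_bound[OF kernel] by metis
  have sets_\<kappa>: "sets (\<kappa> x) = sets ?S" for x
    using kernel by (simp add: \<kappa>_def bounded_jump_kernel_def)
  have space_\<kappa>: "space (\<kappa> x) = {0<..}" for x
    by (simp add: \<kappa>_def jump_kernel_space[OF kernel])
  \<comment> \<open>Dividing by \<open>C + 1\<close> instead of \<open>C\<close> also covers
    \<open>C = 0\<close>.\<close>
  define L where "L x = scale_measure (ennreal (1 / (C + 1))) (\<kappa> x)" for x
  have "L \<in> measurable borel (subprob_algebra ?S)"
  proof (rule measurable_subprob_algebra)
    fix x :: 'a
    show "sets (L x) = sets ?S" by (simp add: L_def sets_\<kappa>)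
    have "emeasure (L x) (space (L x)) \<le> ennreal (1 / (C + 1)) * ennreal C"
      using C(2)[of x] by (auto simp: L_def space_\<kappa> space_scale_measure intro: mult_left_mono)
    also have "\<dots> = ennreal (C / (C + 1))"
      using C(1) by (simp add: ennreal_mult[symmetric])
    also have "\<dots> \<le> 1" using C(1) by (simp add: divide_le_eq_1)
    finally show "subprob_space (L x)"
      by (intro subprob_spaceI) (auto simp: L_def space_\<kappa> space_scale_measure)
  next
    fix A assume "A \<in> sets ?S"
    then have "(\<lambda>x. emeasure (\<kappa> x) A) \<in> borel_measurable borel"
      using kernel by (simp add: \<kappa>_def bounded_jump_kernel_def)
    then show "(\<lambda>x. emeasure (L x) A) \<in> borel_measurable borel"
      by (simp add: L_def)
  qed
  then have L: "(\<lambda>xu. L (fst xu)) \<in> measurable (borel \<Otimes>\<^sub>M borel) (subprob_algebra ?S)"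
    by measurable
  define q where "q l u = ennreal (jump (l * max 0 u) / min l (l\<^sup>2))" for l u :: real
  have "(\<lambda>(xu :: 'a \<times> real, l). q l (snd xu)) \<in> borel_measurable ((borel \<Otimes>\<^sub>M borel) \<Otimes>\<^sub>M borel)"
    unfolding q_def by measurable
  moreover have id: "(\<lambda>l. l) \<in> measurable ?S borel"
    by (rule measurable_restrict_space1) simp
  have "(\<lambda>p. (fst p, snd p)) \<in> measurable (((borel :: 'a measure) \<Otimes>\<^sub>M (borel :: real measure)) \<Otimes>\<^sub>M ?S) ((borel \<Otimes>\<^sub>M borel) \<Otimes>\<^sub>M borel)"
    by (intro measurable_Pair measurable_fst measurable_compose[OF measurable_snd id])
  ultimately have "(\<lambda>(xu :: 'a \<times> real, l). q l (snd xu)) \<in> borel_measurable ((borel \<Otimes>\<^sub>M borel) \<Otimes>\<^sub>M ?S)"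
    using measurable_compose by fastforce
  from nn_integral_measurable_subprob_algebra2[OF this L]
  have nn: "(\<lambda>xu. \<integral>\<^sup>+l. q l (snd xu) \<partial>L (fst xu)) \<in> borel_measurable (borel \<Otimes>\<^sub>M borel)" by simp
  have int_eq: "(\<integral>l. jump (l * max 0 u) \<partial>\<pi> x) = (C + 1) * enn2real (\<integral>\<^sup>+l. q l u \<partial>L x)" for x u
  proof -
    have qm: "(\<lambda>l. q l u) \<in> borel_measurable (\<pi> x)"
      unfolding q_def by (rule jump_kernel_measurable[OF kernel]) measurable
    have mm: "(\<lambda>l. ennreal (min l (l\<^sup>2))) \<in> borel_measurable (\<pi> x)"
      by (rule jump_kernel_measurable[OF kernel]) measurable
    have "(\<integral>\<^sup>+l. q l u \<partial>L x) = ennreal (1 / (C + 1)) * (\<integral>\<^sup>+l. q l u \<partial>\<kappa> x)"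
      unfolding L_def using qm by (intro nn_integral_scale_measure) (simp add: \<kappa>_def)
    also have "(\<integral>\<^sup>+l. q l u \<partial>\<kappa> x) = (\<integral>\<^sup>+l. ennreal (min l (l\<^sup>2)) * q l u \<partial>\<pi> x)"
      unfolding \<kappa>_def using qm mm by (intro nn_integral_density) auto
    also have "\<dots> = (\<integral>\<^sup>+l. ennreal (jump (l * max 0 u)) \<partial>\<pi> x)"
      by (intro nn_integral_cong)
        (auto simp: jump_kernel_space[OF kernel] q_def jump_nonneg min_def simp flip: ennreal_mult split: if_splits)
    also have "\<dots> = ennreal (\<integral>l. jump (l * max 0 u) \<partial>\<pi> x)"
      by (intro nn_integral_eq_integral jump_integrable) (auto simp: jump_nonneg)
    finally have "(\<integral>\<^sup>+l. q l u \<partial>L x) = ennreal (1 / (C + 1) * (\<integral>l. jump (l * max 0 u) \<partial>\<pi> x))"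
      using C(1) by (simp add: ennreal_mult[symmetric] integral_nonneg_AE jump_nonneg)
    moreover have "0 \<le> 1 / (C + 1) * (\<integral>l. jump (l * max 0 u) \<partial>\<pi> x)"
      using C(1) by (simp add: integral_nonneg_AE jump_nonneg)
    ultimately show ?thesis using C(1) by (simp del: mult_nonneg_nonneg)
  qed
  have [measurable]: "\<alpha> \<in> borel_measurable borel" "\<beta> \<in> borel_measurable borel"
    using continuous_coeffs by (auto intro: borel_measurable_continuous_onI)
  have "(\<lambda>xu. \<alpha> (fst xu) * max 0 (snd xu) + \<beta> (fst xu) * (max 0 (snd xu))\<^sup>2 +
      (C + 1) * enn2real (\<integral>\<^sup>+l. q l (snd xu) \<partial>L (fst xu))) \<in> borel_measurable (borel \<Otimes>\<^sub>M borel)"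
    using nn by measurable
  then show ?thesis by (simp add: case_prod_beta eq int_eq)
qed

end

text \<open>\<open>0 \<le> \<alpha> x\<close> is what subcritical and critical mechanisms have in
  common, and the locale is built on it.\<close>

lemma branching_mechanism_triple:
  assumes "branching_mechanism \<Psi>"
  obtains \<alpha> \<beta> \<pi> where "branching_triple \<Psi> \<alpha> \<beta> \<pi>"
proof -
  obtain \<alpha> \<beta> \<pi> where "has_branching_triple \<Psi> \<alpha> \<beta> \<pi>" "subcritical \<alpha> \<or> critical \<alpha>"
    using assms by (auto simp: branching_mechanism_def)
  then have "branching_triple \<Psi> \<alpha> \<beta> \<pi>"
    by unfold_locales (auto simp: subcritical_def critical_def less_imp_le)
  with that show ?thesis by blast
qed

lemma spatially_constant_branching_triple:
  assumes "spatially_constant_branching_mechanism \<Psi>"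
  obtains \<alpha> \<beta> \<pi> where "branching_triple \<Psi> \<alpha> \<beta> \<pi>"
  using assms branching_mechanism_triple[of \<Psi>]
  unfolding spatially_constant_branching_mechanism_def branching_mechanism_def by blast

section \<open>The Keller-Osserman condition and barriers\<close>

text \<open>No integrability of \<open>\<phi>\<close> is assumed: a Bochner integral that does not
  exist has the value 0, which is also below the bound because \<open>0 \<le> B\<close>.\<close>

lemma set_integral_le_const:
  fixes \<phi> :: "real \<Rightarrow> real"
  assumes "0 \<le> t" "0 \<le> B" "\<And>s. 0 \<le> s \<Longrightarrow> s \<le> t \<Longrightarrow> \<phi> s \<le> B"
  shows "(LBINT s:{0..t}. \<phi> s) \<le> t * B"
proof -
  have "(LBINT s:{0..t}. \<phi> s) \<le> (LBINT s:{0..t}. B)"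
    unfolding set_lebesgue_integral_def
  proof (rule integral_mono')
    show "integrable lborel (\<lambda>s. indicator {0..t} s *\<^sub>R B)"
      by (intro integrable_scaleR_left integrable_real_indicator) (auto simp: emeasure_lborel_Icc_eq)
  qed (use assms in \<open>auto simp: indicator_def\<close>)
  also have "\<dots> = t * B" using assms(1) by (simp add: set_lebesgue_integral_def)
  finally show ?thesis .
qed

section \<open>Consequences of the Keller-Osserman condition\<close>

context branching_triple
begin

lemma primitive_le:
  assumes "0 \<le> l"
  shows "(LBINT u:{0..l}. \<Psi> x u) \<le> l * \<Psi> x l"
  using assms by (intro set_integral_le_const nonneg mono)

text \<open>A zero at one \<open>u > 0\<close> spreads by \<open>double_le\<close> to all
  \<open>2 ^ n * u\<close> and by monotonicity to the whole half-line. The primitive then vanishes,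
  and the Keller-Osserman integrand is infinite on \<open>{\<theta>..}\<close>.\<close>

lemma keller_osserman_pos:
  assumes KO: "keller_osserman (\<Psi> x)" and "0 < u"
  shows "0 < \<Psi> x u"
proof (rule ccontr)
  assume "\<not> 0 < \<Psi> x u"
  then have zero_u: "\<Psi> x u = 0" using nonneg[of u x] assms(2) by linarith
  have zero_n: "\<Psi> x (2 ^ n * u) \<le> 0" for n
  proof (induction n)
    case (Suc n)
    then show ?case using double_le[of "2 ^ n * u" x] assms(2) by (simp add: mult_ac)
  qed (simp add: zero_u)
  have zero_all: "\<Psi> x v = 0" if "0 \<le> v" for v
  proof -
    obtain n where "v / u < 2 ^ n" using real_arch_pow[of 2 "v / u"] by auto
    then have "v \<le> 2 ^ n * u" using assms(2) by (simp add: field_simps)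
    then show ?thesis
      using mono[OF that, of "2 ^ n * u" x] zero_n[of n] nonneg[OF that, of x] by linarith
  qed
  obtain \<theta> :: real where \<theta>: "0 < \<theta>"
    "(\<integral>\<^sup>+ l\<in>{\<theta>..}. (1 / ennreal (sqrt (LBINT u:{0..l}. \<Psi> x u))) \<partial>lborel) < \<infinity>"
    using KO by (auto simp: keller_osserman_def)
  have F: "(LBINT u:{0..l}. \<Psi> x u) = 0" for l
    unfolding set_lebesgue_integral_def
    by (rule integral_eq_zero_AE) (auto simp: indicator_def zero_all)
  have "(\<integral>\<^sup>+ l\<in>{\<theta>..}. (1 / ennreal (sqrt (LBINT u:{0..l}. \<Psi> x u))) \<partial>lborel)
      = (\<integral>\<^sup>+ l. \<infinity> * indicator {\<theta>..} l \<partial>lborel)"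
    by (intro nn_integral_cong) (simp add: F ennreal_divide_zero)
  also have "\<dots> = \<infinity>"
  proof -
    have "emeasure lborel {\<theta>..\<theta> + 1} \<le> emeasure lborel {\<theta>..}" by (rule emeasure_mono) auto
    then have "emeasure lborel {\<theta>..} \<noteq> 0" by auto
    then show ?thesis by (subst nn_integral_cmult_indicator) (auto simp: ennreal_top_mult)
  qed
  finally show False using \<theta>(2) by simp
qed

text \<open>On the dyadic block from \<open>A n\<close> to \<open>A (Suc n)\<close> the
  Keller-Osserman integrand is at least \<open>c n\<close>, so the block contributes at least
  \<open>c n * A n\<close>, which is a fixed multiple of the n-th summand. Blocks beyond
  \<open>\<theta>\<close> are paid for by the integral, and the finitely many earlier ones enter the
  constant.\<close>

lemma keller_osserman_gap_sum:
  assumes KO: "keller_osserman (\<Psi> x)" and \<delta>: "0 < \<delta>"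
  obtains G where "\<And>N. (\<Sum>n<N. 2 * sqrt (2 ^ n * \<delta> / \<Psi> x (2 ^ n * \<delta>))) \<le> G"
proof -
  define A where "A n = 2 ^ n * \<delta>" for n :: nat
  \<comment> \<open>The 8 is 2 times 4: on the block \<open>l \<le> 2 * A n\<close>, and
    \<open>\<Psi> x l\<close> is at most \<open>4 * \<Psi> x (A n)\<close> by
    \<open>double_le\<close>.\<close>
  define c where "c n = 1 / sqrt (8 * (A n * \<Psi> x (A n)))" for n
  define k where "k l = 1 / ennreal (sqrt (LBINT u:{0..l}. \<Psi> x u))" for l
  have A: "0 < A n" "A (Suc n) = 2 * A n" for n using \<delta> by (auto simp: A_def)
  have \<Psi>A: "0 < \<Psi> x (A n)" for n by (rule keller_osserman_pos[OF KO A(1)])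
  have A_mono: "A m \<le> A n" if "m \<le> n" for m n
    using that \<delta> by (simp add: A_def power_increasing)
  have c_pos: "0 < c n" for n using A(1) \<Psi>A by (simp add: c_def)
  obtain \<theta> where \<theta>: "0 < \<theta>" "(\<integral>\<^sup>+ l\<in>{\<theta>..}. k l \<partial>lborel) < \<infinity>"
    using KO by (auto simp: keller_osserman_def k_def)
  define J where "J = enn2real (\<integral>\<^sup>+ l\<in>{\<theta>..}. k l \<partial>lborel)"
  have J: "(\<integral>\<^sup>+ l\<in>{\<theta>..}. k l \<partial>lborel) = ennreal J"
    using \<theta>(2) by (simp add: J_def)
  obtain n0 where "\<theta> / \<delta> < 2 ^ n0" using real_arch_pow[of 2 "\<theta> / \<delta>"] by auto
  then have n0: "\<theta> \<le> A n0" using \<delta> by (simp add: A_def field_simps)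
  have k_ge: "ennreal (c n) \<le> k l" if "l \<in> {A n..<A (Suc n)}" for n l
  proof -
    have l: "0 < l" "l \<le> 2 * A n" using that A[of n] by auto
    have "(LBINT u:{0..l}. \<Psi> x u) \<le> l * \<Psi> x l" using l by (intro primitive_le) simp
    also have "\<dots> \<le> (2 * A n) * (4 * \<Psi> x (A n))"
      using l A(1)[of n] mono[of l "2 * A n" x] double_le[of "A n" x] nonneg[of l x]
      by (intro mult_mono) auto
    finally have le: "sqrt (LBINT u:{0..l}. \<Psi> x u) \<le> sqrt (8 * (A n * \<Psi> x (A n)))" by simp
    have B: "0 < sqrt (8 * (A n * \<Psi> x (A n)))" using A(1)[of n] \<Psi>A[of n] by simp
    show ?thesis
    proof (cases "sqrt (LBINT u:{0..l}. \<Psi> x u) \<le> 0")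
      \<comment> \<open>If the root is not positive, the quotient in \<open>k l\<close> is 1 / 0,
        which is infinite.\<close>
      case True
      then show ?thesis by (simp add: k_def ennreal_neg ennreal_divide_zero)
    next
      case False
      then have "k l = ennreal (1 / sqrt (LBINT u:{0..l}. \<Psi> x u))"
        unfolding k_def by (subst divide_ennreal[symmetric]) auto
      moreover have "c n \<le> 1 / sqrt (LBINT u:{0..l}. \<Psi> x u)"
        unfolding c_def using le B False by (intro divide_left_mono mult_pos_pos) auto
      ultimately show ?thesis by (simp add: ennreal_leI)
    qed
  qed
  have tail: "(\<Sum>n=n0..<N. c n * A n) \<le> J" for N
  proof -
    \<comment> \<open>The blocks are disjoint, so at most one summand is non-zero at a given
      \<open>l\<close>.\<close>
    have pointwise: "(\<Sum>n=n0..<N. ennreal (c n) * indicator {A n..<A (Suc n)} l) \<le> k l * indicator {\<theta>..} l" for l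
    proof (cases "\<exists>m\<in>{n0..<N}. l \<in> {A m..<A (Suc m)}")
      case True
      then obtain m where m: "m \<in> {n0..<N}" "l \<in> {A m..<A (Suc m)}" by blast
      have off: "indicator {A n..<A (Suc n)} l = (0 :: ennreal)" if "n \<noteq> m" for n
      proof -
        have "Suc n \<le> m \<or> Suc m \<le> n" using that by linarith
        then have "A (Suc n) \<le> A m \<or> A (Suc m) \<le> A n" using A_mono by blast
        then show ?thesis using m(2) by (auto simp: indicator_def)
      qed
      have "(\<Sum>n=n0..<N. ennreal (c n) * indicator {A n..<A (Suc n)} l)
          = (\<Sum>n\<in>{m}. ennreal (c n) * indicator {A n..<A (Suc n)} l)"
        using m(1) off by (intro sum.mono_neutral_right) simp_all
      also have "\<dots> \<le> k l * indicator {\<theta>..} l"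
        using m k_ge[OF m(2)] n0 A_mono[of n0 m] by (simp add: indicator_def)
      finally show ?thesis .
    next
      case False
      then have "(\<Sum>n=n0..<N. ennreal (c n) * indicator {A n..<A (Suc n)} l) = 0"
        by (intro sum.neutral) (auto simp: indicator_def)
      then show ?thesis by simp
    qed
    have "ennreal (\<Sum>n=n0..<N. c n * A n) = (\<Sum>n=n0..<N. ennreal (c n * A n))"
      using c_pos A(1) by (intro sum_ennreal[symmetric]) (auto simp: less_imp_le)
    also have "\<dots> = (\<Sum>n=n0..<N. \<integral>\<^sup>+ l. ennreal (c n) * indicator {A n..<A (Suc n)} l \<partial>lborel)"
    proof (rule sum.cong)
      fix n
      have "(\<integral>\<^sup>+ l. ennreal (c n) * indicator {A n..<A (Suc n)} l \<partial>lborel) = ennreal (c n) * emeasure lborel {A n..<A (Suc n)}"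
        by (rule nn_integral_cmult_indicator) simp
      also have "emeasure lborel {A n..<A (Suc n)} = ennreal (A n)"
        using A[of n] by simp
      finally show "ennreal (c n * A n) = (\<integral>\<^sup>+ l. ennreal (c n) * indicator {A n..<A (Suc n)} l \<partial>lborel)"
        using c_pos[of n] by (simp add: ennreal_mult')
    qed simp
    also have "\<dots> = (\<integral>\<^sup>+ l. (\<Sum>n=n0..<N. ennreal (c n) * indicator {A n..<A (Suc n)} l) \<partial>lborel)"
      by (rule nn_integral_sum[symmetric]) simp
    also have "\<dots> \<le> ennreal J"
      unfolding J[symmetric] by (intro nn_integral_mono pointwise)
    finally show ?thesis using J_def enn2real_nonneg ennreal_le_iff by metis
  qed
  have gap: "2 * sqrt (A n / \<Psi> x (A n)) = 2 * sqrt 8 * (c n * A n)" for n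
  proof -
    have "sqrt (A n / \<Psi> x (A n)) = A n / sqrt (A n * \<Psi> x (A n))"
      using A(1)[of n] \<Psi>A[of n] by (simp add: real_sqrt_divide real_sqrt_mult field_simps)
    then show ?thesis by (simp add: c_def real_sqrt_mult)
  qed
  define g where "g n = 2 * sqrt (A n / \<Psi> x (A n))" for n
  have g: "0 \<le> g n" for n using A(1)[of n] \<Psi>A[of n] by (simp add: g_def)
  have "(\<Sum>n<N. g n) \<le> (\<Sum>n<n0. g n) + 2 * sqrt 8 * J" for N
  proof -
    have "(\<Sum>n<N. g n) \<le> (\<Sum>n\<in>{..<n0} \<union> {n0..<N}. g n)"
      using g by (intro sum_mono2) auto
    also have "\<dots> = (\<Sum>n<n0. g n) + (\<Sum>n=n0..<N. g n)"
      by (intro sum.union_disjoint) auto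
    also have "(\<Sum>n=n0..<N. g n) = 2 * sqrt 8 * (\<Sum>n=n0..<N. c n * A n)"
      by (simp add: g_def gap sum_distrib_left)
    also have "\<dots> \<le> 2 * sqrt 8 * J" by (intro mult_left_mono tail) simp
    finally show ?thesis by simp
  qed
  with that show ?thesis unfolding g_def A_def by blast
qed

end

section \<open>Construction of the barriers\<close>

text \<open>The new arc is a parabola of curvature \<open>\<Phi> A\<close> that leaves its vertex at height \<open>A\<close> and would
  reach \<open>3 * A\<close> at \<open>b\<close>, so that it crosses the level \<open>2 * A\<close> of \<open>w\<close> before \<open>b\<close> in a concave kink.
  The upper Taylor inequality says \<open>w'' \<le> \<Phi>(w)\<close> from above only, which concave kinks respect.\<close>

lemma barrier_step:
  fixes \<Phi> w :: "real \<Rightarrow> real"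
  assumes A: "0 < A" and \<Phi>A: "0 < \<Phi> A" and mono: "\<And>u. A \<le> u \<Longrightarrow> \<Phi> A \<le> \<Phi> u"
    and w_ge: "\<And>y. 2 * A \<le> w y" and w_le: "\<And>y. w y \<le> B"
    and lip: "L-lipschitz_on UNIV w"
    and left: "\<And>y. y \<le> b \<Longrightarrow> w y = 2 * A"
    and taylor: "\<And>y. \<exists>p. \<forall>z. w (y + z) \<le> w y + p * z + \<Phi> (w y) / 2 * z\<^sup>2 + C * z ^ 4"
  obtains w' L' C' where "\<And>y. A \<le> w' y" "\<And>y. w' y \<le> B" "L'-lipschitz_on UNIV w'"
    "\<And>y. y \<le> b - 2 * sqrt (A / \<Phi> A) \<Longrightarrow> w' y = A"
    "\<And>y. b < y \<Longrightarrow> w' y = w y"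
    "\<And>y. \<exists>p. \<forall>z. w' (y + z) \<le> w' y + p * z + \<Phi> (w' y) / 2 * z\<^sup>2 + C' * z ^ 4"
proof -
  \<comment> \<open>This length is chosen so that a parabola of curvature \<open>\<Phi> A\<close>
    rises by exactly \<open>2 * A\<close> over it, see \<open>gap2\<close>.\<close>
  define gap where "gap = 2 * sqrt (A / \<Phi> A)"
  define \<phi> where "\<phi> y = A + \<Phi> A / 2 * (max 0 (y - (b - gap)))\<^sup>2" for y
  define w' where "w' y = (if y \<le> b then min (\<phi> y) (2 * A) else w y)" for y
  \<comment> \<open>Within distance \<open>r\<close> to the right of \<open>b\<close> the Lipschitz
    function \<open>w\<close> cannot rise from \<open>2 * A\<close> above \<open>3 * A\<close>, the
    height of the continued parabola at \<open>b\<close>.\<close>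
  define r where "r = A / (L + 1)"
  \<comment> \<open>Beyond distance \<open>r\<close> the parabola may no longer dominate
    \<open>w\<close>; there the crude bound \<open>B\<close> is absorbed by the quartic term, as
    \<open>B \<le> B / r ^ 4 * z ^ 4\<close> for \<open>r \<le> z\<close>.\<close>
  define C' where "C' = max \<bar>C\<bar> (B / r ^ 4)"
  have L: "0 \<le> L" using lip by (rule lipschitz_on_nonneg)
  have gap: "0 < gap" using A \<Phi>A by (simp add: gap_def)
  have r: "0 < r" using A L by (simp add: r_def)
  have gap2: "\<Phi> A / 2 * gap\<^sup>2 = 2 * A"
    using A \<Phi>A by (simp add: gap_def power_mult_distrib)
  have B: "0 < B" using A w_ge[of 0] w_le[of 0] by linarith
  have C': "\<bar>C\<bar> \<le> C'" "B / r ^ 4 \<le> C'" by (auto simp: C'_def)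
  have \<phi>_ge: "A \<le> \<phi> y" for y using \<Phi>A by (simp add: \<phi>_def)
  have \<phi>_b: "\<phi> b = 3 * A" using gap gap2 by (simp add: \<phi>_def)
  have \<phi>_mono: "\<phi> y \<le> \<phi> y'" if "y \<le> y'" for y y'
    using that \<Phi>A by (auto simp: \<phi>_def intro!: mult_left_mono power_mono)
  have w'_le_w: "w' y \<le> w y" for y using left[of y] by (simp add: w'_def)
  have w_right: "w (b + s) \<le> 3 * A" if "0 \<le> s" "s \<le> r" for s
  proof -
    have "\<bar>w (b + s) - w b\<bar> \<le> L * s"
      using lipschitz_onD[OF lip, of "b + s" b] that by (simp add: dist_real_def)
    moreover have "L * s \<le> L * r" using that L by (simp add: mult_left_mono)
    moreover have "L * r \<le> A"
      using A L by (simp add: r_def field_simps)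
    ultimately show ?thesis using left[of b] by linarith
  qed
  \<comment> \<open>Where \<open>w'\<close> touches \<open>w\<close> it inherits its Taylor bound,
    because \<open>w'\<close> lies below \<open>w\<close> everywhere. This is why taking a minimum,
    with its concave kink, is admissible.\<close>
  have from_w: "\<exists>p. \<forall>z. w' (y + z) \<le> w' y + p * z + \<Phi> (w' y) / 2 * z\<^sup>2 + C' * z ^ 4"
    if "w' y = w y" for y
  proof -
    obtain p where p: "\<And>z. w (y + z) \<le> w y + p * z + \<Phi> (w y) / 2 * z\<^sup>2 + C * z ^ 4"
      using taylor by blast
    have "C * z ^ 4 \<le> C' * z ^ 4" for z using C' by (intro mult_right_mono) auto
    then have "w' (y + z) \<le> w' y + p * z + \<Phi> (w' y) / 2 * z\<^sup>2 + C' * z ^ 4" for z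
      using p[of z] w'_le_w[of "y + z"] unfolding that by (smt (verit))
    then show ?thesis by blast
  qed
  have taylor': "\<exists>p. \<forall>z. w' (y + z) \<le> w' y + p * z + \<Phi> (w' y) / 2 * z\<^sup>2 + C' * z ^ 4" for y
  proof (cases "y \<le> b \<and> \<phi> y < 2 * A")
    case False
    then show ?thesis using left[of y] by (intro from_w) (auto simp: w'_def)
  next
    case True
    define m where "m = max 0 (y - (b - gap))"
    have m: "0 \<le> m" by (simp add: m_def)
    have w'y: "w' y = \<phi> y" using True by (simp add: w'_def)
    \<comment> \<open>The curvature of the arc is the value of \<open>\<Phi>\<close> at its lowest
      level, hence at most \<open>\<Phi>\<close> of its current height.\<close>
    have \<Phi>w': "\<Phi> A / 2 * z\<^sup>2 \<le> \<Phi> (w' y) / 2 * z\<^sup>2" for z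
      using mono[of "w' y"] \<phi>_ge[of y] unfolding w'y by (intro mult_right_mono) auto
    \<comment> \<open>This holds on both sides of the vertex, so one quadratic expansion serves the
      flat piece, where \<open>m = 0\<close>, and the rising piece.\<close>
    have sq: "(max 0 (y + z - (b - gap)))\<^sup>2 \<le> (m + z)\<^sup>2" for z
    proof -
      have "\<bar>max 0 (y + z - (b - gap))\<bar> \<le> \<bar>m + z\<bar>" by (auto simp: m_def)
      then show ?thesis by (simp only: abs_le_square_iff)
    qed
    have quad: "\<phi> (y + z) \<le> \<phi> y + (\<Phi> A * m) * z + \<Phi> A / 2 * z\<^sup>2" for z
    proof -
      have "\<phi> (y + z) \<le> A + \<Phi> A / 2 * (m + z)\<^sup>2"
        unfolding \<phi>_def using sq[of z] \<Phi>A by (intro add_left_mono mult_left_mono) auto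
      also have "\<dots> = \<phi> y + (\<Phi> A * m) * z + \<Phi> A / 2 * z\<^sup>2"
        unfolding \<phi>_def m_def[symmetric] by (simp add: power2_eq_square field_simps)
      finally show ?thesis .
    qed
    have "w' (y + z) \<le> w' y + (\<Phi> A * m) * z + \<Phi> (w' y) / 2 * z\<^sup>2 + C' * z ^ 4" for z
    proof (cases "y + z \<le> b + r")
      case le: True
      have "w' (y + z) \<le> \<phi> (y + z)"
      proof (cases "y + z \<le> b")
        case False
        then have "w' (y + z) \<le> 3 * A"
          using w_right[of "y + z - b"] le by (simp add: w'_def)
        also have "\<dots> \<le> \<phi> (y + z)" using \<phi>_mono[of b "y + z"] False \<phi>_b by simp
        finally show ?thesis .
      qed (simp add: w'_def)
      moreover have "0 \<le> C' * z ^ 4" using C' by (intro mult_nonneg_nonneg) auto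
      ultimately show ?thesis using quad[of z] \<Phi>w'[of z] w'y by linarith
    next
      case False
      then have z: "r \<le> z" using True by simp
      have "w' (y + z) \<le> B" using w'_le_w[of "y + z"] w_le[of "y + z"] by simp
      also have "B = B / r ^ 4 * r ^ 4" using r by simp
      also have "\<dots> \<le> C' * z ^ 4"
        using C' r z B by (intro mult_mono power_mono) auto
      finally have "w' (y + z) \<le> C' * z ^ 4" .
      moreover have "0 \<le> (\<Phi> A * m) * z" using \<Phi>A m z r by simp
      moreover have "0 \<le> \<Phi> (w' y) / 2 * z\<^sup>2"
        by (rule order_trans[OF _ \<Phi>w'[of z]]) (use \<Phi>A in auto)
      moreover have "0 \<le> w' y" using w'y \<phi>_ge[of y] A by simp
      ultimately show ?thesis by linarith
    qed
    then show ?thesis by blast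
  qed
  \<comment> \<open>The arc is steepest at \<open>b\<close>, where its slope is
    \<open>\<Phi> A * gap\<close>.\<close>
  define L' where "L' = L + \<Phi> A * gap"
  have L'_ge: "0 \<le> L'" "L \<le> L'" "\<Phi> A * gap \<le> L'" using L \<Phi>A gap by (auto simp: L'_def)
  have w'b: "w' b = 2 * A" "w b = 2 * A" using \<phi>_b A left[of b] by (auto simp: w'_def)
  have low: "\<bar>w' y - w' x\<bar> \<le> L' * (y - x)" if "x \<le> y" "y \<le> b" for x y
  proof -
    define m n where "m = max 0 (x - (b - gap))" and "n = max 0 (y - (b - gap))"
    have mn: "0 \<le> m" "m \<le> n" "n \<le> gap" "n - m \<le> y - x"
      using that gap by (auto simp: m_def n_def)
    have "\<bar>w' y - w' x\<bar> \<le> \<bar>\<phi> y - \<phi> x\<bar>" using that by (auto simp: w'_def)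
    also have "\<dots> = \<phi> y - \<phi> x" using \<phi>_mono[OF that(1)] by simp
    also have "\<dots> = \<Phi> A / 2 * ((n + m) * (n - m))"
      unfolding \<phi>_def m_def[symmetric] n_def[symmetric]
      by (simp add: power2_eq_square field_simps)
    also have "\<dots> \<le> \<Phi> A / 2 * ((2 * gap) * (y - x))"
      using mn \<Phi>A by (intro mult_left_mono mult_mono) auto
    also have "\<dots> = (\<Phi> A * gap) * (y - x)" by simp
    also have "\<dots> \<le> L' * (y - x)" using L'_ge that by (intro mult_right_mono) auto
    finally show ?thesis .
  qed
  have high: "\<bar>w' y - w' x\<bar> \<le> L' * (y - x)" if "b \<le> x" "x \<le> y" for x y
  proof -
    have "w' t = w t" if "b \<le> t" for t
      using that by (cases "t = b", simp only: w'b, simp add: w'_def)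
    then have "w' x = w x" "w' y = w y" using that by auto
    moreover have "\<bar>w y - w x\<bar> \<le> L * (y - x)"
      using lipschitz_onD[OF lip, of y x] that by (simp add: dist_real_def)
    moreover have "L * (y - x) \<le> L' * (y - x)" using L'_ge that by (intro mult_right_mono) auto
    ultimately show ?thesis by simp
  qed
  have all: "\<bar>w' y - w' x\<bar> \<le> L' * (y - x)" if "x \<le> y" for x y
  proof -
    consider "y \<le> b" | "b \<le> x" | "x \<le> b" "b \<le> y" by linarith
    then show ?thesis
    proof cases
      case 3
      then show ?thesis using low[of x b] high[of b y] by (simp add: algebra_simps)
    qed (use low high that in auto)
  qed
  have lip': "L'-lipschitz_on UNIV w'"
  proof (rule lipschitz_onI[OF _ L'_ge(1)])
    fix x y :: real
    show "dist (w' x) (w' y) \<le> L' * dist x y"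
      using all[of x y] all[of y x] by (cases "x \<le> y") (auto simp: dist_real_def abs_minus_commute)
  qed
  show ?thesis
  proof (rule that[of w' L' C'])
    show "A \<le> w' y" for y using \<phi>_ge[of y] w_ge[of y] A by (auto simp: w'_def)
    show "w' y \<le> B" for y using w'_le_w[of y] w_le[of y] by simp
    show "w' y = A" if "y \<le> b - 2 * sqrt (A / \<Phi> A)" for y
      using that A gap unfolding gap_def[symmetric] by (simp add: w'_def \<phi>_def max_def)
  qed (use lip' taylor' in \<open>auto simp: w'_def\<close>)
qed

text \<open>The construction runs from the top downwards: it starts with the constant
  \<open>2 ^ N * \<delta>\<close>, and each application of \<open>barrier_step\<close> adds on the
  left an arc that starts at half the lowest level. After \<open>m\<close> steps the lowest level is
  \<open>2 ^ (N - m) * \<delta>\<close>, taken up to \<open>Y (N - m)\<close>. The points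
  \<open>Y n\<close> are counted from \<open>a\<close>, so the last arc begins exactly
  there.\<close>

lemma barrier_exists:
  fixes \<Phi> :: "real \<Rightarrow> real" and \<delta> a :: real
  assumes \<delta>: "0 < \<delta>" and pos: "\<And>u. 0 < u \<Longrightarrow> 0 < \<Phi> u"
    and mono: "\<And>u v. 0 < u \<Longrightarrow> u \<le> v \<Longrightarrow> \<Phi> u \<le> \<Phi> v"
  obtains w L C where "\<And>y. \<delta> \<le> w y" "\<And>y. w y \<le> 2 ^ N * \<delta>" "L-lipschitz_on UNIV w"
    "\<And>y. y \<le> a \<Longrightarrow> w y = \<delta>"
    "\<And>y. a + (\<Sum>n<N. 2 * sqrt (2 ^ n * \<delta> / \<Phi> (2 ^ n * \<delta>))) < y \<Longrightarrow> w y = 2 ^ N * \<delta>"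
    "\<And>y. \<exists>p. \<forall>z. w (y + z) \<le> w y + p * z + \<Phi> (w y) / 2 * z\<^sup>2 + C * z ^ 4"
proof -
  define Y where "Y n = a + (\<Sum>k<n. 2 * sqrt (2 ^ k * \<delta> / \<Phi> (2 ^ k * \<delta>)))" for n
  have Y_mono: "Y n \<le> Y (Suc n)" for n
    using \<delta> pos[of "2 ^ n * \<delta>"] by (simp add: Y_def)
  have "\<exists>w L C. (\<forall>y. 2 ^ (N - m) * \<delta> \<le> w y) \<and> (\<forall>y. w y \<le> 2 ^ N * \<delta>) \<and> L-lipschitz_on UNIV w \<and>
    (\<forall>y. y \<le> Y (N - m) \<longrightarrow> w y = 2 ^ (N - m) * \<delta>) \<and> (\<forall>y>Y N. w y = 2 ^ N * \<delta>) \<and>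
    (\<forall>y. \<exists>p. \<forall>z. w (y + z) \<le> w y + p * z + \<Phi> (w y) / 2 * z\<^sup>2 + C * z ^ 4)" if "m \<le> N" for m
    using that
  proof (induction m)
    case 0
    have "0 \<le> \<Phi> (2 ^ N * \<delta>)" using pos[of "2 ^ N * \<delta>"] \<delta> by simp
    then have "\<exists>p. \<forall>z. 2 ^ N * \<delta> \<le> 2 ^ N * \<delta> + p * z + \<Phi> (2 ^ N * \<delta>) / 2 * z\<^sup>2 + 0 * z ^ 4"
      by (intro exI[of _ 0]) simp
    then show ?case
      by (intro exI[of _ "\<lambda>_. 2 ^ N * \<delta>"] exI[of _ 0]) (auto intro: lipschitz_intros)
  next
    case (Suc m)
    then obtain w L C where w: "\<And>y. 2 ^ (N - m) * \<delta> \<le> w y" "\<And>y. w y \<le> 2 ^ N * \<delta>"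
      "L-lipschitz_on UNIV w" "\<And>y. y \<le> Y (N - m) \<Longrightarrow> w y = 2 ^ (N - m) * \<delta>"
      "\<And>y. Y N < y \<Longrightarrow> w y = 2 ^ N * \<delta>"
      "\<And>y. \<exists>p. \<forall>z. w (y + z) \<le> w y + p * z + \<Phi> (w y) / 2 * z\<^sup>2 + C * z ^ 4"
      by (meson Suc_leD)
    define n where "n = N - Suc m"
    have n: "N - m = Suc n" using Suc.prems by (simp add: n_def)
    define A where "A = 2 ^ n * \<delta>"
    have A: "0 < A" "2 * A = 2 ^ (N - m) * \<delta>" using \<delta> by (auto simp: A_def n)
    have Yn: "Y (N - m) - 2 * sqrt (A / \<Phi> A) = Y n"
      by (simp add: Y_def n A_def)
    have YN: "Y (N - m) \<le> Y N" by (rule lift_Suc_mono_le[of Y, OF Y_mono]) simp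
    obtain w' L' C' where "\<And>y. A \<le> w' y" "\<And>y. w' y \<le> 2 ^ N * \<delta>" "L'-lipschitz_on UNIV w'"
      "\<And>y. y \<le> Y (N - m) - 2 * sqrt (A / \<Phi> A) \<Longrightarrow> w' y = A"
      "\<And>y. Y (N - m) < y \<Longrightarrow> w' y = w y"
      "\<And>y. \<exists>p. \<forall>z. w' (y + z) \<le> w' y + p * z + \<Phi> (w' y) / 2 * z\<^sup>2 + C' * z ^ 4"
      by (rule barrier_step[of A \<Phi> w "2 ^ N * \<delta>" L "Y (N - m)" C])
        (use A pos mono w in \<open>auto\<close>)
    then show ?case
      using w(5) YN unfolding n_def[symmetric] A_def[symmetric] Yn
      by (intro exI[of _ w'] exI[of _ L'] exI[of _ C']) auto
  qed
  from this[of N] that show ?thesis by (auto simp: Y_def)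
qed

section \<open>Brownian motion\<close>

text \<open>Brownian increments are given by their joint density. With the indicator put into the
  factor of the direction \<open>b\<close>, the integral factorizes, and the other directions
  integrate to 1.\<close>

lemma product_density_component:
  fixes X :: "'w \<Rightarrow> 'a::euclidean_space" and f :: "real \<Rightarrow> real"
  assumes X: "distributed M lborel X (\<lambda>y. ennreal (\<Prod>b\<in>Basis. f (y \<bullet> b)))"
    and [measurable]: "f \<in> borel_measurable borel" and f_nonneg: "\<And>z. 0 \<le> f z"
    and f_int: "(\<integral>\<^sup>+z. f z \<partial>lborel) = 1" and b: "b \<in> Basis"
  shows "distributed M lborel (\<lambda>\<omega>. X \<omega> \<bullet> b) f"
proof -
  have Xm [measurable]: "X \<in> borel_measurable M"
    using distributed_measurable[OF X] by simp
  have "distr M lborel (\<lambda>\<omega>. X \<omega> \<bullet> b) = density lborel f"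
  proof (rule measure_eqI)
    fix A assume "A \<in> sets (distr M lborel (\<lambda>\<omega>. X \<omega> \<bullet> b))"
    then have A[measurable]: "A \<in> sets borel" by simp
    define F where "F b' z = ennreal (f z) * (if b' = b then indicator A z else 1)" for b' :: 'a and z
    have [measurable]: "F b' \<in> borel_measurable borel" for b' unfolding F_def by measurable
    have S: "{y. y \<bullet> b \<in> A} \<in> sets lborel"
      using measurable_sets[of "\<lambda>y. y \<bullet> b" borel borel A] A by (simp add: vimage_def)
    have "emeasure (distr M lborel (\<lambda>\<omega>. X \<omega> \<bullet> b)) A = emeasure M (X -` {y. y \<bullet> b \<in> A} \<inter> space M)"
      by (subst emeasure_distr) (auto intro!: arg_cong[where f = "emeasure M"])
    also have "\<dots> = (\<integral>\<^sup>+y. ennreal (\<Prod>b\<in>Basis. f (y \<bullet> b)) * indicator {y. y \<bullet> b \<in> A} y \<partial>lborel)"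
      by (rule distributed_emeasure[OF X S])
    also have "\<dots> = (\<integral>\<^sup>+y. (\<Prod>b'\<in>Basis. F b' (y \<bullet> b')) \<partial>lborel)"
    proof (rule nn_integral_cong)
      fix y :: 'a
      have "(\<Prod>b'\<in>Basis. F b' (y \<bullet> b')) = (\<Prod>b'\<in>Basis. ennreal (f (y \<bullet> b'))) * (\<Prod>b'\<in>Basis. if b' = b then indicator A (y \<bullet> b') else 1)"
        unfolding F_def by (rule prod.distrib)
      also have "(\<Prod>b'\<in>Basis. if b' = b then indicator A (y \<bullet> b') else 1) = (indicator {y. y \<bullet> b \<in> A} y :: ennreal)"
        using b by (subst prod.delta) (auto simp: indicator_def)
      also have "(\<Prod>b'\<in>Basis. ennreal (f (y \<bullet> b'))) = ennreal (\<Prod>b\<in>Basis. f (y \<bullet> b))"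
        by (rule prod_ennreal) (rule f_nonneg)
      finally show "ennreal (\<Prod>b\<in>Basis. f (y \<bullet> b)) * indicator {y. y \<bullet> b \<in> A} y = (\<Prod>b'\<in>Basis. F b' (y \<bullet> b'))" ..
    qed
    also have "\<dots> = (\<Prod>b'\<in>Basis. \<integral>\<^sup>+z. F b' z \<partial>lborel)"
      by (rule nn_integral_lborel_prod) auto
    also have "\<dots> = (\<Prod>b'\<in>Basis. if b' = b then \<integral>\<^sup>+z. ennreal (f z) * indicator A z \<partial>lborel else 1)"
      by (rule prod.cong) (auto simp: F_def f_int)
    also have "\<dots> = (\<integral>\<^sup>+z. ennreal (f z) * indicator A z \<partial>lborel)"
      using b by (subst prod.delta) auto
    also have "\<dots> = emeasure (density lborel f) A"
      by (simp add: emeasure_density)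
    finally show "emeasure (distr M lborel (\<lambda>\<omega>. X \<omega> \<bullet> b)) A = emeasure (density lborel f) A" .
  qed simp
  then show ?thesis unfolding distributed_def by auto
qed

text \<open>\<open>Z\<close> is measured from \<open>W 0\<close> and not from \<open>x\<close>,
  since the two agree only almost surely. The first, second and fourth moments match the terms of
  the barriers' Taylor bound; the absolute moment controls Lipschitz errors.\<close>

lemma brownian_component_moments:
  fixes W :: "real \<Rightarrow> 'w \<Rightarrow> 'a::euclidean_space"
  assumes BM: "standard_brownian_motion M x W" and t: "0 \<le> t" and b: "b \<in> Basis" and c: "\<bar>c\<bar> = 1"
  defines "Z \<equiv> \<lambda>\<omega>. c * ((W t \<omega> - W 0 \<omega>) \<bullet> b)"
  shows "integrable M Z" "(\<integral>\<omega>. Z \<omega> \<partial>M) = 0"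
    "integrable M (\<lambda>\<omega>. (Z \<omega>)\<^sup>2)" "(\<integral>\<omega>. (Z \<omega>)\<^sup>2 \<partial>M) = t"
    "integrable M (\<lambda>\<omega>. Z \<omega> ^ 4)" "(\<integral>\<omega>. Z \<omega> ^ 4 \<partial>M) = 3 * t\<^sup>2"
    "(\<integral>\<omega>. \<bar>Z \<omega>\<bar> \<partial>M) \<le> sqrt t"
proof -
  interpret prob_space M using BM by (simp add: standard_brownian_motion_def)
  have *: "integrable M Z \<and> (\<integral>\<omega>. Z \<omega> \<partial>M) = 0 \<and>
    integrable M (\<lambda>\<omega>. (Z \<omega>)\<^sup>2) \<and> (\<integral>\<omega>. (Z \<omega>)\<^sup>2 \<partial>M) = t \<and>
    integrable M (\<lambda>\<omega>. Z \<omega> ^ 4) \<and> (\<integral>\<omega>. Z \<omega> ^ 4 \<partial>M) = 3 * t\<^sup>2"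
  \<comment> \<open>The definition gives a density only for increments over an interval of positive
    length.\<close>
  proof (cases "t = 0")
    case True
    then show ?thesis by (simp add: Z_def)
  next
    case False
    with t have t: "0 < t" by simp
    let ?n = "normal_density 0 (sqrt t)"
    let ?Y = "\<lambda>\<omega>. (W t \<omega> - W 0 \<omega>) \<bullet> b"
    have "distributed M lborel (\<lambda>\<omega>. W t \<omega> - W 0 \<omega>) (\<lambda>y. ennreal (\<Prod>b\<in>Basis. normal_density 0 (sqrt (t - 0)) (y \<bullet> b)))"
      using BM t unfolding standard_brownian_motion_def by blast
    moreover have "(\<integral>\<^sup>+z. ?n z \<partial>lborel) = 1"
      using t by (subst nn_integral_eq_integral) (auto simp: integral_normal_density)
    ultimately have D: "distributed M lborel ?Y ?n"
      using b t by (intro product_density_component) auto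
    have int: "integrable M (\<lambda>\<omega>. ?Y \<omega> ^ k)" for k
      using distributed_integrable[OF D, of "\<lambda>z. z ^ k"] integrable_normal_moment[of "sqrt t" 0 k] t by simp
    have val: "(\<integral>\<omega>. ?Y \<omega> ^ k \<partial>M) = (\<integral>z. ?n z * (z - 0) ^ k \<partial>lborel)" for k
      using distributed_integral[OF D, of "\<lambda>z. z ^ k"] by simp
    have 1: "(\<integral>\<omega>. ?Y \<omega> ^ 1 \<partial>M) = 0"
      unfolding val using integral_normal_moment_odd[of "sqrt t" 0 0] t by simp
    have 2: "(\<integral>\<omega>. ?Y \<omega> ^ 2 \<partial>M) = t"
      unfolding val using integral_normal_moment_even[of "sqrt t" 0 1] t by simp
    have 4: "(\<integral>\<omega>. ?Y \<omega> ^ 4 \<partial>M) = 3 * t\<^sup>2"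
      unfolding val using integral_normal_moment_even[of "sqrt t" 0 2] t
      by (simp add: fact_numeral power_divide)
    have c2: "c\<^sup>2 = 1" using c by (metis power2_abs power_one)
    have c4: "c ^ 4 = 1" using c2 by (metis numeral_Bit0 power_add mult_1 power2_eq_square power_mult_numeral num_double power_one power_mult)
    show ?thesis
      using int[of 1] int[of 2] int[of 4] 1 2 4
      by (simp add: Z_def power_mult_distrib c2 c4)
  qed
  then show "integrable M Z" "(\<integral>\<omega>. Z \<omega> \<partial>M) = 0"
    "integrable M (\<lambda>\<omega>. (Z \<omega>)\<^sup>2)" "(\<integral>\<omega>. (Z \<omega>)\<^sup>2 \<partial>M) = t"
    "integrable M (\<lambda>\<omega>. Z \<omega> ^ 4)" "(\<integral>\<omega>. Z \<omega> ^ 4 \<partial>M) = 3 * t\<^sup>2" by auto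
  show "(\<integral>\<omega>. \<bar>Z \<omega>\<bar> \<partial>M) \<le> sqrt t"
  proof (cases "t = 0")
    case True
    then show ?thesis by (simp add: Z_def)
  next
    case False
    with t have s: "0 < sqrt t" by simp
    \<comment> \<open>The inequality between arithmetic and geometric means, balanced at
      \<open>sqrt t\<close>, bounds the absolute moment by the variance.\<close>
    have "(\<integral>\<omega>. \<bar>Z \<omega>\<bar> \<partial>M) \<le> (\<integral>\<omega>. (Z \<omega>)\<^sup>2 / (2 * sqrt t) + sqrt t / 2 \<partial>M)"
    proof (rule integral_mono)
      fix \<omega>
      have "0 \<le> (\<bar>Z \<omega>\<bar> - sqrt t)\<^sup>2" by simp
      then have "2 * sqrt t * \<bar>Z \<omega>\<bar> \<le> (Z \<omega>)\<^sup>2 + sqrt t * sqrt t"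
        by (simp add: power2_eq_square algebra_simps)
      then show "\<bar>Z \<omega>\<bar> \<le> (Z \<omega>)\<^sup>2 / (2 * sqrt t) + sqrt t / 2"
        using s by (simp add: field_simps)
    qed (use * in auto)
    also have "\<dots> = t / (2 * sqrt t) + sqrt t / 2" using * by (simp add: prob_space)
    also have "\<dots> = sqrt t" using t s by (simp add: field_simps)
    finally show ?thesis .
  qed
qed

text \<open>Rounding time down to a grid leaves countably many values, for which joint measurability
  is clear; continuity of the paths lets the mesh tend to 0.\<close>

lemma continuous_paths_jointly_measurable:
  fixes V :: "real \<Rightarrow> 'w \<Rightarrow> 'a::{metric_space, second_countable_topology}"
  assumes meas: "\<And>s. V s \<in> borel_measurable M"
    and cont: "\<And>\<omega>. \<omega> \<in> space M \<Longrightarrow> continuous_on UNIV (\<lambda>s. V s \<omega>)"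
  shows "(\<lambda>(s, \<omega>). V s \<omega>) \<in> borel_measurable (borel \<Otimes>\<^sub>M M)"
proof (rule borel_measurable_LIMSEQ_metric)
  fix n :: nat
  have "(\<lambda>p. V (real_of_int \<lfloor>real (Suc n) * fst p\<rfloor> / real (Suc n)) (snd p)) \<in> borel_measurable (borel \<Otimes>\<^sub>M M)"
  proof (rule measurable_compose_countable[where g = "\<lambda>p. \<lfloor>real (Suc n) * fst p\<rfloor>"])
    show "(\<lambda>p. V (real_of_int i / real (Suc n)) (snd p)) \<in> borel_measurable (borel \<Otimes>\<^sub>M M)" for i
      by (rule measurable_compose[OF measurable_snd meas])
  qed measurable
  then show "(\<lambda>(s, \<omega>). V (real_of_int \<lfloor>real (Suc n) * s\<rfloor> / real (Suc n)) \<omega>) \<in> borel_measurable (borel \<Otimes>\<^sub>M M)"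
    by (simp add: case_prod_beta)
next
  fix p assume "p \<in> space (borel \<Otimes>\<^sub>M M :: (real \<times> 'w) measure)"
  then obtain s \<omega> where p: "p = (s, \<omega>)" "\<omega> \<in> space M" by (auto simp: space_pair_measure)
  have "(\<lambda>n. real_of_int \<lfloor>real (Suc n) * s\<rfloor> / real (Suc n)) \<longlonglongrightarrow> s"
  proof (rule tendsto_sandwich[OF _ _ _ tendsto_const])
    have "(\<lambda>n. s - inverse (real (Suc n))) \<longlonglongrightarrow> s - 0"
      by (intro tendsto_diff tendsto_const LIMSEQ_inverse_real_of_nat)
    then show "(\<lambda>n. s - inverse (real (Suc n))) \<longlonglongrightarrow> s" by simp
    show "\<forall>\<^sub>F n in sequentially. s - inverse (real (Suc n)) \<le> real_of_int \<lfloor>real (Suc n) * s\<rfloor> / real (Suc n)"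
    proof (rule always_eventually, rule allI)
      fix n
      have "real (Suc n) * s - 1 \<le> real_of_int \<lfloor>real (Suc n) * s\<rfloor>" by linarith
      then have "(real (Suc n) * s - 1) / real (Suc n) \<le> real_of_int \<lfloor>real (Suc n) * s\<rfloor> / real (Suc n)"
        by (intro divide_right_mono) auto
      moreover have "(real (Suc n) * s - 1) / real (Suc n) = s - inverse (real (Suc n))"
        by (simp add: field_simps del: of_nat_Suc)
      ultimately show "s - inverse (real (Suc n)) \<le> real_of_int \<lfloor>real (Suc n) * s\<rfloor> / real (Suc n)" by simp
    qed
    show "\<forall>\<^sub>F n in sequentially. real_of_int \<lfloor>real (Suc n) * s\<rfloor> / real (Suc n) \<le> s"
    proof (rule always_eventually, rule allI)
      fix n
      have "real_of_int \<lfloor>real (Suc n) * s\<rfloor> \<le> real (Suc n) * s" by linarith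
      then have "real_of_int \<lfloor>real (Suc n) * s\<rfloor> / real (Suc n) \<le> (real (Suc n) * s) / real (Suc n)"
        by (intro divide_right_mono) auto
      then show "real_of_int \<lfloor>real (Suc n) * s\<rfloor> / real (Suc n) \<le> s" by (simp del: of_nat_Suc)
    qed
  qed
  then have "(\<lambda>n. V (real_of_int \<lfloor>real (Suc n) * s\<rfloor> / real (Suc n)) \<omega>) \<longlonglongrightarrow> V s \<omega>"
    using cont[OF p(2)] by (intro continuous_on_tendsto_compose[OF cont[OF p(2)]]) auto
  then show "(\<lambda>n. case p of (s, \<omega>) \<Rightarrow> V (real_of_int \<lfloor>real (Suc n) * s\<rfloor> / real (Suc n)) \<omega>) \<longlonglongrightarrow> (case p of (s, \<omega>) \<Rightarrow> V s \<omega>)"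
    by (simp add: p)
qed

lemma brownian_jointly_measurable:
  fixes W :: "real \<Rightarrow> 'w \<Rightarrow> 'a::euclidean_space"
  assumes "standard_brownian_motion M x W"
  shows "(\<lambda>(s, \<omega>). W (max 0 s) \<omega>) \<in> borel_measurable (borel \<Otimes>\<^sub>M M)"
proof (rule continuous_paths_jointly_measurable)
  show "W (max 0 s) \<in> borel_measurable M" for s
    using assms by (simp add: standard_brownian_motion_def)
  fix \<omega> assume "\<omega> \<in> space M"
  then have "continuous_on {0..} (\<lambda>s. W s \<omega>)"
    using assms by (simp add: standard_brownian_motion_def)
  then show "continuous_on UNIV (\<lambda>s. W (max 0 s) \<omega>)"
    by (rule continuous_on_compose2) (auto intro!: continuous_intros)
qed

section \<open>Super-solutions of the cumulant equation\<close>

context branching_triple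
begin

lemma cumulant_measurable:
  assumes "cumulant_solution P W \<Psi> f v"
  shows "(\<lambda>p. v (fst p) (max 0 (snd p))) \<in> borel_measurable borel"
proof -
  have v: "(\<lambda>(x, t). v x t) \<in> borel_measurable (restrict_space borel (UNIV \<times> {0..}))"
    using assms by (simp add: cumulant_solution_def)
  have "(\<lambda>p :: 'a \<times> real. (fst p, max 0 (snd p))) \<in> measurable borel (restrict_space borel (UNIV \<times> {0..}))"
    by (rule measurable_restrict_space2) (auto intro!: borel_measurable_continuous_onI continuous_intros)
  from measurable_compose[OF this v] show ?thesis by simp
qed

text \<open>Since \<open>\<Psi> \<ge> 0\<close>, the equation keeps \<open>v\<close> below
  \<open>m\<close>. In the other direction the motion costs at most \<open>L * sqrt t\<close> and
  the branching at most \<open>t * C\<close>. These a priori bounds control the argument of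
  \<open>\<Psi>\<close> in the sharper estimate that follows.\<close>

lemma cumulant_bounds:
  fixes W :: "real \<Rightarrow> 'w \<Rightarrow> 'a"
  assumes BM: "\<And>x. standard_brownian_motion (P x) x W"
    and sol: "cumulant_solution P W \<Psi> (\<lambda>x. \<gamma> (c * (x \<bullet> b))) v"
    and b: "b \<in> Basis" and c: "\<bar>c\<bar> = 1"
    and \<gamma>: "\<And>y. 0 \<le> \<gamma> y" "\<And>y. \<gamma> y \<le> m" and lip: "L-lipschitz_on UNIV \<gamma>"
    and C: "\<And>x u. 0 \<le> u \<Longrightarrow> u \<le> m \<Longrightarrow> \<Psi> x u \<le> C"
    and t: "0 \<le> t"
  shows "0 \<le> v x t" "v x t \<le> m" "\<gamma> (c * (x \<bullet> b)) - L * sqrt t - t * C \<le> v x t"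
proof -
  have [measurable]: "\<gamma> \<in> borel_measurable borel"
    using lipschitz_on_continuous_on[OF lip] by (rule borel_measurable_continuous_onI)
  have v_nonneg: "0 \<le> v x t" if "0 \<le> t" for x t
    using sol that unfolding cumulant_solution_def by blast
  show "0 \<le> v x t" by (rule v_nonneg[OF t])
  have v_eq: "v x t = (\<integral>\<omega>. \<gamma> (c * (W t \<omega> \<bullet> b)) \<partial>P x) -
      (\<integral>\<omega>. (LBINT s:{0..t}. \<Psi> (W s \<omega>) (v (W s \<omega>) (t - s))) \<partial>P x)" if "0 \<le> t" for x t
    using sol that by (simp add: cumulant_solution_def)
  have prob: "prob_space (P x)" for x using BM[of x] by (simp add: standard_brownian_motion_def)
  have W_meas: "W t \<in> borel_measurable (P x)" if "0 \<le> t" for x t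
    using BM[of x] that by (simp add: standard_brownian_motion_def)
  have m: "0 \<le> m" using \<gamma>[of 0] by simp
  have \<gamma>_int: "integrable (P x) (\<lambda>\<omega>. \<gamma> (c * (W t \<omega> \<bullet> b)))" if "0 \<le> t" for x t
  proof -
    interpret prob_space "P x" by (rule prob)
    note [measurable] = W_meas[OF that]
    show ?thesis by (rule integrable_const_bound[where B = m]) (auto simp: \<gamma>)
  qed
  have v_le: "v x t \<le> m" if "0 \<le> t" for x t
  proof -
    interpret prob_space "P x" by (rule prob)
    have "(\<integral>\<omega>. \<gamma> (c * (W t \<omega> \<bullet> b)) \<partial>P x) \<le> m"
      by (rule integral_le_const[OF \<gamma>_int[OF that]]) (simp add: \<gamma>)
    moreover have "0 \<le> (\<integral>\<omega>. (LBINT s:{0..t}. \<Psi> (W s \<omega>) (v (W s \<omega>) (t - s))) \<partial>P x)"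
      unfolding set_lebesgue_integral_def
      by (intro integral_nonneg_AE AE_I2) (auto simp: indicator_def nonneg v_nonneg)
    ultimately show ?thesis unfolding v_eq[OF that] by simp
  qed
  show "v x t \<le> m" by (rule v_le[OF t])
  interpret prob_space "P x" by (rule prob)
  let ?Z = "\<lambda>\<omega>. c * ((W t \<omega> - W 0 \<omega>) \<bullet> b)"
  note Z = brownian_component_moments[OF BM t b c, of x]
  have C_nonneg: "0 \<le> C" using C[of 0 x] m by simp
  \<comment> \<open>Integrability of the left side is not yet known; the default value 0 is covered
    because the bound is non-negative.\<close>
  have "(\<integral>\<omega>. (LBINT s:{0..t}. \<Psi> (W s \<omega>) (v (W s \<omega>) (t - s))) \<partial>P x) \<le> (\<integral>\<omega>. t * C \<partial>P x)"
    using t C_nonneg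
    by (intro integral_mono' set_integral_le_const) (auto intro!: C v_le v_nonneg)
  then have inner: "(\<integral>\<omega>. (LBINT s:{0..t}. \<Psi> (W s \<omega>) (v (W s \<omega>) (t - s))) \<partial>P x) \<le> t * C"
    by (simp add: prob_space)
  have start: "AE \<omega> in P x. W 0 \<omega> = x" using BM[of x] by (simp add: standard_brownian_motion_def)
  have "(\<integral>\<omega>. \<gamma> (c * (x \<bullet> b)) - L * \<bar>?Z \<omega>\<bar> \<partial>P x) \<le> (\<integral>\<omega>. \<gamma> (c * (W t \<omega> \<bullet> b)) \<partial>P x)"
  proof (rule integral_mono_AE)
    show "integrable (P x) (\<lambda>\<omega>. \<gamma> (c * (x \<bullet> b)) - L * \<bar>?Z \<omega>\<bar>)"
      using Z(1) by simp
    show "AE \<omega> in P x. \<gamma> (c * (x \<bullet> b)) - L * \<bar>?Z \<omega>\<bar> \<le> \<gamma> (c * (W t \<omega> \<bullet> b))"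
      using start
    proof eventually_elim
      case (elim \<omega>)
      then show ?case
        using lipschitz_onD[OF lip, of "c * (x \<bullet> b)" "c * (W t \<omega> \<bullet> b)"]
        by (simp add: dist_real_def inner_diff_left right_diff_distrib abs_minus_commute)
    qed
  qed (rule \<gamma>_int[OF t])
  moreover have "(\<integral>\<omega>. \<gamma> (c * (x \<bullet> b)) - L * \<bar>?Z \<omega>\<bar> \<partial>P x) = \<gamma> (c * (x \<bullet> b)) - L * (\<integral>\<omega>. \<bar>?Z \<omega>\<bar> \<partial>P x)"
    using Z(1) by (simp add: prob_space)
  moreover have "L * (\<integral>\<omega>. \<bar>?Z \<omega>\<bar> \<partial>P x) \<le> L * sqrt t"
    by (intro mult_left_mono Z(7) lipschitz_on_nonneg[OF lip])
  ultimately show "\<gamma> (c * (x \<bullet> b)) - L * sqrt t - t * C \<le> v x t"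
    using inner v_eq[OF t, of x] by linarith
qed

text \<open>An upper bound for \<open>v\<close> needs a lower bound for the branching loss. Its
  integrand is at least \<open>\<Phi>\<close> of \<open>v\<close>, and replacing
  \<open>v (W s \<omega>) (h - s)\<close> by the initial value at \<open>x\<close> costs
  \<open>K\<close> times a displacement: one \<open>L * sqrt h\<close> and \<open>h * C\<close> from
  \<open>cumulant_bounds\<close>, and another \<open>L * sqrt h\<close> for the motion from
  \<open>x\<close> to \<open>W s \<omega>\<close>.\<close>

lemma cumulant_upper_bound:
  fixes W :: "real \<Rightarrow> 'w \<Rightarrow> 'a" and \<Phi> :: "real \<Rightarrow> real"
  assumes BM: "\<And>x. standard_brownian_motion (P x) x W"
    and sol: "cumulant_solution P W \<Psi> (\<lambda>x. \<gamma> (c * (x \<bullet> b))) v"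
    and b: "b \<in> Basis" and c: "\<bar>c\<bar> = 1"
    and \<gamma>: "\<And>y. 0 \<le> \<gamma> y" "\<And>y. \<gamma> y \<le> m" and lip: "L-lipschitz_on UNIV \<gamma>"
    and C: "\<And>x u. 0 \<le> u \<Longrightarrow> u \<le> m \<Longrightarrow> \<Psi> x u \<le> C"
    and \<Phi>_le: "\<And>x u. 0 \<le> u \<Longrightarrow> \<Phi> u \<le> \<Psi> x u"
    and \<Phi>_mono: "\<And>u v. 0 \<le> u \<Longrightarrow> u \<le> v \<Longrightarrow> \<Phi> u \<le> \<Phi> v"
    and K: "0 \<le> K" "\<And>u v. 0 \<le> u \<Longrightarrow> u \<le> v \<Longrightarrow> v \<le> m \<Longrightarrow> \<Phi> v - \<Phi> u \<le> K * (v - u)"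
    and h: "0 \<le> h"
  shows "v x h \<le> (\<integral>\<omega>. \<gamma> (c * (W h \<omega> \<bullet> b)) \<partial>P x) -
    h * (\<Phi> (\<gamma> (c * (x \<bullet> b))) - K * (2 * L * sqrt h + h * C))"
proof -
  interpret Px: prob_space "P x" using BM[of x] by (simp add: standard_brownian_motion_def)
  interpret pair_sigma_finite lborel "P x" ..
  have [measurable]: "\<gamma> \<in> borel_measurable borel"
    using lipschitz_on_continuous_on[OF lip] by (rule borel_measurable_continuous_onI)
  note v_bounds = cumulant_bounds[OF BM sol b c \<gamma> lip C]
  have L: "0 \<le> L" by (rule lipschitz_on_nonneg[OF lip])
  have m: "0 \<le> m" using \<gamma>[of 0] by simp
  have C_nonneg: "0 \<le> C" using C[of 0 x] m by simp
  \<comment> \<open>Only a lower bound on the new argument is at hand; if it exceeds the old one,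
    monotonicity of \<open>\<Phi>\<close> takes over.\<close>
  have \<Phi>_lip: "\<Phi> u - K * d \<le> \<Phi> v" if "0 \<le> u" "0 \<le> v" "u \<le> m" "u - d \<le> v" "0 \<le> d" for u v d
  proof (cases "u \<le> v")
    case True
    then have "\<Phi> u \<le> \<Phi> v" using \<Phi>_mono that by blast
    moreover have "0 \<le> K * d" using K(1) that(5) by simp
    ultimately show ?thesis by linarith
  next
    case False
    then have "\<Phi> u - \<Phi> v \<le> K * (u - v)" using K(2) that by simp
    also have "\<dots> \<le> K * d" using K(1) that by (intro mult_left_mono) auto
    finally show ?thesis by simp
  qed
  have W0 [measurable]: "W 0 \<in> borel_measurable (P x)"
    using BM[of x] by (simp add: standard_brownian_motion_def)
  have Wm: "(\<lambda>p. W (max 0 (fst p)) (snd p)) \<in> borel_measurable (lborel \<Otimes>\<^sub>M P x)"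
    using brownian_jointly_measurable[OF BM[of x]]
    by (simp add: case_prod_beta cong: measurable_cong_sets sets_pair_measure_cong)
  define Z where "Z s \<omega> = c * ((W (max 0 s) \<omega> - W 0 \<omega>) \<bullet> b)" for s \<omega>
  have Zm [measurable]: "(\<lambda>p. Z (fst p) (snd p)) \<in> borel_measurable (lborel \<Otimes>\<^sub>M P x)"
    unfolding Z_def using Wm by measurable
  have Z_abs: "integrable (P x) (\<lambda>\<omega>. \<bar>Z s \<omega>\<bar>)" "(\<integral>\<omega>. \<bar>Z s \<omega>\<bar> \<partial>P x) \<le> sqrt (max 0 s)" for s
    unfolding Z_def using brownian_component_moments(1,7)[OF BM _ b c, of "max 0 s" x] by auto
  define D where "D s \<omega> = indicator {0..h} s *\<^sub>R \<Psi> (W s \<omega>) (v (W s \<omega>) (h - s))" for s \<omega>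
  define \<eta> where "\<eta> = L * sqrt h + h * C"
  \<comment> \<open>\<open>J\<close> is a minorant of the loss integrand \<open>D\<close> for each
    \<open>s\<close>, almost surely, and its expectation is explicit up to the absolute moment of
    \<open>Z\<close>.\<close>
  define J where "J s \<omega> = indicator {0..h} s * (\<Phi> (\<gamma> (c * (x \<bullet> b))) - K * \<eta> - K * (L * \<bar>Z s \<omega>\<bar>))" for s \<omega>
  have \<eta>: "0 \<le> \<eta>" using L h C_nonneg by (simp add: \<eta>_def)
  have Dm: "(\<lambda>(s, \<omega>). D s \<omega>) \<in> borel_measurable (lborel \<Otimes>\<^sub>M P x)"
  proof -
    note vm = cumulant_measurable[OF sol]
    have "(\<lambda>p. (W (max 0 (fst p)) (snd p), h - fst p)) \<in> measurable (lborel \<Otimes>\<^sub>M P x) borel"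
      unfolding borel_prod[symmetric] using Wm by measurable
    from measurable_compose[OF this vm]
    have "(\<lambda>p. v (W (max 0 (fst p)) (snd p)) (max 0 (h - fst p))) \<in> borel_measurable (lborel \<Otimes>\<^sub>M P x)"
      by simp
    then have "(\<lambda>p. (W (max 0 (fst p)) (snd p), v (W (max 0 (fst p)) (snd p)) (max 0 (h - fst p))))
        \<in> measurable (lborel \<Otimes>\<^sub>M P x) (borel \<Otimes>\<^sub>M borel)"
      using Wm by measurable
    from measurable_compose[OF this jointly_measurable]
    have "(\<lambda>p. \<Psi> (W (max 0 (fst p)) (snd p)) (v (W (max 0 (fst p)) (snd p)) (max 0 (h - fst p))))
        \<in> borel_measurable (lborel \<Otimes>\<^sub>M P x)"
      by (simp add: v_bounds)
    then have "(\<lambda>p. indicator {0..h} (fst p) *\<^sub>R \<Psi> (W (max 0 (fst p)) (snd p)) (v (W (max 0 (fst p)) (snd p)) (max 0 (h - fst p))))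
        \<in> borel_measurable (lborel \<Otimes>\<^sub>M P x)"
      by measurable
    also have "(\<lambda>p. indicator {0..h} (fst p) *\<^sub>R \<Psi> (W (max 0 (fst p)) (snd p)) (v (W (max 0 (fst p)) (snd p)) (max 0 (h - fst p))))
        = (\<lambda>(s, \<omega>). D s \<omega>)"
      by (auto simp: D_def fun_eq_iff indicator_def max_def)
    finally show ?thesis .
  qed
  have D_bound: "norm (D s \<omega>) \<le> indicator {0..h} s * C" for s \<omega>
    using C_nonneg C[of "v (W s \<omega>) (h - s)" "W s \<omega>"] nonneg[of "v (W s \<omega>) (h - s)" "W s \<omega>"] v_bounds[of "h - s" "W s \<omega>"]
    by (simp add: D_def indicator_def)
  have ind_int: "integrable lborel (\<lambda>s. indicator {0..h} s * k)" for k :: real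
    by (intro integrable_mult_left integrable_real_indicator) (auto simp: emeasure_lborel_Icc_eq)
  \<comment> \<open>Joint integrability allows the expectation to be taken at fixed time before the
    time integral, whereas the equation has them in the opposite order.\<close>
  have D_int: "integrable (lborel \<Otimes>\<^sub>M P x) (\<lambda>(s, \<omega>). D s \<omega>)"
  proof (rule Fubini_integrable[OF Dm])
    show "AE s in lborel. integrable (P x) (\<lambda>\<omega>. case (s, \<omega>) of (s, \<omega>) \<Rightarrow> D s \<omega>)"
    proof (rule AE_I2)
      fix s :: real assume s: "s \<in> space lborel"
      have "(\<lambda>\<omega>. D s \<omega>) \<in> borel_measurable (P x)"
        using measurable_Pair2[OF Dm s] by simp
      then show "integrable (P x) (\<lambda>\<omega>. case (s, \<omega>) of (s, \<omega>) \<Rightarrow> D s \<omega>)"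
        using D_bound[of s] by (auto intro!: Px.integrable_const_bound[where B = "indicator {0..h} s * C"])
    qed
    show "integrable lborel (\<lambda>s. \<integral>\<omega>. norm (case (s, \<omega>) of (s, \<omega>) \<Rightarrow> D s \<omega>) \<partial>P x)"
    proof (rule Bochner_Integration.integrable_bound[OF ind_int[of C]])
      show "(\<lambda>s. \<integral>\<omega>. norm (case (s, \<omega>) of (s, \<omega>) \<Rightarrow> D s \<omega>) \<partial>P x) \<in> borel_measurable lborel"
        using Dm by (intro Px.borel_measurable_lebesgue_integral) (simp add: case_prod_beta)
      show "AE s in lborel. norm (\<integral>\<omega>. norm (case (s, \<omega>) of (s, \<omega>) \<Rightarrow> D s \<omega>) \<partial>P x) \<le> norm (indicator {0..h} s * C)"
      proof (rule AE_I2)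
        fix s :: real
        have "(\<integral>\<omega>. norm (D s \<omega>) \<partial>P x) \<le> (\<integral>\<omega>. indicator {0..h} s * C \<partial>P x)"
          using C_nonneg by (intro integral_mono' D_bound) auto
        then show "norm (\<integral>\<omega>. norm (case (s, \<omega>) of (s, \<omega>) \<Rightarrow> D s \<omega>) \<partial>P x) \<le> norm (indicator {0..h} s * C)"
          using C_nonneg by (simp add: Px.prob_space integral_nonneg_AE)
      qed
    qed
  qed
  have J_lower: "h * (\<Phi> (\<gamma> (c * (x \<bullet> b))) - K * \<eta> - K * (L * sqrt h)) \<le> (\<integral>s. (\<integral>\<omega>. J s \<omega> \<partial>P x) \<partial>lborel)"
    and J_int: "integrable lborel (\<lambda>s. \<integral>\<omega>. J s \<omega> \<partial>P x)"
    and J_int_\<omega>: "integrable (P x) (\<lambda>\<omega>. J s \<omega>)" for s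
  proof -
    show J_int_\<omega>: "integrable (P x) (\<lambda>\<omega>. J s \<omega>)" for s
      unfolding J_def using Z_abs(1)[of s] by simp
    have J_val: "(\<integral>\<omega>. J s \<omega> \<partial>P x) = indicator {0..h} s * (\<Phi> (\<gamma> (c * (x \<bullet> b))) - K * \<eta> - K * (L * (\<integral>\<omega>. \<bar>Z s \<omega>\<bar> \<partial>P x)))" for s
      unfolding J_def using Z_abs(1)[of s] by (simp add: Px.prob_space)
    have Eint: "integrable lborel (\<lambda>s. indicator {0..h} s * (\<integral>\<omega>. \<bar>Z s \<omega>\<bar> \<partial>P x))"
    proof (rule Bochner_Integration.integrable_bound[OF ind_int[of "sqrt h"]])
      have "(\<lambda>s. \<integral>\<omega>. \<bar>Z s \<omega>\<bar> \<partial>P x) \<in> borel_measurable lborel"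
        using Zm by (intro Px.borel_measurable_lebesgue_integral) (simp add: case_prod_beta)
      then show "(\<lambda>s. indicator {0..h} s * (\<integral>\<omega>. \<bar>Z s \<omega>\<bar> \<partial>P x)) \<in> borel_measurable lborel"
        by measurable
      show "AE s in lborel. norm (indicator {0..h} s * (\<integral>\<omega>. \<bar>Z s \<omega>\<bar> \<partial>P x)) \<le> norm (indicator {0..h} s * sqrt h)"
      proof (rule AE_I2)
        fix s :: real
        show "norm (indicator {0..h} s * (\<integral>\<omega>. \<bar>Z s \<omega>\<bar> \<partial>P x)) \<le> norm (indicator {0..h} s * sqrt h)"
          using order_trans[OF Z_abs(2)[of s], of "sqrt h"] h by (auto simp: indicator_def integral_nonneg_AE)
      qed
    qed
    have J_split: "(\<integral>\<omega>. J s \<omega> \<partial>P x) = indicator {0..h} s * (\<Phi> (\<gamma> (c * (x \<bullet> b))) - K * \<eta>)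
        - (K * L) * (indicator {0..h} s * (\<integral>\<omega>. \<bar>Z s \<omega>\<bar> \<partial>P x))" for s
      unfolding J_val by (simp add: algebra_simps)
    show J_int: "integrable lborel (\<lambda>s. \<integral>\<omega>. J s \<omega> \<partial>P x)"
      unfolding J_split by (intro Bochner_Integration.integrable_diff ind_int integrable_mult_right Eint)
    have "(\<integral>s. indicator {0..h} s * (\<Phi> (\<gamma> (c * (x \<bullet> b))) - K * \<eta> - K * (L * sqrt h)) \<partial>lborel) \<le> (\<integral>s. (\<integral>\<omega>. J s \<omega> \<partial>P x) \<partial>lborel)"
    proof (rule integral_mono[OF ind_int J_int])
      fix s :: real
      have "K * (L * (\<integral>\<omega>. \<bar>Z s \<omega>\<bar> \<partial>P x)) \<le> K * (L * sqrt h)" if "s \<in> {0..h}"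
        using that K(1) L order_trans[OF Z_abs(2)[of s], of "sqrt h"] by (intro mult_left_mono) auto
      then show "indicator {0..h} s * (\<Phi> (\<gamma> (c * (x \<bullet> b))) - K * \<eta> - K * (L * sqrt h)) \<le> (\<integral>\<omega>. J s \<omega> \<partial>P x)"
        unfolding J_val by (auto simp: indicator_def)
    qed
    then show "h * (\<Phi> (\<gamma> (c * (x \<bullet> b))) - K * \<eta> - K * (L * sqrt h)) \<le> (\<integral>s. (\<integral>\<omega>. J s \<omega> \<partial>P x) \<partial>lborel)"
      using h by simp
  qed
  have start: "AE \<omega> in P x. W 0 \<omega> = x" using BM[of x] by (simp add: standard_brownian_motion_def)
  have "(\<integral>s. (\<integral>\<omega>. J s \<omega> \<partial>P x) \<partial>lborel) \<le> (\<integral>s. (\<integral>\<omega>. D s \<omega> \<partial>P x) \<partial>lborel)"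
  proof (rule integral_mono[OF J_int])
    show "integrable lborel (\<lambda>s. \<integral>\<omega>. D s \<omega> \<partial>P x)"
      using integrable_fst[OF D_int] .
    fix s :: real assume s: "s \<in> space lborel"
    show "(\<integral>\<omega>. J s \<omega> \<partial>P x) \<le> (\<integral>\<omega>. D s \<omega> \<partial>P x)"
    proof (rule integral_mono_AE[OF J_int_\<omega>])
      have "(\<lambda>\<omega>. D s \<omega>) \<in> borel_measurable (P x)"
        using measurable_Pair2[OF Dm s] by simp
      then show "integrable (P x) (D s)"
        using D_bound[of s] by (auto intro!: Px.integrable_const_bound[where B = "indicator {0..h} s * C"])
      show "AE \<omega> in P x. J s \<omega> \<le> D s \<omega>"
        using start
      proof eventually_elim
        case (elim \<omega>)
        show ?case
        proof (cases "s \<in> {0..h}")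
          case True
          let ?y = "W s \<omega>"
          have Z: "\<bar>Z s \<omega>\<bar> = \<bar>c * (x \<bullet> b) - c * (?y \<bullet> b)\<bar>"
            using True elim by (simp add: Z_def max_def inner_diff_left right_diff_distrib abs_minus_commute)
          have near: "\<gamma> (c * (x \<bullet> b)) - L * \<bar>Z s \<omega>\<bar> \<le> \<gamma> (c * (?y \<bullet> b))"
            using lipschitz_onD[OF lip, of "c * (x \<bullet> b)" "c * (?y \<bullet> b)"] Z
            by (simp add: dist_real_def)
          have "L * sqrt (h - s) \<le> L * sqrt h" "(h - s) * C \<le> h * C"
            using True L C_nonneg by (auto intro!: mult_left_mono mult_right_mono)
          then have "\<gamma> (c * (?y \<bullet> b)) - \<eta> \<le> v ?y (h - s)"
            using v_bounds(3)[of "h - s" ?y] True by (simp add: \<eta>_def)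
          then have "\<gamma> (c * (x \<bullet> b)) - (\<eta> + L * \<bar>Z s \<omega>\<bar>) \<le> v ?y (h - s)" using near by simp
          then have "\<Phi> (\<gamma> (c * (x \<bullet> b))) - K * (\<eta> + L * \<bar>Z s \<omega>\<bar>) \<le> \<Phi> (v ?y (h - s))"
            using True \<gamma> \<eta> L by (intro \<Phi>_lip v_bounds) auto
          also have "\<dots> \<le> \<Psi> ?y (v ?y (h - s))" using True by (intro \<Phi>_le v_bounds) auto
          finally show ?thesis using True by (simp add: J_def D_def distrib_left)
        qed (simp add: J_def D_def)
      qed
    qed
  qed
  also have "\<dots> = (\<integral>\<omega>. (\<integral>s. D s \<omega> \<partial>lborel) \<partial>P x)"
    using Fubini_integral[OF D_int] by simp
  finally have inner: "h * (\<Phi> (\<gamma> (c * (x \<bullet> b))) - K * \<eta> - K * (L * sqrt h)) \<le> (\<integral>\<omega>. (\<integral>s. D s \<omega> \<partial>lborel) \<partial>P x)"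
    using J_lower by linarith
  have "v x h = (\<integral>\<omega>. \<gamma> (c * (W h \<omega> \<bullet> b)) \<partial>P x) - (\<integral>\<omega>. (\<integral>s. D s \<omega> \<partial>lborel) \<partial>P x)"
    using sol h by (simp add: cumulant_solution_def D_def set_lebesgue_integral_def)
  with inner show ?thesis by (simp add: \<eta>_def algebra_simps)
qed

text \<open>The balance over one step is as follows. The motion raises \<open>w\<close> by at most
  \<open>h * \<Phi> (w y) / 2\<close>, the initial condition adds \<open>h * \<theta> * f y\<close>,
  and the branching removes about \<open>h * \<Phi> (w y)\<close>. The net change is at most
  \<open>h * (\<theta> * f y - \<Phi> (w y) / 2 + Q * sqrt h)\<close>, and the margin
  \<open>\<epsilon>\<close> makes this non-positive for small \<open>h\<close>, uniformly in
  \<open>x\<close>.\<close>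

lemma cumulant_one_step:
  fixes W :: "real \<Rightarrow> 'w \<Rightarrow> 'a" and \<Phi> w f :: "real \<Rightarrow> real"
  assumes BM: "\<And>x. standard_brownian_motion (P x) x W"
    and b: "b \<in> Basis" and c: "\<bar>c\<bar> = 1"
    and \<Phi>_le: "\<And>x u. 0 \<le> u \<Longrightarrow> \<Phi> u \<le> \<Psi> x u"
    and \<Phi>_mono: "\<And>u v. 0 \<le> u \<Longrightarrow> u \<le> v \<Longrightarrow> \<Phi> u \<le> \<Phi> v"
    and K: "0 \<le> K" "\<And>u v. 0 \<le> u \<Longrightarrow> u \<le> v \<Longrightarrow> v \<le> M + 1 \<Longrightarrow> \<Phi> v - \<Phi> u \<le> K * (v - u)"
    and w: "\<And>y. 0 \<le> w y" "\<And>y. w y \<le> M" "L-lipschitz_on UNIV w"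
    and taylor: "\<And>y. \<exists>p. \<forall>z. w (y + z) \<le> w y + p * z + \<Phi> (w y) / 2 * z\<^sup>2 + C4 * z ^ 4"
    and f: "\<And>y. 0 \<le> f y" "\<And>y. f y \<le> 1" "1-lipschitz_on UNIV f"
    and \<theta>: "0 \<le> \<theta>" and \<epsilon>: "0 < \<epsilon>" and strict: "\<And>y. \<theta> * f y + \<epsilon> \<le> \<Phi> (w y) / 2"
  obtains h0 where "0 < h0"
    "\<And>h v x. 0 < h \<Longrightarrow> h \<le> h0 \<Longrightarrow>
      cumulant_solution P W \<Psi> (\<lambda>x. w (c * (x \<bullet> b)) + h * \<theta> * f (c * (x \<bullet> b))) v \<Longrightarrow> v x h \<le> w (c * (x \<bullet> b))"
proof -
  have M: "0 \<le> M" using w(1,2)[of 0] by simp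
  have L: "0 \<le> L" by (rule lipschitz_on_nonneg[OF w(3)])
  obtain K' where K': "0 \<le> K'"
    "\<And>x u v. 0 \<le> u \<Longrightarrow> u \<le> v \<Longrightarrow> v \<le> M + 1 \<Longrightarrow> \<Psi> x v - \<Psi> x u \<le> K' * (v - u)"
    using lipschitz by metis
  define C where "C = K' * (M + 1)"
  have C: "\<Psi> x u \<le> C" if "0 \<le> u" "u \<le> M + 1" for x u
  proof -
    have "\<Psi> x u \<le> K' * u" using K'(2)[of 0 u x] that by simp
    also have "\<dots> \<le> C" unfolding C_def using that K'(1) by (intro mult_left_mono) auto
    finally show ?thesis .
  qed
  have C_nonneg: "0 \<le> C" using K'(1) M by (simp add: C_def)
  \<comment> \<open>The three parts are the fourth moment in the Taylor bound, the displacement of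
    \<open>f\<close>, and the errors in the branching loss, all of order at most
    \<open>h * sqrt h\<close> when \<open>h \<le> 1\<close>.\<close>
  define Q where "Q = 3 * \<bar>C4\<bar> + \<theta> + K * (2 * (L + 1) + C)"
  have Q: "0 \<le> Q" using \<theta> K(1) L C_nonneg by (simp add: Q_def)
  \<comment> \<open>The first bound gives \<open>h \<le> sqrt h\<close>, the second keeps the
    initial function below \<open>M + 1\<close>, where \<open>K\<close> is valid, and the third
    gives \<open>Q * sqrt h \<le> \<epsilon>\<close>.\<close>
  define h0 where "h0 = min (min 1 (1 / (\<theta> + 1))) ((\<epsilon> / (Q + 1))\<^sup>2)"
  show ?thesis
  proof (rule that[of h0])
    show "0 < h0" using \<theta> \<epsilon> Q by (simp add: h0_def)
  next
    fix h v x
    assume h: "0 < h" "h \<le> h0"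
      and sol: "cumulant_solution P W \<Psi> (\<lambda>x. w (c * (x \<bullet> b)) + h * \<theta> * f (c * (x \<bullet> b))) v"
    have h1: "h \<le> 1" "h \<le> 1 / (\<theta> + 1)" "h \<le> (\<epsilon> / (Q + 1))\<^sup>2" using h(2) by (auto simp: h0_def)
    have h\<theta>: "h * \<theta> \<le> 1" "0 \<le> h * \<theta>"
      using h1(2) \<theta> h(1) by (simp_all add: field_simps)
    have sh: "0 < sqrt h" "h \<le> sqrt h" using h(1) h1(1) by (auto simp: real_le_rsqrt power2_eq_square mult_le_one mult_left_le)
    have "sqrt h \<le> \<epsilon> / (Q + 1)" using h1(3) \<epsilon> Q by (intro real_le_lsqrt) auto
    then have "sqrt h * (Q + 1) \<le> \<epsilon>" using Q by (simp add: pos_le_divide_eq)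
    then have "sqrt h * Q + sqrt h \<le> \<epsilon>" by (simp only: distrib_left mult_1_right)
    then have Qsh: "Q * sqrt h \<le> \<epsilon>" using sh(1) unfolding mult.commute[of Q] by linarith
    define \<gamma> where "\<gamma> y = w y + h * \<theta> * f y" for y
    have \<gamma>: "0 \<le> \<gamma> y" "\<gamma> y \<le> M + 1" "w y \<le> \<gamma> y" for y
    proof -
      have "h * \<theta> * f y \<le> 1" "0 \<le> h * \<theta> * f y"
        using h\<theta> f(1,2)[of y] mult_mono[of "h * \<theta>" 1 "f y" 1] by auto
      then show "0 \<le> \<gamma> y" "\<gamma> y \<le> M + 1" "w y \<le> \<gamma> y" using w(1,2)[of y] by (auto simp: \<gamma>_def)
    qed
    have lip: "(L + 1)-lipschitz_on UNIV \<gamma>"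
    proof -
      have "(L + \<bar>h * \<theta>\<bar> * 1)-lipschitz_on UNIV \<gamma>"
        unfolding \<gamma>_def using lipschitz_on_add[OF w(3) lipschitz_on_cmult_real[OF f(3), of "h * \<theta>"]] by simp
      then show ?thesis by (rule lipschitz_on_le) (use h\<theta> in simp)
    qed
    interpret Px: prob_space "P x" using BM[of x] by (simp add: standard_brownian_motion_def)
    have [measurable]: "\<gamma> \<in> borel_measurable borel" "W h \<in> borel_measurable (P x)"
      using lipschitz_on_continuous_on[OF lip] BM[of x] h(1)
      by (auto simp: standard_brownian_motion_def intro: borel_measurable_continuous_onI)
    define y where "y = c * (x \<bullet> b)"
    define Z where "Z \<omega> = c * ((W h \<omega> - W 0 \<omega>) \<bullet> b)" for \<omega>
    note Z = brownian_component_moments[OF BM less_imp_le[OF h(1)] b c, of x, folded Z_def]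
    have start: "AE \<omega> in P x. W 0 \<omega> = x" using BM[of x] by (simp add: standard_brownian_motion_def)
    obtain p where p: "\<And>z. w (y + z) \<le> w y + p * z + \<Phi> (w y) / 2 * z\<^sup>2 + C4 * z ^ 4"
      using taylor by blast
    have "(\<integral>\<omega>. \<gamma> (c * (W h \<omega> \<bullet> b)) \<partial>P x) \<le> (\<integral>\<omega>. w y + p * Z \<omega> + \<Phi> (w y) / 2 * (Z \<omega>)\<^sup>2 + C4 * Z \<omega> ^ 4 + h * \<theta> * (f y + \<bar>Z \<omega>\<bar>) \<partial>P x)"
    proof (rule integral_mono_AE)
      show "integrable (P x) (\<lambda>\<omega>. \<gamma> (c * (W h \<omega> \<bullet> b)))"
        by (rule Px.integrable_const_bound[where B = "M + 1"]) (auto simp: \<gamma>)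
      show "integrable (P x) (\<lambda>\<omega>. w y + p * Z \<omega> + \<Phi> (w y) / 2 * (Z \<omega>)\<^sup>2 + C4 * Z \<omega> ^ 4 + h * \<theta> * (f y + \<bar>Z \<omega>\<bar>))"
        using Z by simp
      show "AE \<omega> in P x. \<gamma> (c * (W h \<omega> \<bullet> b)) \<le> w y + p * Z \<omega> + \<Phi> (w y) / 2 * (Z \<omega>)\<^sup>2 + C4 * Z \<omega> ^ 4 + h * \<theta> * (f y + \<bar>Z \<omega>\<bar>)"
        using start
      proof eventually_elim
        case (elim \<omega>)
        then have yZ: "c * (W h \<omega> \<bullet> b) = y + Z \<omega>"
          by (simp add: y_def Z_def inner_diff_left right_diff_distrib)
        have "f (y + Z \<omega>) \<le> f y + \<bar>Z \<omega>\<bar>"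
          using lipschitz_onD[OF f(3), of "y + Z \<omega>" y] by (simp add: dist_real_def)
        then have "h * \<theta> * f (y + Z \<omega>) \<le> h * \<theta> * (f y + \<bar>Z \<omega>\<bar>)" using h\<theta> by (intro mult_left_mono)
        then show ?case using p[of "Z \<omega>"] by (simp add: \<gamma>_def yZ)
      qed
    qed
    also have "\<dots> = w y + \<Phi> (w y) / 2 * h + C4 * (3 * h\<^sup>2) + h * \<theta> * (f y + (\<integral>\<omega>. \<bar>Z \<omega>\<bar> \<partial>P x))"
      using Z by (simp add: Px.prob_space)
    also have "\<dots> \<le> w y + \<Phi> (w y) / 2 * h + \<bar>C4\<bar> * (3 * (h * sqrt h)) + h * \<theta> * (f y + sqrt h)"
    proof (intro add_mono order_refl)
      show "C4 * (3 * h\<^sup>2) \<le> \<bar>C4\<bar> * (3 * (h * sqrt h))"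
        using h(1) sh by (intro mult_mono) (auto simp: power2_eq_square)
      show "h * \<theta> * (f y + (\<integral>\<omega>. \<bar>Z \<omega>\<bar> \<partial>P x)) \<le> h * \<theta> * (f y + sqrt h)"
        using Z(7) h\<theta> by (intro mult_left_mono) auto
    qed
    finally have upper: "(\<integral>\<omega>. \<gamma> (c * (W h \<omega> \<bullet> b)) \<partial>P x) \<le> \<dots>" .
    have "v x h \<le> (\<integral>\<omega>. \<gamma> (c * (W h \<omega> \<bullet> b)) \<partial>P x) -
      h * (\<Phi> (\<gamma> y) - K * (2 * (L + 1) * sqrt h + h * C))"
      unfolding y_def
      using cumulant_upper_bound[OF BM sol[folded \<gamma>_def] b c \<gamma>(1,2) lip C \<Phi>_le \<Phi>_mono K] h(1) by simp
    moreover have "h * (\<Phi> (w y) - K * (2 * (L + 1) * sqrt h + sqrt h * C)) \<le> h * (\<Phi> (\<gamma> y) - K * (2 * (L + 1) * sqrt h + h * C))"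
      using h(1) sh(2) C_nonneg K(1) \<Phi>_mono[OF w(1) \<gamma>(3), of y]
      by (intro mult_left_mono diff_mono add_mono mult_right_mono order_refl) auto
    moreover have "h * (\<theta> * f y - \<Phi> (w y) / 2 + Q * sqrt h) \<le> h * 0"
      using strict[of y] Qsh h(1) by (intro mult_left_mono) auto
    moreover have "w y + \<Phi> (w y) / 2 * h + \<bar>C4\<bar> * (3 * (h * sqrt h)) + h * \<theta> * (f y + sqrt h)
        - h * (\<Phi> (w y) - K * (2 * (L + 1) * sqrt h + sqrt h * C)) = w y + h * (\<theta> * f y - \<Phi> (w y) / 2 + Q * sqrt h)"
      unfolding Q_def by (simp add: field_simps)
    ultimately have "v x h \<le> w y" using upper by linarith
    then show "v x h \<le> w (c * (x \<bullet> b))" by (simp add: y_def)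
  qed
qed

end

section \<open>Cadlag Markov families of measure-valued paths\<close>

lemma space_finite_measure_borel [simp]:
    "space (finite_measure_borel :: 'a::euclidean_space measure measure) = finite_measures"
  and sets_finite_measure_borel_openin:
    "openin weak_topology U \<Longrightarrow> (U :: 'a measure set) \<in> sets finite_measure_borel"
proof -
  have sub: "{U. openin weak_topology U} \<subseteq> Pow (finite_measures :: 'a measure set)"
    using openin_subset topspace_weak_topology by blast
  show "space (finite_measure_borel :: 'a measure measure) = finite_measures"
    unfolding finite_measure_borel_def using sub by (rule space_measure_of)
  show "U \<in> sets finite_measure_borel" if "openin weak_topology U" for U :: "'a measure set"
    unfolding finite_measure_borel_def using that by (simp add: sets_measure_of[OF sub] sigma_sets.Basic)
qed

lemma openin_weak_integral:
  fixes f :: "'a::euclidean_space \<Rightarrow> real"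
  assumes "continuous_on UNIV f" "bounded (range f)" "open U"
  shows "openin weak_topology {\<mu> \<in> finite_measures. (\<integral>x. f x \<partial>\<mu>) \<in> U}"
  unfolding weak_topology_def using assms by (intro topology_generated_by_Basis) blast

lemma measurable_weak_integral:
  fixes f :: "'a::euclidean_space \<Rightarrow> real"
  assumes "continuous_on UNIV f" "bounded (range f)"
  shows "(\<lambda>\<mu>. \<integral>x. f x \<partial>\<mu>) \<in> borel_measurable finite_measure_borel"
proof (rule borel_measurableI)
  fix S :: "real set" assume "open S"
  then show "(\<lambda>\<mu>. \<integral>x. f x \<partial>\<mu>) -` S \<inter> space finite_measure_borel \<in> sets finite_measure_borel"
    using sets_finite_measure_borel_openin[OF openin_weak_integral[OF assms]]
    by (simp add: vimage_def Int_def conj_commute)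
qed

lemma finite_measures_integrable:
  fixes f :: "'a::euclidean_space \<Rightarrow> real"
  assumes "\<mu> \<in> finite_measures" "f \<in> borel_measurable borel" "\<And>x. \<bar>f x\<bar> \<le> B"
  shows "integrable \<mu> f"
proof -
  interpret finite_measure \<mu> using assms(1) by (simp add: finite_measures_def)
  have "sets \<mu> = sets borel" using assms(1) by (simp add: finite_measures_def)
  then have "f \<in> borel_measurable \<mu>" using assms(2) by (simp cong: measurable_cong_sets)
  then show ?thesis by (rule integrable_const_bound[rotated, where B = B]) (use assms(3) in auto)
qed

lemma space_skorokhod [simp]: "space skorokhod_space = cadlag_paths"
  by (auto simp: skorokhod_space_def space_restrict_space space_PiM cadlag_paths_def)

lemma cadlag_pathD: "\<omega> \<in> cadlag_paths \<Longrightarrow> 0 \<le> t \<Longrightarrow> \<omega> t \<in> finite_measures"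
  by (auto simp: cadlag_paths_def)

lemma coordinate_measurable:
  assumes "0 \<le> t" shows "(\<lambda>\<omega>. \<omega> t) \<in> measurable skorokhod_space finite_measure_borel"
  unfolding skorokhod_space_def using assms
  by (intro measurable_restrict_space1 measurable_component_singleton) simp

lemma canonical_filtration_sets:
  "sets (canonical_filtration s) = sigma_sets cadlag_paths
     {{\<omega> \<in> cadlag_paths. \<omega> r \<in> B} | r B. 0 \<le> r \<and> r \<le> s \<and> B \<in> sets finite_measure_borel}"
  and canonical_filtration_space [simp]: "space (canonical_filtration s) = cadlag_paths"
  unfolding canonical_filtration_def by (subst sets_measure_of space_measure_of; auto)+

lemma coordinate_adapted:
  assumes "0 \<le> r" "r \<le> s"
  shows "(\<lambda>\<omega>. \<omega> r) \<in> measurable (canonical_filtration s) finite_measure_borel"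
proof (rule measurableI)
  fix B :: "'a measure set" assume "B \<in> sets finite_measure_borel"
  then have "{\<omega> \<in> cadlag_paths. \<omega> r \<in> B} \<in> sets (canonical_filtration s)"
    unfolding canonical_filtration_sets using assms by (intro sigma_sets.Basic) blast
  then show "(\<lambda>\<omega>. \<omega> r) -` B \<inter> space (canonical_filtration s) \<in> sets (canonical_filtration s)"
    by (simp add: vimage_def Int_def conj_commute)
qed (use assms in \<open>auto intro: cadlag_pathD\<close>)

lemma canonical_filtration_subset: "sets (canonical_filtration s) \<subseteq> sets skorokhod_space"
proof -
  have "{\<omega> \<in> cadlag_paths. \<omega> r \<in> B} \<in> sets skorokhod_space"
    if "0 \<le> r" "B \<in> sets finite_measure_borel" for r and B :: "'a measure set"
    using measurable_sets[OF coordinate_measurable[OF that(1)] that(2)]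
    by (simp add: vimage_def Int_def conj_commute)
  then show ?thesis
    unfolding canonical_filtration_sets
    by (intro order_trans[OF sets.sigma_sets_subset[of _ skorokhod_space, unfolded space_skorokhod]]) auto
qed

section \<open>The Markov property for integrals of functions\<close>

locale cadlag_markov =
  fixes \<P> :: "'a::euclidean_space measure \<Rightarrow> (real \<Rightarrow> 'a measure) measure"
  assumes family: "cadlag_markov_family \<P>"
begin

lemma prob_space_law: "\<mu> \<in> finite_measures \<Longrightarrow> prob_space (\<P> \<mu>)"
  and sets_law [simp]: "\<mu> \<in> finite_measures \<Longrightarrow> sets (\<P> \<mu>) = sets skorokhod_space"
  and start_law: "\<mu> \<in> finite_measures \<Longrightarrow> AE \<omega> in \<P> \<mu>. \<omega> 0 = \<mu>"
  using family by (auto simp: cadlag_markov_family_def)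

lemma space_law [simp]: "\<mu> \<in> finite_measures \<Longrightarrow> space (\<P> \<mu>) = cadlag_paths"
  using sets_eq_imp_space_eq[OF sets_law] by simp

lemma coordinate [measurable]:
  "\<mu> \<in> finite_measures \<Longrightarrow> 0 \<le> t \<Longrightarrow> (\<lambda>\<omega>. \<omega> t) \<in> measurable (\<P> \<mu>) finite_measure_borel"
  using coordinate_measurable[of t] by (simp cong: measurable_cong_sets)

text \<open>Viewing the time-\<open>t\<close> marginals as a kernel on
  \<open>finite_measures\<close> makes the monadic \<open>bind\<close> available, which carries the
  Markov property from sets to functions.\<close>

lemma transition_kernel:
  assumes t: "0 \<le> t"
  shows "(\<lambda>\<nu>. distr (\<P> \<nu>) finite_measure_borel (\<lambda>\<eta>. \<eta> t)) \<in>
    measurable finite_measure_borel (subprob_algebra finite_measure_borel)"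
proof (rule measurable_subprob_algebra)
  fix \<nu> :: "'a measure" assume \<nu>: "\<nu> \<in> space finite_measure_borel"
  then interpret prob_space "\<P> \<nu>" by (simp add: prob_space_law)
  show "subprob_space (distr (\<P> \<nu>) finite_measure_borel (\<lambda>\<eta>. \<eta> t))"
    using \<nu> t by (intro prob_space_imp_subprob_space prob_space_distr coordinate) auto
next
  fix B :: "'a measure set" assume B: "B \<in> sets finite_measure_borel"
  then have "{\<eta> \<in> cadlag_paths. \<eta> t \<in> B} \<in> sets skorokhod_space"
    using measurable_sets[OF coordinate_measurable[OF t] B] by (simp add: vimage_def Int_def conj_commute)
  then have "(\<lambda>\<nu>. ennreal (measure (\<P> \<nu>) {\<eta> \<in> cadlag_paths. \<eta> t \<in> B})) \<in> borel_measurable finite_measure_borel"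
    using family by (simp add: cadlag_markov_family_def)
  moreover have "emeasure (distr (\<P> \<nu>) finite_measure_borel (\<lambda>\<eta>. \<eta> t)) B
      = ennreal (measure (\<P> \<nu>) {\<eta> \<in> cadlag_paths. \<eta> t \<in> B})" if \<nu>: "\<nu> \<in> finite_measures" for \<nu>
  proof -
    interpret prob_space "\<P> \<nu>" by (rule prob_space_law[OF \<nu>])
    show ?thesis
      using \<nu> t B by (subst emeasure_distr) 
        (auto simp: emeasure_eq_measure coordinate intro!: arg_cong[where f = "measure (\<P> \<nu>)"])
  qed
  ultimately show "(\<lambda>\<nu>. emeasure (distr (\<P> \<nu>) finite_measure_borel (\<lambda>\<eta>. \<eta> t)) B) \<in> borel_measurable finite_measure_borel"
    by (subst measurable_cong) auto
qed simp

text \<open>The Markov property is given only for indicators of events at one later time. The weight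
  \<open>Y\<close> is absorbed into the measure \<open>D\<close>, and the law of the later state
  under \<open>D\<close> is identified as \<open>D\<close> followed by the transition kernel.
  Equality of measures then extends from sets to integrands \<open>F\<close>.\<close>

lemma markov_nn_integral:
  assumes \<mu>: "\<mu> \<in> finite_measures" and s: "0 \<le> s" and t: "0 \<le> t"
    and Y: "Y \<in> borel_measurable (canonical_filtration s)" "\<And>\<omega>. 0 \<le> Y \<omega>" "\<And>\<omega>. Y \<omega> \<le> (1 :: real)"
    and F: "F \<in> borel_measurable finite_measure_borel"
  shows "(\<integral>\<^sup>+\<omega>. ennreal (Y \<omega>) * F (\<omega> (s + t)) \<partial>\<P> \<mu>) =
    (\<integral>\<^sup>+\<omega>. ennreal (Y \<omega>) * (\<integral>\<^sup>+\<eta>. F (\<eta> t) \<partial>\<P> (\<omega> s)) \<partial>\<P> \<mu>)"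
proof -
  interpret prob_space "\<P> \<mu>" by (rule prob_space_law[OF \<mu>])
  let ?F = "canonical_filtration s" and ?N = "finite_measure_borel :: 'a measure measure"
  have sub: "subalgebra (\<P> \<mu>) ?F"
    using canonical_filtration_subset \<mu> by (auto simp: subalgebra_def)
  interpret finite_measure_subalgebra "\<P> \<mu>" ?F by unfold_locales (rule sub)
  have YM [measurable]: "Y \<in> borel_measurable (\<P> \<mu>)" by (rule measurable_from_subalg[OF sub Y(1)])
  note coord = coordinate[OF \<mu>]
  have coord_st [measurable]: "(\<lambda>\<omega>. \<omega> (s + t)) \<in> measurable (\<P> \<mu>) ?N" using s t by (intro coord) simp
  define k where "k \<nu> = distr (\<P> \<nu>) ?N (\<lambda>\<eta>. \<eta> t)" for \<nu>
  have k: "k \<in> measurable ?N (subprob_algebra ?N)" unfolding k_def by (rule transition_kernel[OF t])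
  have ks: "(\<lambda>\<omega>. k (\<omega> s)) \<in> measurable (\<P> \<mu>) (subprob_algebra ?N)"
    by (rule measurable_compose[OF coord[OF s] k])
  define D where "D = density (\<P> \<mu>) (\<lambda>\<omega>. ennreal (Y \<omega>))"
  have ksD: "(\<lambda>\<omega>. k (\<omega> s)) \<in> measurable D (subprob_algebra ?N)"
    using ks by (simp add: D_def)
  have spaceD: "space D = cadlag_paths" using \<mu> by (simp add: D_def)
  have ne: "space D \<noteq> {}" using not_empty \<mu> spaceD by simp
  \<comment> \<open>On a fixed set \<open>B\<close> this is the characterization of the conditional
    expectation, tested against the adapted weight \<open>Y\<close>.\<close>
  have eq: "distr D ?N (\<lambda>\<omega>. \<omega> (s + t)) = D \<bind> (\<lambda>\<omega>. k (\<omega> s))"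
  proof (rule measure_eqI)
    show "sets (distr D ?N (\<lambda>\<omega>. \<omega> (s + t))) = sets (D \<bind> (\<lambda>\<omega>. k (\<omega> s)))"
      using sets_bind[of D "\<lambda>\<omega>. k (\<omega> s)" ?N] ne by (simp add: k_def)
    fix B assume "B \<in> sets (distr D ?N (\<lambda>\<omega>. \<omega> (s + t)))"
    then have B [measurable]: "B \<in> sets ?N" by simp
    have kval: "emeasure (k (\<omega> s)) B = ennreal (measure (\<P> (\<omega> s)) {\<eta> \<in> space (\<P> (\<omega> s)). \<eta> t \<in> B})"
      if \<omega>: "\<omega> \<in> cadlag_paths" for \<omega>
    proof -
      have \<nu>: "\<omega> s \<in> finite_measures" using cadlag_pathD[OF \<omega> s] .
      interpret Q: prob_space "\<P> (\<omega> s)" by (rule prob_space_law[OF \<nu>])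
      show ?thesis unfolding k_def
        using \<nu> t B by (subst emeasure_distr)
          (auto simp: Q.emeasure_eq_measure coordinate intro!: arg_cong[where f = "measure (\<P> (\<omega> s))"])
    qed
    define g where "g \<omega> = (indicator B (\<omega> (s + t)) :: real)" for \<omega> :: "real \<Rightarrow> 'a measure"
    have gm [measurable]: "g \<in> borel_measurable (\<P> \<mu>)" unfolding g_def by measurable
    have Yg: "integrable (\<P> \<mu>) (\<lambda>\<omega>. Y \<omega> * g \<omega>)"
      by (rule integrable_const_bound[where B = 1]) (auto simp: g_def indicator_def abs_le_iff Y(2,3) intro: order_trans[OF _ Y(2)])
    have ce: "AE \<omega> in \<P> \<mu>. real_cond_exp (\<P> \<mu>) ?F g \<omega> = measure (\<P> (\<omega> s)) {\<eta> \<in> space (\<P> (\<omega> s)). \<eta> t \<in> B}"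
      using family \<mu> s t B unfolding cadlag_markov_family_def g_def by blast
    have ce_nonneg: "AE \<omega> in \<P> \<mu>. 0 \<le> Y \<omega> * real_cond_exp (\<P> \<mu>) ?F g \<omega>"
      using ce by eventually_elim (simp add: Y(2))
    have "emeasure (distr D ?N (\<lambda>\<omega>. \<omega> (s + t))) B = emeasure D ((\<lambda>\<omega>. \<omega> (s + t)) -` B \<inter> space D)"
      by (rule emeasure_distr) (auto simp: D_def)
    also have "\<dots> = (\<integral>\<^sup>+\<omega>. ennreal (Y \<omega>) * indicator ((\<lambda>\<omega>. \<omega> (s + t)) -` B \<inter> space D) \<omega> \<partial>\<P> \<mu>)"
    proof -
      have "(\<lambda>\<omega>. \<omega> (s + t)) -` B \<inter> space D \<in> sets (\<P> \<mu>)"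
        using measurable_sets[OF coord_st B] by (simp add: D_def)
      then show ?thesis unfolding D_def by (intro emeasure_density) auto
    qed
    also have "\<dots> = (\<integral>\<^sup>+\<omega>. ennreal (Y \<omega> * g \<omega>) \<partial>\<P> \<mu>)"
      by (rule nn_integral_cong) (use \<mu> in \<open>auto simp: g_def indicator_def spaceD\<close>)
    also have "\<dots> = ennreal (\<integral>\<omega>. Y \<omega> * g \<omega> \<partial>\<P> \<mu>)"
      by (rule nn_integral_eq_integral[OF Yg]) (auto simp: Y(2) g_def)
    also have "(\<integral>\<omega>. Y \<omega> * g \<omega> \<partial>\<P> \<mu>) = (\<integral>\<omega>. Y \<omega> * real_cond_exp (\<P> \<mu>) ?F g \<omega> \<partial>\<P> \<mu>)"
      by (rule real_cond_exp_intg(2)[OF Yg Y(1) gm, symmetric])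
    also have "ennreal \<dots> = (\<integral>\<^sup>+\<omega>. ennreal (Y \<omega> * real_cond_exp (\<P> \<mu>) ?F g \<omega>) \<partial>\<P> \<mu>)"
      by (rule nn_integral_eq_integral[OF real_cond_exp_intg(1)[OF Yg Y(1) gm] ce_nonneg, symmetric])
    also have "\<dots> = (\<integral>\<^sup>+\<omega>. ennreal (Y \<omega>) * emeasure (k (\<omega> s)) B \<partial>\<P> \<mu>)"
    proof (rule nn_integral_cong_AE)
      show "AE \<omega> in \<P> \<mu>. ennreal (Y \<omega> * real_cond_exp (\<P> \<mu>) ?F g \<omega>) = ennreal (Y \<omega>) * emeasure (k (\<omega> s)) B"
        using ce AE_space by eventually_elim (use \<mu> Y(2) in \<open>auto simp: kval ennreal_mult\<close>)
    qed
    also have "\<dots> = (\<integral>\<^sup>+\<omega>. emeasure (k (\<omega> s)) B \<partial>D)"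
      unfolding D_def using measurable_emeasure_kernel[OF ks B] by (intro nn_integral_density[symmetric]) auto
    also have "\<dots> = emeasure (D \<bind> (\<lambda>\<omega>. k (\<omega> s))) B"
      by (rule emeasure_bind[OF ne ksD B, symmetric])
    finally show "emeasure (distr D ?N (\<lambda>\<omega>. \<omega> (s + t))) B = emeasure (D \<bind> (\<lambda>\<omega>. k (\<omega> s))) B" .
  qed
  have kF: "(\<lambda>\<omega>. \<integral>\<^sup>+\<nu>. F \<nu> \<partial>k (\<omega> s)) \<in> borel_measurable (\<P> \<mu>)"
    by (rule measurable_compose[OF ks nn_integral_measurable_subprob_algebra[OF F]])
  have "(\<integral>\<^sup>+\<omega>. ennreal (Y \<omega>) * F (\<omega> (s + t)) \<partial>\<P> \<mu>) = (\<integral>\<^sup>+\<omega>. F (\<omega> (s + t)) \<partial>D)"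
    unfolding D_def using F by (intro nn_integral_density[symmetric]) auto
  also have "\<dots> = (\<integral>\<^sup>+\<nu>. F \<nu> \<partial>distr D ?N (\<lambda>\<omega>. \<omega> (s + t)))"
    using F by (intro nn_integral_distr[symmetric]) (auto simp: D_def)
  also have "\<dots> = (\<integral>\<^sup>+\<omega>. (\<integral>\<^sup>+\<nu>. F \<nu> \<partial>k (\<omega> s)) \<partial>D)"
    unfolding eq by (rule nn_integral_bind[OF F ksD])
  also have "\<dots> = (\<integral>\<^sup>+\<omega>. ennreal (Y \<omega>) * (\<integral>\<^sup>+\<nu>. F \<nu> \<partial>k (\<omega> s)) \<partial>\<P> \<mu>)"
    unfolding D_def using kF by (intro nn_integral_density) auto
  also have "\<dots> = (\<integral>\<^sup>+\<omega>. ennreal (Y \<omega>) * (\<integral>\<^sup>+\<eta>. F (\<eta> t) \<partial>\<P> (\<omega> s)) \<partial>\<P> \<mu>)"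
  proof (rule nn_integral_cong)
    fix \<omega> assume "\<omega> \<in> space (\<P> \<mu>)"
    then have "\<omega> s \<in> finite_measures" using \<mu> s by (auto intro: cadlag_pathD)
    then show "ennreal (Y \<omega>) * (\<integral>\<^sup>+\<nu>. F \<nu> \<partial>k (\<omega> s)) = ennreal (Y \<omega>) * (\<integral>\<^sup>+\<eta>. F (\<eta> t) \<partial>\<P> (\<omega> s))"
      unfolding k_def using F t by (subst nn_integral_distr) auto
  qed
  finally show ?thesis .
qed

lemma markov_step:
  assumes \<mu>: "\<mu> \<in> finite_measures" and s: "0 \<le> s" and t: "0 \<le> t"
    and Y: "Y \<in> borel_measurable (canonical_filtration s)" "\<And>\<omega>. 0 \<le> Y \<omega>" "\<And>\<omega>. Y \<omega> \<le> (1 :: real)"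
    and F: "F \<in> borel_measurable finite_measure_borel" "\<And>\<nu>. 0 \<le> F \<nu>" "\<And>\<nu>. F \<nu> \<le> (1 :: real)"
    and G: "G \<in> borel_measurable finite_measure_borel" "\<And>\<nu>. 0 \<le> G \<nu>"
    and step: "\<And>\<nu>. \<nu> \<in> finite_measures \<Longrightarrow> G \<nu> \<le> (\<integral>\<eta>. F (\<eta> t) \<partial>\<P> \<nu>)"
  shows "(\<integral>\<omega>. Y \<omega> * G (\<omega> s) \<partial>\<P> \<mu>) \<le> (\<integral>\<omega>. Y \<omega> * F (\<omega> (s + t)) \<partial>\<P> \<mu>)"
proof -
  interpret prob_space "\<P> \<mu>" by (rule prob_space_law[OF \<mu>])
  have sub: "subalgebra (\<P> \<mu>) (canonical_filtration s)"
    using canonical_filtration_subset \<mu> by (auto simp: subalgebra_def)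
  have YM [measurable]: "Y \<in> borel_measurable (\<P> \<mu>)" by (rule measurable_from_subalg[OF sub Y(1)])
  note [measurable] = measurable_compose[OF coordinate[OF \<mu>] F(1), of "s + t"]
  have YF: "integrable (\<P> \<mu>) (\<lambda>\<omega>. Y \<omega> * F (\<omega> (s + t)))"
    using s t by (intro integrable_const_bound[where B = 1])
      (auto simp: abs_mult Y F intro!: mult_le_one)
  \<comment> \<open>If the integrand is not integrable, its Bochner integral is 0 and the inequality
    is trivial.\<close>
  have "ennreal (\<integral>\<omega>. Y \<omega> * G (\<omega> s) \<partial>\<P> \<mu>) \<le> (\<integral>\<^sup>+\<omega>. ennreal (Y \<omega> * G (\<omega> s)) \<partial>\<P> \<mu>)"
    by (cases "integrable (\<P> \<mu>) (\<lambda>\<omega>. Y \<omega> * G (\<omega> s))")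
      (auto simp: nn_integral_eq_integral Y G not_integrable_integral_eq)
  also have "\<dots> \<le> (\<integral>\<^sup>+\<omega>. ennreal (Y \<omega>) * (\<integral>\<^sup>+\<eta>. ennreal (F (\<eta> t)) \<partial>\<P> (\<omega> s)) \<partial>\<P> \<mu>)"
  proof (rule nn_integral_mono)
    fix \<omega> assume "\<omega> \<in> space (\<P> \<mu>)"
    then have \<nu>: "\<omega> s \<in> finite_measures" using \<mu> s by (auto intro: cadlag_pathD)
    interpret Q: prob_space "\<P> (\<omega> s)" by (rule prob_space_law[OF \<nu>])
    have "integrable (\<P> (\<omega> s)) (\<lambda>\<eta>. F (\<eta> t))"
      using measurable_compose[OF coordinate[OF \<nu> t] F(1)]
      by (intro Q.integrable_const_bound[where B = 1]) (auto simp: F)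
    then have "ennreal (G (\<omega> s)) \<le> (\<integral>\<^sup>+\<eta>. ennreal (F (\<eta> t)) \<partial>\<P> (\<omega> s))"
      using step[OF \<nu>] by (subst nn_integral_eq_integral) (auto simp: F ennreal_leI)
    then show "ennreal (Y \<omega> * G (\<omega> s)) \<le> ennreal (Y \<omega>) * (\<integral>\<^sup>+\<eta>. ennreal (F (\<eta> t)) \<partial>\<P> (\<omega> s))"
      by (simp add: ennreal_mult Y G mult_left_mono)
  qed
  also have "\<dots> = (\<integral>\<^sup>+\<omega>. ennreal (Y \<omega>) * ennreal (F (\<omega> (s + t))) \<partial>\<P> \<mu>)"
    using F(1) by (intro markov_nn_integral[OF \<mu> s t Y, symmetric]) auto
  also have "\<dots> = ennreal (\<integral>\<omega>. Y \<omega> * F (\<omega> (s + t)) \<partial>\<P> \<mu>)"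
    using YF by (subst nn_integral_eq_integral[symmetric]) (auto simp: Y F ennreal_mult)
  finally show ?thesis
    by (subst (asm) ennreal_le_iff) (auto intro!: integral_nonneg_AE simp: Y F)
qed

end

section \<open>Supports, right-continuity and compactness of the range\<close>

lemma cadlag_integral_right_continuous:
  fixes f :: "'a::euclidean_space \<Rightarrow> real"
  assumes \<omega>: "\<omega> \<in> cadlag_paths" and t: "0 \<le> t" and f: "continuous_on UNIV f" "bounded (range f)"
  shows "((\<lambda>s. \<integral>x. f x \<partial>\<omega> s) \<longlongrightarrow> (\<integral>x. f x \<partial>\<omega> t)) (at_right t)"
proof (rule topological_tendstoI)
  fix U :: "real set" assume U: "open U" "(\<integral>x. f x \<partial>\<omega> t) \<in> U"
  have "limitin weak_topology \<omega> (\<omega> t) (at_right t)" using \<omega> t by (simp add: cadlag_paths_def)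
  moreover have "\<omega> t \<in> finite_measures" using \<omega> t by (rule cadlag_pathD)
  ultimately have "\<forall>\<^sub>F s in at_right t. \<omega> s \<in> {\<mu> \<in> finite_measures. (\<integral>x. f x \<partial>\<mu>) \<in> U}"
    using openin_weak_integral[OF f U(1)] U(2) unfolding limitin_def by blast
  then show "\<forall>\<^sub>F s in at_right t. (\<integral>x. f x \<partial>\<omega> s) \<in> U"
    by eventually_elim simp
qed

text \<open>This turns containment of a support into the vanishing of an integral, which is
  measurable and right-continuous along paths. One direction rests on Lindelof: outside the support
  every point has an open null neighbourhood, and countably many of these suffice.\<close>

lemma measure_support_subset_zeros_iff:
  fixes f :: "'a::euclidean_space \<Rightarrow> real"
  assumes \<nu>: "\<nu> \<in> finite_measures" and f: "continuous_on UNIV f" "bounded (range f)" "\<And>x. 0 \<le> f x"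
  shows "measure_support \<nu> \<subseteq> {x. f x = 0} \<longleftrightarrow> (\<integral>x. f x \<partial>\<nu>) = 0"
proof -
  define U where "U = {x. 0 < f x}"
  have nz: "f x \<noteq> 0 \<longleftrightarrow> 0 < f x" for x using f(3)[of x] by linarith
  have U: "open U"
    unfolding U_def by (intro open_Collect_less f continuous_intros)
  have sets: "sets \<nu> = sets borel" using \<nu> by (simp add: finite_measures_def)
  have space: "space \<nu> = UNIV" using sets_eq_imp_space_eq[OF sets] by simp
  obtain B where "\<And>x. \<bar>f x\<bar> \<le> B" using f(2) by (auto simp: bounded_iff)
  then have int: "integrable \<nu> f"
    using \<nu> f(1) by (intro finite_measures_integrable) (auto intro: borel_measurable_continuous_onI)
  have Us: "U \<in> sets \<nu>" using U sets by simp
  have "(\<integral>x. f x \<partial>\<nu>) = 0 \<longleftrightarrow> (AE x in \<nu>. f x = 0)"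
    using integral_nonneg_eq_0_iff_AE[OF int] f(3) by simp
  also have "\<dots> \<longleftrightarrow> emeasure \<nu> {x \<in> space \<nu>. \<not> f x = 0} = 0"
    using Us by (subst AE_iff_measurable[OF _ refl]) (auto simp: U_def space nz)
  also have "{x \<in> space \<nu>. \<not> f x = 0} = U" by (auto simp: U_def space nz)
  finally have null: "(\<integral>x. f x \<partial>\<nu>) = 0 \<longleftrightarrow> emeasure \<nu> U = 0" .
  show ?thesis
  proof
    assume "(\<integral>x. f x \<partial>\<nu>) = 0"
    then have "emeasure \<nu> U = 0" using null by simp
    then show "measure_support \<nu> \<subseteq> {x. f x = 0}"
      using U nz by (fastforce simp: measure_support_def U_def)
  next
    assume sub: "measure_support \<nu> \<subseteq> {x. f x = 0}"
    define \<U> where "\<U> = {V. open V \<and> emeasure \<nu> V = 0}"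
    have "U \<subseteq> \<Union>\<U>"
    proof
      fix x assume "x \<in> U"
      then have "x \<notin> measure_support \<nu>" using sub nz[of x] by (auto simp: U_def)
      then obtain V where "open V" "x \<in> V" "emeasure \<nu> V = 0"
        by (auto simp: measure_support_def not_gr_zero)
      then show "x \<in> \<Union>\<U>" by (auto simp: \<U>_def)
    qed
    obtain \<V> where \<V>: "\<V> \<subseteq> \<U>" "countable \<V>" "\<Union>\<V> = \<Union>\<U>"
      using Lindelof[of \<U>] by (auto simp: \<U>_def)
    have "(\<Union>V\<in>\<V>. V) \<in> null_sets \<nu>"
      using \<V>(1,2) sets by (intro null_sets_UN') (auto simp: \<U>_def null_sets_def)
    then have "emeasure \<nu> U = 0"
      using \<open>U \<subseteq> \<Union>\<U>\<close> \<V>(3) Us by (metis image_ident null_setsD1 null_sets_subset)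
    then show "(\<integral>x. f x \<partial>\<nu>) = 0" using null by simp
  qed
qed

text \<open>With mesh \<open>1 / 2 ^ k\<close> and \<open>4 ^ k\<close> points the grid reaches time
  \<open>2 ^ k\<close>, so refining it also extends it and any fixed interval is eventually covered.
  About \<open>d * 2 ^ k\<close> grid points fall into the interval; the factor 1/2 absorbs the
  rounding.\<close>

lemma dyadic_riemann_sum_lower_bound:
  fixes \<phi> :: "real \<Rightarrow> real"
  assumes nonneg: "\<And>r. 0 \<le> \<phi> r" and s: "0 < s" and d: "0 < d" and a: "0 \<le> a"
    and lower: "\<And>r. s \<le> r \<Longrightarrow> r < s + d \<Longrightarrow> a \<le> \<phi> r"
  obtains k0 where "\<And>k. k0 \<le> k \<Longrightarrow> a * d / 2 \<le> (\<Sum>i<4 ^ k. \<phi> (real (Suc i) / 2 ^ k)) / 2 ^ k"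
proof -
  obtain k0 where k0: "max (2 / d) (s + d) < 2 ^ k0" using real_arch_pow[of 2 "max (2 / d) (s + d)"] by auto
  show ?thesis
  proof (rule that[of k0])
    fix k assume k: "k0 \<le> k"
    define T :: real where "T = 2 ^ k"
    have "2 ^ k0 \<le> T" using k by (simp add: T_def)
    then have "max (2 / d) (s + d) < T" using k0 by linarith
    then have T: "2 / d < T" "s + d < T" "0 < T" using s d by auto
    have Td: "2 < T * d" using T(1) d by (simp add: field_simps)
    \<comment> \<open>\<open>m\<close> is the first grid index not before \<open>s\<close>, and
      \<open>n\<close> counts the whole mesh steps in \<open>d\<close>. Since \<open>s > 0\<close>
      gives \<open>1 \<le> m\<close>, the summation index \<open>m + j - 1\<close> below is free of
      truncation.\<close>
    define m where "m = nat \<lceil>s * T\<rceil>"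
    define n where "n = nat \<lfloor>d * T\<rfloor>"
    have "0 < s * T" "0 < d * T" using s d T(3) by auto
    then have m: "s * T \<le> real m" "real m < s * T + 1" "1 \<le> m"
      unfolding m_def by linarith+
    have n: "real n \<le> d * T" "d * T - 1 < real n"
      using \<open>0 < d * T\<close> unfolding n_def by linarith+
    have mem: "s \<le> real (m + j) / T" "real (m + j) / T < s + d" if "j < n" for j
    proof -
      have "real (Suc j) \<le> real n" using that by simp
      then have "real (m + j) < (s + d) * T" using m n by (simp add: algebra_simps)
      then show "real (m + j) / T < s + d" using T(3) by (simp add: pos_divide_less_eq)
      have "s * T \<le> real (m + j)" using m by simp
      then show "s \<le> real (m + j) / T" using T(3) by (simp add: pos_le_divide_eq)
    qed
    have range: "m + j - 1 < 4 ^ k" if "j < n" for j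
    proof -
      have "real (m + j) < (s + d) * T" using mem(2)[OF that] T(3) by (simp add: pos_divide_less_eq)
      also have "\<dots> \<le> T * T" using T by (intro mult_right_mono) auto
      also have "\<dots> = real (4 ^ k)" by (simp add: T_def flip: power_mult_distrib)
      finally have "m + j < 4 ^ k" by (simp only: of_nat_less_iff)
      then show ?thesis by simp
    qed
    have "a * d / 2 * T \<le> a * (d * T - 1)"
      using a Td mult_left_mono[of "T * d / 2" "d * T - 1" a] by (simp add: mult_ac)
    also have "\<dots> \<le> a * real n" using a n by (intro mult_left_mono) auto
    also have "\<dots> = (\<Sum>j<n. a)" by simp
    also have "\<dots> \<le> (\<Sum>j<n. \<phi> (real (m + j) / T))"
      by (intro sum_mono lower mem) auto
    also have "\<dots> = (\<Sum>i\<in>(\<lambda>j. m + j - 1) ` {..<n}. \<phi> (real (Suc i) / T))"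
      using m(3) by (subst sum.reindex) (auto simp: inj_on_def intro!: sum.cong)
    also have "\<dots> \<le> (\<Sum>i<4 ^ k. \<phi> (real (Suc i) / T))"
      using range nonneg by (intro sum_mono2) auto
    finally have "a * d / 2 * T \<le> (\<Sum>i<4 ^ k. \<phi> (real (Suc i) / T))" .
    then show "a * d / 2 \<le> (\<Sum>i<4 ^ k. \<phi> (real (Suc i) / 2 ^ k)) / 2 ^ k"
      using T(3) by (simp add: T_def pos_le_divide_eq)
  qed
qed

text \<open>Compactness means containment in some ball of integer radius, and the cutoff functions
  vanish exactly on these balls. A non-zero integral at time \<open>s\<close> persists on an
  interval to the right of \<open>s\<close>, so a countable \<open>D\<close> that is dense from the
  right detects it.\<close>

lemma compact_range_iff:
  fixes \<omega> :: "real \<Rightarrow> 'a::euclidean_space measure"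
  assumes \<omega>: "\<omega> \<in> cadlag_paths" and I: "D \<subseteq> I" "I \<subseteq> {0..}"
    and dense: "\<And>s \<epsilon>. s \<in> I \<Longrightarrow> 0 < \<epsilon> \<Longrightarrow> \<exists>q\<in>D. s \<le> q \<and> q < s + \<epsilon>"
  shows "compact (closure (\<Union>s\<in>I. measure_support (\<omega> s))) \<longleftrightarrow>
    (\<exists>N::nat. \<forall>q\<in>D. (\<integral>x. min 1 (max 0 (norm x - real N)) \<partial>\<omega> q) = 0)"
proof -
  define F :: "nat \<Rightarrow> 'a \<Rightarrow> real" where "F N x = min 1 (max 0 (norm x - real N))" for N x
  have F: "continuous_on UNIV (F N)" "bounded (range (F N))" "\<And>x. 0 \<le> F N x" for N
    unfolding F_def by (auto intro!: continuous_intros boundedI[where B = 1])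
  have zero: "{x. F N x = 0} = cball 0 (real N)" for N
    by (auto simp: F_def min_def max_def split: if_splits)
  have fin: "\<omega> s \<in> finite_measures" if "s \<in> I" for s using \<omega> that I by (auto intro: cadlag_pathD)
  have "compact (closure (\<Union>s\<in>I. measure_support (\<omega> s))) \<longleftrightarrow> bounded (\<Union>s\<in>I. measure_support (\<omega> s))"
    by (metis bounded_closure bounded_subset closure_subset compact_eq_bounded_closed closed_closure)
  also have "\<dots> \<longleftrightarrow> (\<exists>N::nat. (\<Union>s\<in>I. measure_support (\<omega> s)) \<subseteq> cball 0 (real N))"
  proof
    assume "bounded (\<Union>s\<in>I. measure_support (\<omega> s))"
    then obtain b where "(\<Union>s\<in>I. measure_support (\<omega> s)) \<subseteq> cball 0 b"
      unfolding bounded_iff subset_eq mem_cball_0 by blast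
    moreover obtain N where "b \<le> real N" using real_arch_simple by blast
    ultimately show "\<exists>N::nat. (\<Union>s\<in>I. measure_support (\<omega> s)) \<subseteq> cball 0 (real N)"
      using subset_cball[of b "real N" 0] by blast
  qed (use bounded_subset bounded_cball in blast)
  also have "\<dots> \<longleftrightarrow> (\<exists>N. \<forall>s\<in>I. (\<integral>x. F N x \<partial>\<omega> s) = 0)"
    unfolding UN_subset_iff zero[symmetric]
    using measure_support_subset_zeros_iff[OF fin F] by simp
  also have "\<dots> \<longleftrightarrow> (\<exists>N. \<forall>q\<in>D. (\<integral>x. F N x \<partial>\<omega> q) = 0)"
  proof (intro ex_cong1 iffI ballI)
    fix N s assume D: "\<forall>q\<in>D. (\<integral>x. F N x \<partial>\<omega> q) = 0" and s: "s \<in> I"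
    show "(\<integral>x. F N x \<partial>\<omega> s) = 0"
    proof (rule ccontr)
      assume ne: "(\<integral>x. F N x \<partial>\<omega> s) \<noteq> 0"
      have "\<forall>\<^sub>F r in at_right s. (\<integral>x. F N x \<partial>\<omega> r) \<noteq> 0"
        using cadlag_integral_right_continuous[OF \<omega> _ F(1,2)] s I ne
        by (intro tendsto_imp_eventually_ne) auto
      then obtain b where b: "s < b" "\<And>r. s < r \<Longrightarrow> r < b \<Longrightarrow> (\<integral>x. F N x \<partial>\<omega> r) \<noteq> 0"
        unfolding eventually_at_right_field by blast
      obtain q where "q \<in> D" "s \<le> q" "q < s + (b - s)" using dense[OF s, of "b - s"] b(1) by auto
      then show False using D b(2)[of q] ne by (cases "s = q") auto
    qed
  qed (use I in auto)
  finally show ?thesis by (simp add: F_def)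
qed

section \<open>From one-step estimates to whole paths\<close>

context cadlag_markov
begin

lemma measurable_integral_coordinate:
  fixes f :: "'a \<Rightarrow> real"
  assumes "\<mu> \<in> finite_measures" "0 \<le> t" "continuous_on UNIV f" "bounded (range f)"
  shows "(\<lambda>\<omega>. \<integral>x. f x \<partial>\<omega> t) \<in> borel_measurable (\<P> \<mu>)"
  by (rule measurable_compose[OF coordinate[OF assms(1,2)] measurable_weak_integral[OF assms(3,4)]])

text \<open>On a set outside the sigma-algebra \<open>measure\<close> is 0, so an event of
  probability one has to be shown measurable.\<close>

lemma measurable_compact_range:
  assumes \<mu>: "\<mu> \<in> finite_measures" and D: "countable D" "D \<subseteq> I" "I \<subseteq> {0..}"
    and dense: "\<And>s \<epsilon>. s \<in> I \<Longrightarrow> 0 < \<epsilon> \<Longrightarrow> \<exists>q\<in>D. s \<le> q \<and> q < s + \<epsilon>"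
  shows "{\<omega> \<in> space (\<P> \<mu>). compact (closure (\<Union>s\<in>I. measure_support (\<omega> s)))} \<in> sets (\<P> \<mu>)"
proof -
  have meas: "(\<lambda>\<omega>. \<integral>x. min 1 (max 0 (norm x - real N)) \<partial>\<omega> q) \<in> borel_measurable (\<P> \<mu>)" if "q \<in> D" for N q
    using that D by (intro measurable_integral_coordinate[OF \<mu>]) (auto intro!: continuous_intros boundedI[where B = 1])
  have "{\<omega> \<in> space (\<P> \<mu>). \<exists>N::nat. \<forall>q\<in>D. (\<integral>x. min 1 (max 0 (norm x - real N)) \<partial>\<omega> q) = 0} \<in> sets (\<P> \<mu>)"
    using meas D(1) by (intro sets.sets_Collect_countable_Ex sets.sets_Collect_countable_Ball borel_measurable_eq) auto
  moreover have "{\<omega> \<in> space (\<P> \<mu>). compact (closure (\<Union>s\<in>I. measure_support (\<omega> s)))} =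
    {\<omega> \<in> space (\<P> \<mu>). \<exists>N::nat. \<forall>q\<in>D. (\<integral>x. min 1 (max 0 (norm x - real N)) \<partial>\<omega> q) = 0}"
    using \<mu> compact_range_iff[OF _ D(2,3) dense] by auto
  ultimately show ?thesis by simp
qed

text \<open>The induction shows that \<open>exp (- \<Sum>\<^sub>i\<^sub>\<le>\<^sub>n \<langle>f, X\<^sub>i\<^sub>h\<rangle> - \<langle>u, X\<^sub>n\<^sub>h\<rangle>)\<close> has non-decreasing expectation in \<open>n\<close>.\<close>

lemma multi_step:
  fixes u f :: "'a \<Rightarrow> real"
  assumes \<mu>: "\<mu> \<in> finite_measures" and h: "0 \<le> h"
    and u: "continuous_on UNIV u" "bounded (range u)" "\<And>x. 0 \<le> u x"
    and f: "continuous_on UNIV f" "bounded (range f)" "\<And>x. 0 \<le> f x"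
    and step: "\<And>\<nu>. \<nu> \<in> finite_measures \<Longrightarrow>
      exp (- (\<integral>x. u x \<partial>\<nu>)) \<le> (\<integral>\<eta>. exp (- (\<integral>x. u x + f x \<partial>\<eta> h)) \<partial>\<P> \<nu>)"
  shows "exp (- (\<integral>x. u x \<partial>\<mu>)) \<le> (\<integral>\<omega>. exp (- (\<Sum>i<n. \<integral>x. f x \<partial>\<omega> (real (Suc i) * h))) \<partial>\<P> \<mu>)"
proof -
  interpret prob_space "\<P> \<mu>" by (rule prob_space_law[OF \<mu>])
  define Y where "Y n \<omega> = exp (- (\<Sum>i<n. \<integral>x. f x \<partial>\<omega> (real (Suc i) * h)))" for n and \<omega> :: "real \<Rightarrow> 'a measure"
  have u_nonneg: "0 \<le> (\<integral>x. u x \<partial>\<nu>)" and f_nonneg: "0 \<le> (\<integral>x. f x \<partial>\<nu>)"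
    and uf_nonneg: "0 \<le> (\<integral>x. u x + f x \<partial>\<nu>)" for \<nu>
    using u f by (auto intro!: integral_nonneg_AE)
  have uf: "continuous_on UNIV (\<lambda>x. u x + f x)" "bounded (range (\<lambda>x. u x + f x))"
    using u f by (auto intro!: continuous_intros bounded_plus_comp)
  have Y: "0 \<le> Y n \<omega>" "Y n \<omega> \<le> 1" for n \<omega>
    using f_nonneg by (auto simp: Y_def sum_nonneg)
  have Y_adapted: "Y n \<in> borel_measurable (canonical_filtration (real n * h))" for n
    unfolding Y_def
  proof (intro measurable_compose[OF _ borel_measurable_exp] borel_measurable_uminus borel_measurable_sum)
    fix i assume "i \<in> {..<n}"
    then show "(\<lambda>\<omega>. \<integral>x. f x \<partial>\<omega> (real (Suc i) * h)) \<in> borel_measurable (canonical_filtration (real n * h))"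
      using h by (intro measurable_compose[OF coordinate_adapted measurable_weak_integral] mult_right_mono f) auto
  qed
  have Y_meas: "Y n \<in> borel_measurable (\<P> \<mu>)" for n
    unfolding Y_def using h f
    by (intro measurable_compose[OF _ borel_measurable_exp] borel_measurable_uminus borel_measurable_sum measurable_integral_coordinate[OF \<mu>]) auto
  have Yu_int: "integrable (\<P> \<mu>) (\<lambda>\<omega>. Y n \<omega> * exp (- (\<integral>x. u x \<partial>\<omega> (real n * h))))" for n
  proof (rule integrable_const_bound[where B = 1])
    show "(\<lambda>\<omega>. Y n \<omega> * exp (- (\<integral>x. u x \<partial>\<omega> (real n * h)))) \<in> borel_measurable (\<P> \<mu>)"
      using h by (intro borel_measurable_times Y_meas measurable_compose[OF _ borel_measurable_exp] borel_measurable_uminus measurable_integral_coordinate[OF \<mu>] u) auto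
  qed (auto simp: abs_mult Y u_nonneg intro!: mult_le_one)
  have "exp (- (\<integral>x. u x \<partial>\<mu>)) \<le> (\<integral>\<omega>. Y n \<omega> * exp (- (\<integral>x. u x \<partial>\<omega> (real n * h))) \<partial>\<P> \<mu>)" for n
  proof (induction n)
    case 0
    have "(\<integral>\<omega>. exp (- (\<integral>x. u x \<partial>\<mu>)) \<partial>\<P> \<mu>) \<le> (\<integral>\<omega>. Y 0 \<omega> * exp (- (\<integral>x. u x \<partial>\<omega> (real 0 * h))) \<partial>\<P> \<mu>)"
    proof (rule integral_mono_AE)
      show "AE \<omega> in \<P> \<mu>. exp (- (\<integral>x. u x \<partial>\<mu>)) \<le> Y 0 \<omega> * exp (- (\<integral>x. u x \<partial>\<omega> (real 0 * h)))"
        using start_law[OF \<mu>] by eventually_elim (simp add: Y_def)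
    qed (use Yu_int[of 0] in simp_all)
    then show ?case by (simp add: prob_space)
  next
    case (Suc n)
    also have "(\<integral>\<omega>. Y n \<omega> * exp (- (\<integral>x. u x \<partial>\<omega> (real n * h))) \<partial>\<P> \<mu>)
        \<le> (\<integral>\<omega>. Y n \<omega> * exp (- (\<integral>x. u x + f x \<partial>\<omega> (real n * h + h))) \<partial>\<P> \<mu>)"
      using h by (intro markov_step[OF \<mu>, where F = "\<lambda>\<nu>. exp (- (\<integral>x. u x + f x \<partial>\<nu>))" and G = "\<lambda>\<nu>. exp (- (\<integral>x. u x \<partial>\<nu>))"]
        Y Y_adapted step measurable_compose[OF _ borel_measurable_exp] borel_measurable_uminus measurable_weak_integral u uf)
        (auto simp: uf_nonneg)
    \<comment> \<open>Additivity of the integral splits off the new \<open>f\<close>-term, which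
      joins the product \<open>Y\<close>.\<close>
    also have "\<dots> = (\<integral>\<omega>. Y (Suc n) \<omega> * exp (- (\<integral>x. u x \<partial>\<omega> (real (Suc n) * h))) \<partial>\<P> \<mu>)"
    proof (rule Bochner_Integration.integral_cong)
      fix \<omega> assume "\<omega> \<in> space (\<P> \<mu>)"
      then have \<nu>: "\<omega> (real n * h + h) \<in> finite_measures" using \<mu> h by (auto intro: cadlag_pathD)
      obtain B B' where "\<And>x. \<bar>u x\<bar> \<le> B" "\<And>x. \<bar>f x\<bar> \<le> B'"
        using u(2) f(2) by (auto simp: bounded_iff)
      then have "integrable (\<omega> (real n * h + h)) u" "integrable (\<omega> (real n * h + h)) f"
        using \<nu> u(1) f(1) by (auto intro!: finite_measures_integrable borel_measurable_continuous_onI)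
      moreover have "real (Suc n) * h = real n * h + h" by (simp add: algebra_simps)
      ultimately show "Y n \<omega> * exp (- (\<integral>x. u x + f x \<partial>\<omega> (real n * h + h))) = Y (Suc n) \<omega> * exp (- (\<integral>x. u x \<partial>\<omega> (real (Suc n) * h)))"
        by (simp add: Y_def del: of_nat_Suc flip: exp_add)
    qed simp
    finally show ?case .
  qed
  also have "(\<integral>\<omega>. Y n \<omega> * exp (- (\<integral>x. u x \<partial>\<omega> (real n * h))) \<partial>\<P> \<mu>) \<le> (\<integral>\<omega>. Y n \<omega> \<partial>\<P> \<mu>)"
  proof (rule integral_mono[OF Yu_int])
    show "integrable (\<P> \<mu>) (Y n)"
      by (rule integrable_const_bound[where B = 1]) (auto simp: Y Y_meas)
    show "Y n \<omega> * exp (- (\<integral>x. u x \<partial>\<omega> (real n * h))) \<le> Y n \<omega>" for \<omega>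
      using Y(1)[of n \<omega>] u_nonneg by (intro mult_left_le) auto
  qed
  finally show ?thesis by (simp add: Y_def)
qed

text \<open>On the event \<open>C n\<close>, where all late Riemann sums are at least
  \<open>1 / (n + 1)\<close>, the exponential is at most \<open>exp (- \<theta> / (n + 1))\<close>.
  As the lower bound \<open>e\<close> is the same for every \<open>\<theta>\<close>, letting
  \<open>\<theta>\<close> tend to infinity gives \<open>C n\<close> probability at most
  \<open>1 - e\<close>. The events increase, so their union obeys the same bound.\<close>

lemma never_charged:
  fixes f :: "'a \<Rightarrow> real"
  assumes \<mu>: "\<mu> \<in> finite_measures"
    and f: "continuous_on UNIV f" "bounded (range f)" "\<And>x. 0 \<le> f x"
    and lower: "\<And>\<theta>. 0 < \<theta> \<Longrightarrow> \<forall>\<^sub>F k in sequentially.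
      e \<le> (\<integral>\<omega>. exp (- \<theta> * ((\<Sum>i<4 ^ k. \<integral>x. f x \<partial>\<omega> (real (Suc i) / 2 ^ k)) / 2 ^ k)) \<partial>\<P> \<mu>)"
  obtains B where "B \<in> sets (\<P> \<mu>)" "measure (\<P> \<mu>) B \<le> 1 - e"
    "\<And>\<omega> t. \<omega> \<in> space (\<P> \<mu>) - B \<Longrightarrow> 0 \<le> t \<Longrightarrow> (\<integral>x. f x \<partial>\<omega> t) = 0"
proof -
  interpret prob_space "\<P> \<mu>" by (rule prob_space_law[OF \<mu>])
  define S where "S k \<omega> = (\<Sum>i<4 ^ k. \<integral>x. f x \<partial>\<omega> (real (Suc i) / 2 ^ k)) / 2 ^ k" for k :: nat and \<omega> :: "real \<Rightarrow> 'a measure"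
  have f_nonneg: "0 \<le> (\<integral>x. f x \<partial>\<nu>)" for \<nu> using f by (auto intro!: integral_nonneg_AE)
  have S_nonneg: "0 \<le> S k \<omega>" for k \<omega> using f_nonneg by (simp add: S_def sum_nonneg)
  have S_meas [measurable]: "S k \<in> borel_measurable (\<P> \<mu>)" for k
    unfolding S_def by (intro borel_measurable_divide borel_measurable_sum measurable_integral_coordinate[OF \<mu>] f) auto
  define C where "C n = {\<omega> \<in> space (\<P> \<mu>). \<forall>k\<in>{n..}. 1 / real (Suc n) \<le> S k \<omega>}" for n
  have C_sets [measurable]: "C n \<in> sets (\<P> \<mu>)" for n unfolding C_def by measurable
  have C_bound: "measure (\<P> \<mu>) (C n) \<le> 1 - e" for n
  proof -
    have "measure (\<P> \<mu>) (C n) \<le> 1 - e + exp (- \<theta> / real (Suc n))" if \<theta>: "0 < \<theta>" for \<theta>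
    proof -
      have "\<forall>\<^sub>F k in sequentially. n \<le> k" by (rule eventually_ge_at_top)
      with lower[OF \<theta>] have "\<forall>\<^sub>F k in sequentially. n \<le> k \<and> e \<le> (\<integral>\<omega>. exp (- \<theta> * S k \<omega>) \<partial>\<P> \<mu>)"
        unfolding S_def by eventually_elim simp
      then obtain k where k: "n \<le> k" "e \<le> (\<integral>\<omega>. exp (- \<theta> * S k \<omega>) \<partial>\<P> \<mu>)"
        by (auto simp: eventually_sequentially)
      have "(\<integral>\<omega>. exp (- \<theta> * S k \<omega>) \<partial>\<P> \<mu>) \<le> (\<integral>\<omega>. 1 - indicator (C n) \<omega> + exp (- \<theta> / real (Suc n)) \<partial>\<P> \<mu>)"
      proof (rule integral_mono)
        show "integrable (\<P> \<mu>) (\<lambda>\<omega>. exp (- \<theta> * S k \<omega>))"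
          using \<theta> S_nonneg by (intro integrable_const_bound[where B = 1]) auto
        show "integrable (\<P> \<mu>) (\<lambda>\<omega>. 1 - indicator (C n) \<omega> + exp (- \<theta> / real (Suc n)))"
          by (intro Bochner_Integration.integrable_add Bochner_Integration.integrable_diff integrable_const integrable_real_indicator)
            (auto simp: less_top[symmetric] C_sets)
        fix \<omega> assume "\<omega> \<in> space (\<P> \<mu>)"
        show "exp (- \<theta> * S k \<omega>) \<le> 1 - indicator (C n) \<omega> + exp (- \<theta> / real (Suc n))"
        proof (cases "\<omega> \<in> C n")
          case True
          then have "1 / real (Suc n) \<le> S k \<omega>" using k(1) by (auto simp: C_def)
          from mult_left_mono[OF this, of \<theta>] \<theta> show ?thesis using True by simp
        next
          case False
          have "exp (- \<theta> * S k \<omega>) \<le> 1" using \<theta> S_nonneg[of k \<omega>] by simp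
          moreover have "indicator (C n) \<omega> = (0 :: real)" using False by simp
          ultimately show ?thesis using exp_ge_zero[of "- \<theta> / real (Suc n)"] by linarith
        qed
      qed
      also have "\<dots> = 1 - measure (\<P> \<mu>) (C n) + exp (- \<theta> / real (Suc n))"
        using C_sets[of n] by (simp add: prob_space less_top[symmetric] Bochner_Integration.integral_add Bochner_Integration.integral_diff)
      finally show ?thesis using k(2) by simp
    qed
    moreover have "((\<lambda>\<theta>. 1 - e + exp (- \<theta> / real (Suc n))) \<longlongrightarrow> 1 - e + 0) at_top"
    proof (intro tendsto_intros filterlim_compose[OF exp_at_bot])
      have "filterlim (\<lambda>\<theta>. \<theta> * (1 / real (Suc n))) at_top at_top"
        by (rule filterlim_at_top_mult_tendsto_pos[OF tendsto_const _ filterlim_ident]) auto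
      then show "filterlim (\<lambda>\<theta>. - \<theta> / real (Suc n)) at_bot at_top"
        by (simp add: filterlim_uminus_at_bot)
    qed
    ultimately show ?thesis
      by (intro tendsto_lowerbound[of "\<lambda>\<theta>. 1 - e + exp (- \<theta> / real (Suc n))" _ at_top])
        (auto intro: eventually_mono[OF eventually_gt_at_top[of 0]])
  qed
  have C_inc: "incseq C"
  proof (rule incseq_SucI, rule subsetI)
    fix n \<omega> assume \<omega>: "\<omega> \<in> C n"
    have "1 / real (Suc (Suc n)) \<le> 1 / real (Suc n)" by (simp add: field_simps)
    then show "\<omega> \<in> C (Suc n)" using \<omega> unfolding C_def by (auto intro: order_trans)
  qed
  define B where "B = (\<Union>n. C n)"
  show ?thesis
  proof (rule that[of B])
    show "B \<in> sets (\<P> \<mu>)" by (simp add: B_def C_sets)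
    have "(\<lambda>n. measure (\<P> \<mu>) (C n)) \<longlonglongrightarrow> measure (\<P> \<mu>) B"
      unfolding B_def by (rule finite_Lim_measure_incseq) (auto simp: C_inc C_sets)
    then show "measure (\<P> \<mu>) B \<le> 1 - e"
      by (rule LIMSEQ_le_const2) (auto simp: C_bound)
    fix \<omega> t assume \<omega>: "\<omega> \<in> space (\<P> \<mu>) - B" and t: "0 \<le> (t :: real)"
    show "(\<integral>x. f x \<partial>\<omega> t) = 0"
    proof (rule ccontr)
      assume "(\<integral>x. f x \<partial>\<omega> t) \<noteq> 0"
      then have pos: "0 < (\<integral>x. f x \<partial>\<omega> t)" using f_nonneg[of "\<omega> t"] by linarith
      define a where "a = (\<integral>x. f x \<partial>\<omega> t) / 2"
      have "\<forall>\<^sub>F r in at_right t. a < (\<integral>x. f x \<partial>\<omega> r)"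
        using \<omega> \<mu> t f pos by (intro order_tendstoD(1)[OF cadlag_integral_right_continuous]) (auto simp: a_def)
      then obtain b where b: "t < b" "\<And>r. t < r \<Longrightarrow> r < b \<Longrightarrow> a < (\<integral>x. f x \<partial>\<omega> r)"
        unfolding eventually_at_right_field by blast
      \<comment> \<open>The second half of the interval from \<open>t\<close> to \<open>b\<close> is
        used, so that \<open>s > 0\<close> even for \<open>t = 0\<close> and the strict lower bound
        holds on all of it.\<close>
      define s d where "s = (t + b) / 2" and "d = (b - t) / 2"
      have sd: "0 < s" "0 < d" "t < s" "s + d = b" using b(1) t by (auto simp: s_def d_def field_simps)
      have a: "0 < a" using pos by (simp add: a_def)
      obtain k0 where k0: "\<And>k. k0 \<le> k \<Longrightarrow> a * d / 2 \<le> S k \<omega>"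
        unfolding S_def
        by (rule dyadic_riemann_sum_lower_bound[of "\<lambda>r. \<integral>x. f x \<partial>\<omega> r" s d a])
          (use f_nonneg sd a b in \<open>auto simp: less_imp_le\<close>)
      have "0 < a * d / 2" using a sd by simp
      then obtain n0 where n0: "1 / real (Suc n0) < a * d / 2" using nat_approx_posE by blast
      \<comment> \<open>One index \<open>n\<close> in \<open>C n\<close> governs both how late the
        sums are taken and how small the threshold is, so both requirements are met by the
        maximum.\<close>
      define n where "n = max k0 n0"
      have "1 / real (Suc n) \<le> 1 / real (Suc n0)" by (simp add: n_def frac_le)
      then have "\<forall>k\<in>{n..}. 1 / real (Suc n) \<le> S k \<omega>"
        using k0 n0 by (fastforce simp: n_def)
      then have "\<omega> \<in> C n" using \<omega> by (simp add: C_def)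
      then show False using \<omega> by (auto simp: B_def)
    qed
  qed
qed

end

section \<open>Compactness of the range\<close>

locale dominated_super_brownian_motion =
  \<Psi>: branching_triple \<Psi> \<alpha> \<beta> \<pi> + \<Phi>: branching_triple "\<lambda>_. \<Phi>" \<alpha>' \<beta>' \<pi>' + cadlag_markov \<P>
  for \<Psi> :: "'a::euclidean_space \<Rightarrow> real \<Rightarrow> real" and \<alpha> \<beta> \<pi> and \<Phi> :: "real \<Rightarrow> real" and \<alpha>' \<beta>' \<pi>'
    and \<P> :: "'a measure \<Rightarrow> (real \<Rightarrow> 'a measure) measure" +
  fixes P :: "'a \<Rightarrow> 'w measure" and W :: "real \<Rightarrow> 'w \<Rightarrow> 'a"
  assumes BM: "\<And>x. standard_brownian_motion (P x) x W"
    and SBM: "super_brownian_motion P W \<Psi> \<P>"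
    and KO: "keller_osserman \<Phi>"
    and \<Phi>_le_\<Psi>: "\<And>x u. 0 \<le> u \<Longrightarrow> \<Phi> u \<le> \<Psi> x u"
begin

text \<open>The order of choices is the point: \<open>\<delta>\<close> fixes \<open>G\<close> and
  hence \<open>f\<close>; only then does \<open>\<theta>\<close> determine the height
  \<open>2 ^ N * \<delta>\<close>, the barrier and the admissible mesh. Neither the half-space nor
  the lower bound depends on \<open>\<theta>\<close>, which is what \<open>never_charged\<close>
  requires.\<close>

lemma half_space_occupation_bound:
  assumes \<mu>: "\<mu> \<in> finite_measures" and b: "b \<in> Basis" and c: "\<bar>c\<bar> = 1" and \<delta>: "0 < \<delta>"
    and supp: "measure_support \<mu> \<subseteq> {x. c * (x \<bullet> b) \<le> a}"
    and gap: "\<And>N. (\<Sum>n<N. 2 * sqrt (2 ^ n * \<delta> / \<Phi> (2 ^ n * \<delta>))) \<le> G"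
    and \<theta>: "0 < \<theta>"
  defines "f \<equiv> \<lambda>x. min 1 (max 0 (c * (x \<bullet> b) - (a + G)))"
  shows "\<forall>\<^sub>F k in sequentially. exp (- \<delta> * measure \<mu> UNIV) \<le>
    (\<integral>\<omega>. exp (- \<theta> * ((\<Sum>i<4 ^ k. \<integral>x. f x \<partial>\<omega> (real (Suc i) / 2 ^ k)) / 2 ^ k)) \<partial>\<P> \<mu>)"
proof -
  have pos: "0 < \<Phi> u" if "0 < u" for u using \<Phi>.keller_osserman_pos[OF KO that] .
  have mono: "\<Phi> u \<le> \<Phi> v" if "0 \<le> u" "u \<le> v" for u v using \<Phi>.mono[OF that] .
  have \<Phi>_pow: "2 ^ n * \<Phi> \<delta> \<le> \<Phi> (2 ^ n * \<delta>)" for n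
  proof (induction n)
    case (Suc n)
    then show ?case using \<Phi>.double_ge[of "2 ^ n * \<delta>"] \<delta> by (simp add: mult_ac)
  qed simp
  \<comment> \<open>The height is such that half of \<open>\<Phi> M\<close> covers
    \<open>\<theta>\<close> and still leaves \<open>\<Phi> \<delta> / 2\<close>, the margin used for
    \<open>\<epsilon>\<close>.\<close>
  obtain N where "(2 * \<theta> + \<Phi> \<delta>) / \<Phi> \<delta> < 2 ^ N" using real_arch_pow[of 2 "(2 * \<theta> + \<Phi> \<delta>) / \<Phi> \<delta>"] by auto
  then have N: "2 * \<theta> + \<Phi> \<delta> \<le> \<Phi> (2 ^ N * \<delta>)"
    using \<Phi>_pow[of N] pos[OF \<delta>] by (simp add: field_simps)
  define M where "M = 2 ^ N * \<delta>"
  obtain w L C4 where w: "\<And>y. \<delta> \<le> w y" "\<And>y. w y \<le> M" "L-lipschitz_on UNIV w"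
    "\<And>y. y \<le> a \<Longrightarrow> w y = \<delta>"
    "\<And>y. a + (\<Sum>n<N. 2 * sqrt (2 ^ n * \<delta> / \<Phi> (2 ^ n * \<delta>))) < y \<Longrightarrow> w y = M"
    "\<And>y. \<exists>p. \<forall>z. w (y + z) \<le> w y + p * z + \<Phi> (w y) / 2 * z\<^sup>2 + C4 * z ^ 4"
    by (rule barrier_exists[where \<Phi> = \<Phi> and N = N and a = a, OF \<delta> pos mono[OF less_imp_le], folded M_def])
      (assumption | rule that; assumption)+
  define g :: "real \<Rightarrow> real" where "g y = min 1 (max 0 (y - (a + G)))" for y
  have g: "0 \<le> g y" "g y \<le> 1" for y by (auto simp: g_def)
  have g_lip: "1-lipschitz_on UNIV g"
    by (rule lipschitz_onI) (auto simp: g_def dist_real_def)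
  \<comment> \<open>Up to the threshold \<open>g\<close> vanishes and
    \<open>\<Phi> \<delta> \<le> \<Phi> (w y)\<close> suffices; beyond it \<open>w\<close> has
    reached its top level \<open>M\<close>.\<close>
  have strict: "\<theta> * g y + \<Phi> \<delta> / 2 \<le> \<Phi> (w y) / 2" for y
  proof (cases "y \<le> a + G")
    case True
    then show ?thesis using mono[OF _ w(1)[of y]] \<delta> by (simp add: g_def)
  next
    case False
    then have "w y = M" using w(5)[of y] gap[of N] by simp
    moreover have "\<theta> * g y \<le> \<theta>" using \<theta> g[of y] by (simp add: mult_left_le)
    ultimately show ?thesis using N by (simp add: M_def)
  qed
  obtain K where K: "0 \<le> K" "\<And>u v. 0 \<le> u \<Longrightarrow> u \<le> v \<Longrightarrow> v \<le> M + 1 \<Longrightarrow> \<Phi> v - \<Phi> u \<le> K * (v - u)"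
    using \<Phi>.lipschitz by metis
  have w_nonneg: "0 \<le> w y" for y using w(1)[of y] \<delta> by simp
  obtain h0 where h0: "0 < h0"
    "\<And>h v x. 0 < h \<Longrightarrow> h \<le> h0 \<Longrightarrow>
      cumulant_solution P W \<Psi> (\<lambda>x. w (c * (x \<bullet> b)) + h * \<theta> * g (c * (x \<bullet> b))) v \<Longrightarrow> v x h \<le> w (c * (x \<bullet> b))"
    by (rule \<Psi>.cumulant_one_step[OF BM b c \<Phi>_le_\<Psi> mono K w_nonneg w(2,3,6) g g_lip less_imp_le[OF \<theta>]
        half_gt_zero[OF pos[OF \<delta>]] strict])
      (assumption | rule that; assumption)+
  define u where "u x = w (c * (x \<bullet> b))" for x :: 'a
  have w_cont: "continuous_on UNIV w" and g_cont: "continuous_on UNIV g"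
    using w(3) g_lip by (auto intro: lipschitz_on_continuous_on)
  have coord_cont: "continuous_on UNIV (\<lambda>x :: 'a. c * (x \<bullet> b))" by (intro continuous_intros)
  have u: "continuous_on UNIV u" "bounded (range u)" "\<And>x. 0 \<le> u x"
    unfolding u_def using w(2) w_nonneg
    by (auto intro!: continuous_on_compose2[OF w_cont coord_cont] boundedI[where B = M])
  have f_g: "f x = g (c * (x \<bullet> b))" for x by (simp add: f_def g_def)
  have f: "continuous_on UNIV f" "bounded (range f)" "\<And>x. 0 \<le> f x" "\<And>x. f x \<le> 1"
    unfolding f_g[abs_def] using g
    by (auto intro!: continuous_on_compose2[OF g_cont coord_cont] boundedI[where B = 1])
  \<comment> \<open>A function vanishing exactly up to level \<open>a\<close> serves to show that
    \<mu> is carried by the part of space where the barrier equals \<delta>.\<close>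
  have u\<mu>: "(\<integral>x. u x \<partial>\<mu>) = \<delta> * measure \<mu> UNIV"
  proof -
    interpret finite_measure \<mu> using \<mu> by (simp add: finite_measures_def)
    have sets: "sets \<mu> = sets borel" using \<mu> by (simp add: finite_measures_def)
    have space: "space \<mu> = UNIV" using sets_eq_imp_space_eq[OF sets] by simp
    define q where "q x = min 1 (max 0 (c * (x \<bullet> b) - a))" for x :: 'a
    have q: "continuous_on UNIV q" "bounded (range q)" "\<And>x. 0 \<le> q x"
      unfolding q_def by (auto intro!: continuous_intros boundedI[where B = 1])
    have q_int: "integrable \<mu> q"
      using q(1) by (intro finite_measures_integrable[OF \<mu>, where B = 1])
        (auto intro: borel_measurable_continuous_onI simp: q_def)
    have "measure_support \<mu> \<subseteq> {x. q x = 0}" using supp by (auto simp: q_def)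
    then have "(\<integral>x. q x \<partial>\<mu>) = 0" using measure_support_subset_zeros_iff[OF \<mu> q] by simp
    then have "AE x in \<mu>. q x = 0" using integral_nonneg_eq_0_iff_AE[OF q_int] q(3) by simp
    then have "AE x in \<mu>. u x = \<delta>"
      by eventually_elim (auto simp: q_def u_def min_def max_def intro!: w(4) split: if_splits)
    moreover have "u \<in> borel_measurable \<mu>"
      using u(1) sets by (simp add: borel_measurable_continuous_onI cong: measurable_cong_sets)
    ultimately have "(\<integral>x. u x \<partial>\<mu>) = (\<integral>x. \<delta> \<partial>\<mu>)" by (intro integral_cong_AE) auto
    then show ?thesis by (simp add: space)
  qed
  have bound: "exp (- \<delta> * measure \<mu> UNIV) \<le>
    (\<integral>\<omega>. exp (- \<theta> * ((\<Sum>i<4 ^ k. \<integral>x. f x \<partial>\<omega> (real (Suc i) / 2 ^ k)) / 2 ^ k)) \<partial>\<P> \<mu>)"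
    if k: "1 / 2 ^ k \<le> h0" for k
  proof -
    define h :: real where "h = 1 / 2 ^ k"
    have h: "0 < h" "h \<le> h0" using k by (auto simp: h_def)
    have f': "continuous_on UNIV (\<lambda>x. h * \<theta> * f x)" "bounded (range (\<lambda>x. h * \<theta> * f x))" "\<And>x. 0 \<le> h * \<theta> * f x"
    proof -
      show "bounded (range (\<lambda>x. h * \<theta> * f x))"
        using f(3,4) h \<theta> by (intro boundedI[where B = "h * \<theta>"]) (auto simp: abs_mult mult_left_le)
    qed (use f h \<theta> in \<open>auto intro!: continuous_intros\<close>)
    have step: "exp (- (\<integral>x. u x \<partial>\<nu>)) \<le> (\<integral>\<eta>. exp (- (\<integral>x. u x + h * \<theta> * f x \<partial>\<eta> h)) \<partial>\<P> \<nu>)"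
      if \<nu>: "\<nu> \<in> finite_measures" for \<nu>
    proof -
      have "(\<lambda>x. u x + h * \<theta> * f x) \<in> borel_measurable borel"
        using u(1) f'(1) by (intro borel_measurable_continuous_onI continuous_on_add)
      moreover have "bounded (range (\<lambda>x. u x + h * \<theta> * f x))" by (rule bounded_plus_comp[OF u(2) f'(2)])
      moreover have "0 \<le> u x + h * \<theta> * f x" for x using u(3) f'(3) by (simp add: add_nonneg_nonneg)
      ultimately obtain v where v: "cumulant_solution P W \<Psi> (\<lambda>x. u x + h * \<theta> * f x) v"
        "\<And>\<mu> t. \<mu> \<in> finite_measures \<Longrightarrow> 0 \<le> t \<Longrightarrow>
          (\<integral>\<omega>. exp (- (\<integral>x. u x + h * \<theta> * f x \<partial>\<omega> t)) \<partial>\<P> \<mu>) = exp (- (\<integral>x. v x t \<partial>\<mu>))"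
        using SBM[unfolded super_brownian_motion_def, THEN conjunct2, rule_format, of "\<lambda>x. u x + h * \<theta> * f x"] by blast
      have "v x h \<le> u x" for x
        using h0(2)[OF h v(1)[unfolded u_def f_g]] by (simp add: u_def)
      then have "(\<integral>x. v x h \<partial>\<nu>) \<le> (\<integral>x. u x \<partial>\<nu>)"
        using u(3) \<nu> w(2) w_nonneg u(1)
        by (intro integral_mono' finite_measures_integrable[where B = M])
          (auto simp: u_def intro: borel_measurable_continuous_onI)
      then show ?thesis using v(2)[OF \<nu>, of h] h(1) by simp
    qed
    have "exp (- \<delta> * measure \<mu> UNIV) = exp (- (\<integral>x. u x \<partial>\<mu>))" by (simp add: u\<mu>)
    also have "\<dots> \<le> (\<integral>\<omega>. exp (- (\<Sum>i<4 ^ k. \<integral>x. h * \<theta> * f x \<partial>\<omega> (real (Suc i) * h))) \<partial>\<P> \<mu>)"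
      using h(1) by (intro multi_step[OF \<mu>] u f' step) auto
    also have "\<dots> = (\<integral>\<omega>. exp (- \<theta> * ((\<Sum>i<4 ^ k. \<integral>x. f x \<partial>\<omega> (real (Suc i) / 2 ^ k)) / 2 ^ k)) \<partial>\<P> \<mu>)"
      by (intro Bochner_Integration.integral_cong refl)
        (simp add: h_def sum_distrib_left[symmetric] sum_divide_distrib[symmetric] del: of_nat_Suc)
    finally show ?thesis .
  qed
  obtain k0 where "1 / h0 < 2 ^ k0" using real_arch_pow[of 2 "1 / h0"] by auto
  then have "1 / 2 ^ k0 < h0" using h0(1) by (simp add: field_simps)
  show ?thesis
    unfolding eventually_sequentially
  proof (intro exI allI impI bound)
    fix k assume "k0 \<le> k"
    then have "(1 :: real) / 2 ^ k \<le> 1 / 2 ^ k0" by (intro divide_left_mono power_increasing) auto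
    then show "1 / 2 ^ k \<le> h0" using \<open>1 / 2 ^ k0 < h0\<close> by linarith
  qed
qed

text \<open>The bound \<open>R\<close> depends on \<delta> through \<open>G\<close> but is the same
  for all paths outside \<open>B\<close>; a smaller \<delta> improves the bound on the exceptional
  probability.\<close>

lemma supports_in_half_space:
  assumes \<mu>: "\<mu> \<in> finite_measures" and b: "b \<in> Basis" and c: "\<bar>c\<bar> = 1" and \<delta>: "0 < \<delta>"
    and supp: "measure_support \<mu> \<subseteq> {x. c * (x \<bullet> b) \<le> a}"
  shows "\<exists>B R. B \<in> sets (\<P> \<mu>) \<and> measure (\<P> \<mu>) B \<le> 1 - exp (- \<delta> * measure \<mu> UNIV) \<and>
    (\<forall>\<omega>\<in>space (\<P> \<mu>) - B. \<forall>t\<ge>0. measure_support (\<omega> t) \<subseteq> {x. c * (x \<bullet> b) \<le> R})"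
proof -
  obtain G where gap: "\<And>N. (\<Sum>n<N. 2 * sqrt (2 ^ n * \<delta> / \<Phi> (2 ^ n * \<delta>))) \<le> G"
    using \<Phi>.keller_osserman_gap_sum[OF KO \<delta>] by metis
  define f where "f x = min 1 (max 0 (c * (x \<bullet> b) - (a + G)))" for x :: 'a
  have f: "continuous_on UNIV f" "bounded (range f)" "\<And>x. 0 \<le> f x"
    unfolding f_def by (auto intro!: continuous_intros boundedI[where B = 1])
  obtain B where B: "B \<in> sets (\<P> \<mu>)" "measure (\<P> \<mu>) B \<le> 1 - exp (- \<delta> * measure \<mu> UNIV)"
    "\<And>\<omega> t. \<omega> \<in> space (\<P> \<mu>) - B \<Longrightarrow> 0 \<le> t \<Longrightarrow> (\<integral>x. f x \<partial>\<omega> t) = 0"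
    by (rule never_charged[OF \<mu> f half_space_occupation_bound[OF \<mu> b c \<delta> supp gap, folded f_def]])
      (assumption | rule that; assumption)+
  have "measure_support (\<omega> t) \<subseteq> {x. c * (x \<bullet> b) \<le> a + G}" if "\<omega> \<in> space (\<P> \<mu>) - B" "0 \<le> t" for \<omega> t
  proof -
    have "\<omega> t \<in> finite_measures" using that \<mu> by (auto intro: cadlag_pathD)
    then have "measure_support (\<omega> t) \<subseteq> {x. f x = 0}"
      using measure_support_subset_zeros_iff[OF _ f] B(3)[OF that] by simp
    also have "\<dots> \<subseteq> {x. c * (x \<bullet> b) \<le> a + G}"
      by (auto simp: f_def min_def max_def split: if_splits)
    finally show ?thesis .
  qed
  with B(1,2) show ?thesis by blast
qed

text \<open>A union bound over the signed basis directions confines all supports to one box, up to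
  probability of order \<delta>. The box depends on \<delta>, but the compactness event does not, so
  \<delta> can tend to 0. General \<open>I\<close> and \<open>D\<close> cover bounded and unbounded
  time at once.\<close>

lemma compact_range_almost_surely:
  assumes \<mu>: "\<mu> \<in> compactly_supported_measures" and D: "countable D" "D \<subseteq> I" "I \<subseteq> {0..}"
    and dense: "\<And>s \<epsilon>. s \<in> I \<Longrightarrow> 0 < \<epsilon> \<Longrightarrow> \<exists>q\<in>D. s \<le> q \<and> q < s + \<epsilon>"
  shows "measure (\<P> \<mu>) {\<omega> \<in> space (\<P> \<mu>). compact (closure (\<Union>s\<in>I. measure_support (\<omega> s)))} = 1"
proof -
  have fin: "\<mu> \<in> finite_measures" and "compact (measure_support \<mu>)"
    using \<mu> by (auto simp: compactly_supported_measures_def)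
  then obtain a where a: "\<And>x. x \<in> measure_support \<mu> \<Longrightarrow> norm x \<le> a"
    using compact_imp_bounded bounded_iff by metis
  interpret prob_space "\<P> \<mu>" by (rule prob_space_law[OF fin])
  let ?E = "{\<omega> \<in> space (\<P> \<mu>). compact (closure (\<Union>s\<in>I. measure_support (\<omega> s)))}"
  have E: "?E \<in> sets (\<P> \<mu>)" by (rule measurable_compact_range[OF fin D dense])
  define J :: "('a \<times> real) set" where "J = Basis \<times> {1, -1}"
  have J: "finite J" by (simp add: J_def)
  have bound: "measure (\<P> \<mu>) (space (\<P> \<mu>) - ?E) \<le> real (card J) * (1 - exp (- \<delta> * measure \<mu> UNIV))"
    if \<delta>: "0 < \<delta>" for \<delta>
  proof -
    have "\<forall>j\<in>J. \<exists>B R. B \<in> sets (\<P> \<mu>) \<and> measure (\<P> \<mu>) B \<le> 1 - exp (- \<delta> * measure \<mu> UNIV) \<and>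
      (\<forall>\<omega>\<in>space (\<P> \<mu>) - B. \<forall>t\<ge>0. measure_support (\<omega> t) \<subseteq> {x. snd j * (x \<bullet> fst j) \<le> R})"
    proof
      fix j assume "j \<in> J"
      then have j: "fst j \<in> Basis" "\<bar>snd j\<bar> = 1" by (auto simp: J_def)
      have "measure_support \<mu> \<subseteq> {x. snd j * (x \<bullet> fst j) \<le> a}"
      proof
        fix x assume "x \<in> measure_support \<mu>"
        then have "\<bar>x \<bullet> fst j\<bar> \<le> a" using a[of x] Basis_le_norm[OF j(1), of x] by simp
        moreover have "snd j * (x \<bullet> fst j) \<le> \<bar>snd j\<bar> * \<bar>x \<bullet> fst j\<bar>"
          by (metis abs_ge_self abs_mult)
        ultimately show "x \<in> {x. snd j * (x \<bullet> fst j) \<le> a}" using j(2) by simp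
      qed
      then show "\<exists>B R. B \<in> sets (\<P> \<mu>) \<and> measure (\<P> \<mu>) B \<le> 1 - exp (- \<delta> * measure \<mu> UNIV) \<and>
        (\<forall>\<omega>\<in>space (\<P> \<mu>) - B. \<forall>t\<ge>0. measure_support (\<omega> t) \<subseteq> {x. snd j * (x \<bullet> fst j) \<le> R})"
        by (rule supports_in_half_space[OF fin j \<delta>])
    qed
    then obtain B R where BR: "\<And>j. j \<in> J \<Longrightarrow> B j \<in> sets (\<P> \<mu>)"
      "\<And>j. j \<in> J \<Longrightarrow> measure (\<P> \<mu>) (B j) \<le> 1 - exp (- \<delta> * measure \<mu> UNIV)"
      "\<And>j \<omega> t. j \<in> J \<Longrightarrow> \<omega> \<in> space (\<P> \<mu>) - B j \<Longrightarrow> 0 \<le> t \<Longrightarrow>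
        measure_support (\<omega> t) \<subseteq> {x. snd j * (x \<bullet> fst j) \<le> R j}"
      by metis
    \<comment> \<open>Sign 1 gives the upper faces of the box; sign -1 bounds
      \<open>- (x \<bullet> b)\<close>, hence the minus in the lower corner.\<close>
    define K where "K = cbox (\<Sum>b\<in>Basis. - R (b, -1) *\<^sub>R b) (\<Sum>b\<in>Basis. R (b, 1) *\<^sub>R b)"
    have "space (\<P> \<mu>) - ?E \<subseteq> (\<Union>j\<in>J. B j)"
    proof (rule ccontr)
      assume "\<not> space (\<P> \<mu>) - ?E \<subseteq> (\<Union>j\<in>J. B j)"
      then obtain \<omega> where \<omega>: "\<omega> \<in> space (\<P> \<mu>)" "\<omega> \<notin> ?E" "\<And>j. j \<in> J \<Longrightarrow> \<omega> \<notin> B j" by blast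
      have "measure_support (\<omega> s) \<subseteq> K" if "s \<in> I" for s
      proof
        fix x assume x: "x \<in> measure_support (\<omega> s)"
        have le: "snd j * (x \<bullet> fst j) \<le> R j" if "j \<in> J" for j
          using BR(3)[of j \<omega> s] that \<omega> x D \<open>s \<in> I\<close> by auto
        have "x \<bullet> i \<le> R (i, 1)" "- R (i, -1) \<le> x \<bullet> i" if "i \<in> Basis" for i
          using le[of "(i, 1)"] le[of "(i, -1)"] that by (auto simp: J_def)
        then show "x \<in> K"
          by (auto simp: K_def mem_box simp del: scaleR_minus_left)
      qed
      then have "closure (\<Union>s\<in>I. measure_support (\<omega> s)) \<subseteq> K"
        unfolding K_def by (intro closure_minimal closed_cbox) auto
      then have "compact (closure (\<Union>s\<in>I. measure_support (\<omega> s)))"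
        by (auto simp: compact_eq_bounded_closed K_def intro: bounded_subset[OF bounded_cbox])
      then show False using \<omega> by simp
    qed
    then have "measure (\<P> \<mu>) (space (\<P> \<mu>) - ?E) \<le> measure (\<P> \<mu>) (\<Union>j\<in>J. B j)"
      using BR(1) J by (intro finite_measure_mono) auto
    also have "\<dots> \<le> (\<Sum>j\<in>J. measure (\<P> \<mu>) (B j))"
      using BR(1) J by (intro finite_measure_subadditive_finite) auto
    also have "\<dots> \<le> real (card J) * (1 - exp (- \<delta> * measure \<mu> UNIV))"
      using BR(2) by (intro sum_bounded_above) auto
    finally show ?thesis .
  qed
  have "((\<lambda>\<delta>. real (card J) * (1 - exp (- \<delta> * measure \<mu> UNIV))) \<longlongrightarrow> real (card J) * (1 - exp (- 0 * measure \<mu> UNIV))) (at_right 0)"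
    by (intro tendsto_intros)
  then have "measure (\<P> \<mu>) (space (\<P> \<mu>) - ?E) \<le> real (card J) * (1 - exp (- 0 * measure \<mu> UNIV))"
  proof (rule tendsto_lowerbound)
    show "\<forall>\<^sub>F \<delta> in at_right 0. measure (\<P> \<mu>) (space (\<P> \<mu>) - ?E) \<le> real (card J) * (1 - exp (- \<delta> * measure \<mu> UNIV))"
      by (rule eventually_mono[OF eventually_at_right_less]) (rule bound)
  qed simp
  then have "measure (\<P> \<mu>) (space (\<P> \<mu>) - ?E) \<le> 0" by simp
  then have "measure (\<P> \<mu>) (space (\<P> \<mu>) - ?E) = 0" by (intro antisym measure_nonneg)
  then show ?thesis using prob_compl[OF E] by simp
qed

end

theorem corollary3p4:
  fixes P :: "'a::euclidean_space \<Rightarrow> 'w measure"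
    and W :: "real \<Rightarrow> 'w \<Rightarrow> 'a"
    and \<Psi> :: "'a \<Rightarrow> real \<Rightarrow> real"
    and \<P> :: "'a measure \<Rightarrow> (real \<Rightarrow> 'a measure) measure"
    and \<Phi> :: "real \<Rightarrow> real"
  assumes "\<And>x. standard_brownian_motion (P x) x W"
    and "branching_mechanism \<Psi>"
    and "super_brownian_motion P W \<Psi> \<P>"
    and "spatially_constant_branching_mechanism (\<lambda>_::'a. \<Phi>)"
    and "keller_osserman \<Phi>"
    and "\<And>x u. 0 \<le> u \<Longrightarrow> \<Phi> u \<le> \<Psi> x u"
  shows "(\<forall>\<mu>\<in>compactly_supported_measures. \<forall>t>0.
            measure (\<P> \<mu>) {\<omega> \<in> space (\<P> \<mu>). compact (range_up_to t \<omega>)} = 1) \<and>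
         (\<forall>\<mu>\<in>compactly_supported_measures.
            measure (\<P> \<mu>) {\<omega> \<in> space (\<P> \<mu>). compact (total_range \<omega>)} = 1)"
proof -
  obtain \<alpha> \<beta> \<pi> where \<Psi>: "branching_triple \<Psi> \<alpha> \<beta> \<pi>"
    using branching_mechanism_triple[OF assms(2)] .
  obtain \<alpha>' \<beta>' \<pi>' where \<Phi>: "branching_triple (\<lambda>_::'a. \<Phi>) \<alpha>' \<beta>' \<pi>'"
    using spatially_constant_branching_triple[OF assms(4)] .
  have "cadlag_markov \<P>"
    using assms(3) by (simp add: cadlag_markov_def super_brownian_motion_def)
  then interpret dominated_super_brownian_motion \<Psi> \<alpha> \<beta> \<pi> \<Phi> \<alpha>' \<beta>' \<pi>' \<P> P W
    using \<Psi> \<Phi> assms by (simp add: dominated_super_brownian_motion_def dominated_super_brownian_motion_axioms_def)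
  show ?thesis
    unfolding range_up_to_def total_range_def
  proof (intro conjI ballI allI impI)
    fix \<mu> :: "'a measure" and t :: real
    assume \<mu>: "\<mu> \<in> compactly_supported_measures" and t: "0 < t"
    show "measure (\<P> \<mu>) {\<omega> \<in> space (\<P> \<mu>). compact (closure (\<Union>s\<in>{0..t}. measure_support (\<omega> s)))} = 1"
    \<comment> \<open>The endpoint \<open>t\<close> has to be added by hand: no time in
      \<open>{0..t}\<close> lies to its right.\<close>
    proof (rule compact_range_almost_surely[OF \<mu>, where D = "insert t (\<rat> \<inter> {0..t})"])
      fix s \<epsilon> :: real assume s: "s \<in> {0..t}" "0 < \<epsilon>"
      show "\<exists>q\<in>insert t (\<rat> \<inter> {0..t}). s \<le> q \<and> q < s + \<epsilon>"
      proof (cases "s = t")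
        case False
        then obtain q where "q \<in> \<rat>" "s < q" "q < min t (s + \<epsilon>)"
          using Rats_dense_in_real[of s "min t (s + \<epsilon>)"] s by auto
        then show ?thesis using s by (intro bexI[of _ q]) auto
      qed (use s in auto)
    qed (use t in \<open>auto intro: countable_subset[OF _ countable_rat]\<close>)
  next
    fix \<mu> :: "'a measure"
    assume \<mu>: "\<mu> \<in> compactly_supported_measures"
    show "measure (\<P> \<mu>) {\<omega> \<in> space (\<P> \<mu>). compact (closure (\<Union>s\<in>{0..}. measure_support (\<omega> s)))} = 1"
    proof (rule compact_range_almost_surely[OF \<mu>, where D = "\<rat> \<inter> {0..}"])
      fix s \<epsilon> :: real assume s: "s \<in> {0..}" "0 < \<epsilon>"
      then obtain q where "q \<in> \<rat>" "s < q" "q < s + \<epsilon>"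
        using Rats_dense_in_real[of s "s + \<epsilon>"] by auto
      then show "\<exists>q\<in>\<rat> \<inter> {0..}. s \<le> q \<and> q < s + \<epsilon>" using s by (intro bexI[of _ q]) auto
    qed (auto intro: countable_subset[OF _ countable_rat])
  qed
qed

end
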